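(* Suppose $d\ge2$ and $p=1$, and that $f$ also satisfies (Lip) and (Hilb). Then, for all realizations $\{X_i\}$ in an event of probability $1$, $$\lim_{n\to\infty}\min_{\mathbf v\in V_n(a,b)}H_n(\mathbf v)=\min_{\gamma\in\Omega(a,b)}F(\gamma).$$ Moreover, suppose now that $f$ in addition satisfies (TrIneq) and (Pythag) for some $1<\alpha<\sqrt2$, and that $\epsilon_n=n^{-\delta}$ where, for some $0<\eta<1$ and this $\alpha$, $$\delta>\max\big\{[(2-\alpha^2)\eta+d]^{-1},\ [\alpha(d-1)+1]^{-1}\big\}.$$ Then, for all realizations $\{X_i\}$ in an event of probability $1$: let $\mathbf v^{(n)}\in\operatorname{argmin}H_n$ be optimal discrete paths ($n$ large), with linear interpolations $l_{\mathbf v^{(n)}}$. For any subsequence of $\{l_{\mathbf v^{(n)}}\}$, and correspondingly of $\{\mathbf v^{(n)}\}$, there is a further subsequence along which the linear paths converge uniformly to a limit path $\gamma\in\operatorname{argmin}F$ and the discrete paths converge in the Hausdorff metric to $S_\gamma$. If $F$ has a unique (up to reparametrization) minimizer $\gamma$, the whole sequence of discrete paths converges: $\lim_{n\to\infty}d_{haus}(\mathbf v^{(n)},S_\gamma)=0$.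
   Context: Let $D\subset\mathbb R^d$ be the closure of a nonempty open, bounded, convex set; $|\cdot|$ is the Euclidean norm. The function $f:D\times\mathbb R^d\to[0,\infty)$ satisfies, for some $p\ge1$: (A0) $f$ is continuous on $D\times\mathbb R^d$ and $C^1$ on $D\times(\mathbb R^d\setminus\{0\})$; (A1) $f(x,v)$ is convex in $v$; (A2) $f(x,\lambda v)=\lambda^pf(x,v)$ for $\lambda>0$; (A3) there are $m_1,m_2>0$ with $m_1|v|^p\le f(x,v)\le m_2|v|^p$ for all $x\in D$, $v\in\mathbb R^d$. Fix $a,b\in D$. For $u,v\in D$, $\Omega(u,v)$ is the set of Lipschitz paths $\gamma:[0,1]\to D$ with $\gamma(0)=u$, $\gamma(1)=v$; $F(\gamma)=\int_0^1f(\gamma(t),\dot\gamma(t))\,dt$ (the minimum over $\Omega(a,b)$ is attained; $\operatorname{argmin}F$ refers to $\Omega(a,b)$). Additional conditions on $f$: - (Lip): there is $c$ with $|f(x,v)-f(y,v)|\le c|x-y||v|^p$ for all $x,y\in D$, $v\in\mathbb R^d$. - (Hilb): for each $x\in D$ and all $u,v\in D$, $\inf_{\gamma\in\Omega(u,v)}\int_0^1f(x,\dot\gamma(t))\,dt=f(x,v-u)$. - (TrIneq): for each $x\in D$ and all $u,v,w\in\mathbb R^d$, $f(x,v-w)\le f(x,v-u)+f(x,u-w)$. - (Pythag) with exponent $\alpha>1$: for every $c>0$ there is $C=C(\alpha,f,c)>0$ such that, whenever $0<r<1$ and $u,v,w$ are points with $|u-w|,|v-w|,|u-v|<\eta'$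 for some $\eta'<1$, with distance from $w$ to the line segment between $u$ and $v$ at least $r$, and with $|u-v|\le c\,r^{1/\alpha}$, one has $f(x,w-u)+f(x,v-w)\ge f(x,v-u)+Cr^\alpha$ for all $x\in D$. Let $X_1,X_2,\dots$ be i.i.d. points in $D$ whose law has Lebesgue density $\rho$ satisfying $c_0\le\rho(x)\le c_0^{-1}$ for all $x\in D$ and some $c_0>0$. Put $\mathcal X_n=\{X_1,\dots,X_n\}$. Throughout (including in the second part), $\epsilon_n>0$ satisfies $\lim_n\epsilon_n=0$ and $\limsup_{n\to\infty}\frac{(\log n)^{1/d}}{n^{1/d}}\frac1{\epsilon_n}=0$. The graph $\mathcal G_n(a,b)$ has vertex set $\mathcal X_n\cup\{a,b\}$, with an edge between $u,v$ iff $0<|u-v|<\epsilon_n$. $V_n(a,b)$ is the set of paths $\mathbf v=(v_0,\dots,v_m)$ ($m\ge1$ steps, $m$ arbitrary) of vertices with $v_0=a$, $v_m=b$ and an edge between $v_i$ and $v_{i+1}$ for $0\le i<m$; almost surely $V_n(a,b)\neq\emptyset$ for all large $n$. For $\mathbf v=(v_0,\dots,v_m)\in V_n(a,b)$ put $H_n(\mathbf v)=\frac1m\sum_{i=0}^{m-1}f(v_i,m(v_{i+1}-v_i))$, and let $l_{\mathbf v}\in\Omega(a,b)$ be the piecewise linear path $l_{\mathbf v}(t)=(1-(mt-i))v_i+(mt-i)v_{i+1}$ for $i/m\le t\le(i+1)/m$. For $\gamma\in\Omega(a,b)$, $S_\gamma=\{\gamma(t):0\le t\le1\}$. For compact $A,B\subset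 D$, the Hausdorff metric is $d_{haus}(A,B)=\max\{\sup_{x\in A}\inf_{y\in B}|x-y|,\ \sup_{y\in B}\inf_{x\in A}|x-y|\}$; a discrete path $(v_0,\dots,v_m)$ is identified with the set $\{v_0,\dots,v_m\}$ in Hausdorff statements. "$F$ has a unique (up to reparametrization) minimizer $\gamma$" means that $\gamma\in\operatorname{argmin}F$ and every element of $\operatorname{argmin}F$ is of the form $\gamma\circ s$ with $s:[0,1]\to[0,1]$ nondecreasing, Lipschitz, $s(0)=0$, $s(1)=1$. *)

theory Defs
  imports "HOL-Probability.Probability"
begin

section \<open>Domain and integrand\<close>

definition convex_body :: "'a::euclidean_space set \<Rightarrow> bool" where
  "convex_body D \<longleftrightarrow> (\<exists>U. open U \<and> U \<noteq> {} \<and> bounded U \<and> convex U \<and> D = closure U)"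

text \<open>The set \<open>D \<times> (UNIV - {0})\<close> is not open, so the derivative is taken within it. For a
  convex body \<open>D\<close> this derivative is unique also at boundary points, and it is required to be
  continuous up to the boundary.\<close>

definition cond_A0 :: "'a::euclidean_space set \<Rightarrow> ('a \<Rightarrow> 'a \<Rightarrow> real) \<Rightarrow> bool" where
  "cond_A0 D f \<longleftrightarrow>
     continuous_on (D \<times> UNIV) (\<lambda>(x, v). f x v) \<and>
     (\<exists>f' :: 'a \<times> 'a \<Rightarrow> ('a \<times> 'a) \<Rightarrow>\<^sub>L real.
        (\<forall>z \<in> D \<times> (UNIV - {0}).
           ((\<lambda>(x, v). f x v) has_derivative blinfun_apply (f' z)) (at z within D \<times> (UNIV - {0}))) \<and>
        continuous_on (D \<times> (UNIV - {0})) f')"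

definition cond_A1 :: "'a::euclidean_space set \<Rightarrow> ('a \<Rightarrow> 'a \<Rightarrow> real) \<Rightarrow> bool" where
  "cond_A1 D f \<longleftrightarrow> (\<forall>x\<in>D. convex_on UNIV (f x))"

definition cond_A2 :: "real \<Rightarrow> 'a::euclidean_space set \<Rightarrow> ('a \<Rightarrow> 'a \<Rightarrow> real) \<Rightarrow> bool" where
  "cond_A2 p D f \<longleftrightarrow> (\<forall>x\<in>D. \<forall>v. \<forall>l>0. f x (l *\<^sub>R v) = l powr p * f x v)"

definition cond_A3 :: "real \<Rightarrow> 'a::euclidean_space set \<Rightarrow> ('a \<Rightarrow> 'a \<Rightarrow> real) \<Rightarrow> bool" where
  "cond_A3 p D f \<longleftrightarrow>
     (\<exists>m1>0. \<exists>m2>0. \<forall>x\<in>D. \<forall>v. m1 * norm v powr p \<le> f x v \<and> f x v \<le> m2 * norm v powr p)"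

definition integrand :: "real \<Rightarrow> 'a::euclidean_space set \<Rightarrow> ('a \<Rightarrow> 'a \<Rightarrow> real) \<Rightarrow> bool" where
  "integrand p D f \<longleftrightarrow>
     p \<ge> 1 \<and> (\<forall>x\<in>D. \<forall>v. 0 \<le> f x v) \<and> cond_A0 D f \<and> cond_A1 D f \<and> cond_A2 p D f \<and> cond_A3 p D f"


section \<open>Lipschitz paths and the continuum functional\<close>

text \<open>Paths are total functions on the reals, but only their values on \<open>{0..1}\<close> ever matter. The
  derivative of a Lipschitz path exists almost everywhere; the unspecified value of
  \<^const>\<open>vector_derivative\<close> on the remaining null set does not affect the integrals over
  the (complete) Lebesgue measure.\<close>

definition lip_paths :: "'a::euclidean_space set \<Rightarrow> 'a \<Rightarrow> 'a \<Rightarrow> (real \<Rightarrow> 'a) set" where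
  "lip_paths D u v =
     {\<gamma>. (\<exists>L. L-lipschitz_on {0..1} \<gamma>) \<and> path_image \<gamma> \<subseteq> D \<and> pathstart \<gamma> = u \<and> pathfinish \<gamma> = v}"

definition velocity :: "(real \<Rightarrow> 'a::euclidean_space) \<Rightarrow> real \<Rightarrow> 'a" where
  "velocity \<gamma> t = vector_derivative \<gamma> (at t within {0..1})"

definition path_cost :: "('a::euclidean_space \<Rightarrow> 'a \<Rightarrow> real) \<Rightarrow> (real \<Rightarrow> 'a) \<Rightarrow> real" where
  "path_cost f \<gamma> = (LINT t:{0..1}|lebesgue. f (\<gamma> t) (velocity \<gamma> t))"

definition argmin_set :: "('b \<Rightarrow> real) \<Rightarrow> 'b set \<Rightarrow> 'b set" where
  "argmin_set g S = {x. is_arg_min g (\<lambda>y. y \<in> S) x}"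

definition unique_minimizer ::
    "'a::euclidean_space set \<Rightarrow> ('a \<Rightarrow> 'a \<Rightarrow> real) \<Rightarrow> 'a \<Rightarrow> 'a \<Rightarrow> (real \<Rightarrow> 'a) \<Rightarrow> bool" where
  "unique_minimizer D f a b \<gamma> \<longleftrightarrow>
     \<gamma> \<in> argmin_set (path_cost f) (lip_paths D a b) \<and>
     (\<forall>\<sigma> \<in> argmin_set (path_cost f) (lip_paths D a b).
        \<exists>s :: real \<Rightarrow> real. s ` {0..1} \<subseteq> {0..1} \<and> mono_on {0..1} s \<and>
          (\<exists>L. L-lipschitz_on {0..1} s) \<and> s 0 = 0 \<and> s 1 = 1 \<and>
          (\<forall>t\<in>{0..1}. \<sigma> t = \<gamma> (s t)))"


section \<open>Additional conditions on the integrand\<close>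

definition cond_Lip :: "real \<Rightarrow> 'a::euclidean_space set \<Rightarrow> ('a \<Rightarrow> 'a \<Rightarrow> real) \<Rightarrow> bool" where
  "cond_Lip p D f \<longleftrightarrow>
     (\<exists>c. \<forall>x\<in>D. \<forall>y\<in>D. \<forall>v. \<bar>f x v - f y v\<bar> \<le> c * norm (x - y) * norm v powr p)"

definition cond_Hilb :: "'a::euclidean_space set \<Rightarrow> ('a \<Rightarrow> 'a \<Rightarrow> real) \<Rightarrow> bool" where
  "cond_Hilb D f \<longleftrightarrow>
     (\<forall>x\<in>D. \<forall>u\<in>D. \<forall>v\<in>D.
        (INF \<gamma> \<in> lip_paths D u v. LINT t:{0..1}|lebesgue. f x (velocity \<gamma> t)) = f x (v - u))"

definition cond_TrIneq :: "'a::euclidean_space set \<Rightarrow> ('a \<Rightarrow> 'a \<Rightarrow> real) \<Rightarrow> bool" where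
  "cond_TrIneq D f \<longleftrightarrow> (\<forall>x\<in>D. \<forall>u v w. f x (v - w) \<le> f x (v - u) + f x (u - w))"

text \<open>The points \<open>u\<close>, \<open>v\<close>, \<open>w\<close> range over the whole space, as in the triangle inequality: they
  enter only through their differences. The bound \<open>\<eta>'\<close> may depend on the configuration.\<close>

definition cond_Pythag :: "real \<Rightarrow> 'a::euclidean_space set \<Rightarrow> ('a \<Rightarrow> 'a \<Rightarrow> real) \<Rightarrow> bool" where
  "cond_Pythag \<alpha> D f \<longleftrightarrow> \<alpha> > 1 \<and>
     (\<forall>c>0. \<exists>C>0. \<forall>r u v w.
        0 < r \<longrightarrow> r < 1 \<longrightarrow>
        (\<exists>\<eta>'<1. norm (u - w) < \<eta>' \<and> norm (v - w) < \<eta>' \<and> norm (u - v) < \<eta>') \<longrightarrow>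
        infdist w (closed_segment u v) \<ge> r \<longrightarrow>
        norm (u - v) \<le> c * r powr (1 / \<alpha>) \<longrightarrow>
        (\<forall>x\<in>D. f x (w - u) + f x (v - w) \<ge> f x (v - u) + C * r powr \<alpha>))"


section \<open>Random points, graph paths and the discrete functional\<close>

text \<open>The sample is \<open>X 1, X 2, \<dots>\<close>; \<open>X 0\<close> is not used. The density is cut off outside \<open>D\<close>, so
  the points lie in \<open>D\<close> almost surely.\<close>

definition random_points ::
    "'w measure \<Rightarrow> 'a::euclidean_space set \<Rightarrow> ('a \<Rightarrow> real) \<Rightarrow> (nat \<Rightarrow> 'w \<Rightarrow> 'a) \<Rightarrow> bool" where
  "random_points M D \<rho> X \<longleftrightarrow>
     prob_space M \<and>
     prob_space.indep_vars M (\<lambda>_. borel) X {1..} \<and>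
     (\<forall>i\<ge>1. distributed M lborel (X i) (\<lambda>x. ennreal (\<rho> x) * indicator D x)) \<and>
     (\<exists>c0>0. \<forall>x\<in>D. c0 \<le> \<rho> x \<and> \<rho> x \<le> inverse c0)"

definition vertices :: "(nat \<Rightarrow> 'w \<Rightarrow> 'a) \<Rightarrow> 'a \<Rightarrow> 'a \<Rightarrow> nat \<Rightarrow> 'w \<Rightarrow> 'a set" where
  "vertices X a b n \<omega> = (\<lambda>i. X i \<omega>) ` {1..n} \<union> {a, b}"

text \<open>A path \<open>(v\<^sub>0, \<dots>, v\<^sub>m)\<close> is a list of length \<open>m + 1\<close>.\<close>

definition graph_paths :: "'a::euclidean_space set \<Rightarrow> real \<Rightarrow> 'a \<Rightarrow> 'a \<Rightarrow> 'a list set" where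
  "graph_paths S \<epsilon> a b =
     {v. length v \<ge> 2 \<and> set v \<subseteq> S \<and> hd v = a \<and> last v = b \<and>
         (\<forall>i. Suc i < length v \<longrightarrow> 0 < norm (v ! Suc i - v ! i) \<and> norm (v ! Suc i - v ! i) < \<epsilon>)}"

definition hops :: "'a list \<Rightarrow> nat" where
  "hops v = length v - 1"

definition discrete_cost :: "('a::euclidean_space \<Rightarrow> 'a \<Rightarrow> real) \<Rightarrow> 'a list \<Rightarrow> real" where
  "discrete_cost f v =
     1 / real (hops v) * (\<Sum>i<hops v. f (v ! i) (real (hops v) *\<^sub>R (v ! Suc i - v ! i)))"

text \<open>The segment index \<open>\<lfloor>m t\<rfloor>\<close> is capped at \<open>m - 1\<close>, which matters only at \<open>t = 1\<close>.\<close>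

definition interpolation :: "'a::euclidean_space list \<Rightarrow> real \<Rightarrow> 'a" where
  "interpolation v t =
     (let m = hops v; i = min (nat \<lfloor>real m * t\<rfloor>) (m - 1); s = real m * t - real i
      in (1 - s) *\<^sub>R (v ! i) + s *\<^sub>R (v ! Suc i))"

definition d_haus :: "'a::metric_space set \<Rightarrow> 'a set \<Rightarrow> real" where
  "d_haus A B = max (SUP x\<in>A. infdist x B) (SUP y\<in>B. infdist y A)"

end

theory Submission
  imports Defs "HOL-Complex_Analysis.Great_Picard"
begin

text \<open>
  For exponent \<open>p = 1\<close> the functions \<open>f x\<close> are asymmetric norms: convexity and homogeneity make
  them subadditive, \<open>f x v\<close> is comparable to \<open>norm v\<close>, and by the Lipschitz condition
  \<open>f x v \<le> (1 + \<kappa> * dist x y) * f y v\<close>. These properties are collected in the locale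
  \<open>finsler_integrand\<close>. The discrete cost of a path is then the plain sum of
  \<open>f (v i) (v (i + 1) - v i)\<close>, here called chain cost, and the cost of a Lipschitz path is the
  limit of the chain costs along equidistant partitions (\<open>chain_cost_tendsto_path_cost\<close>). This
  is the only place where velocities occur; it rests on the almost everywhere differentiability
  of Lipschitz functions, proved with the Vitali covering theorem. From there on the whole
  argument is about finite chains.

  If a piece of a chain lies within \<open>w\<close> of a base point, subadditivity at this base point shows
  that cutting the piece short increases the cost at most by the factor \<open>1 + \<kappa> * w\<close>
  (\<open>shortcut_le\<close>). Hence chain costs are almost monotone under refinement, path costs are lower
  semicontinuous (\<open>path_cost_lsc\<close>), and a polygon with short sides costs at most slightly more
  as a path than as a chain (\<open>interpolation_lip_path\<close>). Resampling a path into \<open>m\<close> steps of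
  length at most \<open>h\<close> with \<open>m * h\<close> bounded gives uniformly Lipschitz polygons, so the
  theorem of Arzela and Ascoli yields minimizers (\<open>polygons_compact\<close>, \<open>minimizer_exists\<close>).

  Convergence of the minima: every graph path is a polygon with sides shorter than \<open>\<epsilon> n\<close>,
  which bounds the discrete minimum from below. From above, a minimizer is sampled at steps of
  about \<open>\<epsilon> n / 2\<close> and the points are moved to sample points at distance at most \<open>c * \<epsilon> n\<close>. As the
  number of steps is of order \<open>1 / \<epsilon> n\<close>, the total error is of order \<open>c\<close>, and \<open>c\<close> is arbitrary, because almost
  surely every point of \<open>D\<close> has a sample point within a constant multiple of
  \<open>(ln n / n) powr (1 / d)\<close>, which is negligible compared with \<open>\<epsilon> n\<close> (\<open>sample_covers\<close>).

  Convergence of optimal paths: if \<open>a = b\<close>, they shrink to this point. Otherwise, by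
  \<open>polygons_compact\<close>, it suffices to bound \<open>m * \<epsilon> n\<close> for the number \<open>m\<close> of hops. Consider consecutive vertices of an optimal path within \<open>\<epsilon>\<close> of the first
  one. As a single hop from the first to the last of them is allowed, the path between them costs
  at most as much as this hop. If some vertex between them had distance at least \<open>\<epsilon> powr \<alpha>\<close> from
  the direct segment, the condition (Pythag) would make the path more expensive by \<open>C * \<epsilon> powr \<alpha>\<^sup>2\<close>, whereas evaluating
  the integrand at one base point instead of along the path changes the cost only by the order
  \<open>\<epsilon>\<^sup>2\<close>. As \<open>\<alpha>\<^sup>2 < 2\<close>, the vertices stay in a tube of length \<open>\<epsilon>\<close> and radius \<open>\<epsilon> powr \<alpha>\<close>
  (\<open>optimal_run_in_tube\<close>). The volume of this tube is at most of order \<open>n powr (- 1 - \<beta>)\<close>, where \<open>\<beta> > 0\<close>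
  by the choice of \<open>\<delta>\<close>, so almost surely all such tubes contain at most \<open>K\<close> sample points
  (\<open>tubes_contain_few_points\<close>). Hence any \<open>K\<close> consecutive hops have total length at least \<open>\<epsilon>\<close>, and
  as the length of optimal paths is bounded, so is \<open>m * \<epsilon> n\<close>.
\<close>

section \<open>Almost everywhere differentiability of Lipschitz functions\<close>

text \<open>The intervals on which \<open>\<phi>\<close> has slope at most \<open>p\<close> form a Vitali covering of \<open>A\<close>. Disjoint
  intervals chosen from it inside an open set slightly larger than \<open>A\<close> have disjoint images, of
  measure at most \<open>p\<close> times their own, and the part of \<open>A\<close> missed by them is mapped to a null
  set. The outer measure avoids any discussion of the measurability of \<open>A\<close>.\<close>

lemma outer_measure_image_le_slope:
  fixes \<phi> :: "real \<Rightarrow> real"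
  assumes mono: "strict_mono \<phi>" and lip: "L-lipschitz_on UNIV \<phi>" and "0 < p"
    and slope: "\<And>x d. x \<in> A \<Longrightarrow> 0 < d \<Longrightarrow>
      \<exists>u v. u \<le> x \<and> x \<le> v \<and> u < v \<and> v - u < d \<and> \<phi> v - \<phi> u \<le> p * (v - u)"
  shows "outer_measure_of lebesgue (\<phi> ` A) \<le> ennreal p * outer_measure_of lebesgue A"
proof -
  obtain B where B: "B \<in> sets lebesgue" "A \<subseteq> B" "outer_measure_of lebesgue A = emeasure lebesgue B"
    using outer_measure_of_attain[of A lebesgue] by auto
  have le_open: "outer_measure_of lebesgue (\<phi> ` A) \<le> ennreal p * emeasure lebesgue T"
    if T: "open T" "B \<subseteq> T" for T
  proof -
    define K where "K = {(u, v). u < v \<and> {u..v} \<subseteq> T \<and> \<phi> v - \<phi> u \<le> p * (v - u)}"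
    define c :: "real \<times> real \<Rightarrow> real" where "c = (\<lambda>(u, v). (u + v) / 2)"
    define r :: "real \<times> real \<Rightarrow> real" where "r = (\<lambda>(u, v). (v - u) / 2)"
    have ball: "cball (c i) (r i) = {fst i..snd i}" for i
      by (auto simp: c_def r_def cball_eq_atLeastAtMost field_simps split: prod.splits)
    have rpos: "0 < r i" if "i \<in> K" for i
      using that by (auto simp: K_def r_def)
    have fine: "\<exists>i. i \<in> K \<and> x \<in> cball (c i) (r i) \<and> r i < d" if "x \<in> A" "0 < d" for x d
    proof -
      have "x \<in> T" using that B T by auto
      then obtain e where e: "e > 0" "ball x e \<subseteq> T" using T(1) openE by blast
      obtain u v where uv: "u \<le> x" "x \<le> v" "u < v" "v - u < min d e" "\<phi> v - \<phi> u \<le> p * (v - u)"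
        using slope[OF \<open>x \<in> A\<close>, of "min d e"] \<open>0 < d\<close> e(1) that by auto
      have "{u..v} \<subseteq> ball x e" using uv by (auto simp: dist_real_def)
      then have "(u, v) \<in> K" using uv e by (auto simp: K_def)
      moreover have "x \<in> cball (c (u, v)) (r (u, v))" unfolding ball using uv by simp
      moreover have "r (u, v) < d" using uv by (auto simp: r_def)
      ultimately show ?thesis by blast
    qed
    obtain C where C: "countable C" "C \<subseteq> K"
      and disj: "pairwise (\<lambda>i j. disjnt (cball (c i) (r i)) (cball (c j) (r j))) C"
      and negl: "negligible (A - (\<Union>i\<in>C. cball (c i) (r i)))"
      by (rule Vitali_covering_theorem_cballs[of K r A c, OF rpos fine])
    let ?N = "\<phi> ` (A - (\<Union>i\<in>C. {fst i..snd i}))"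
    have neglN: "negligible ?N"
    proof (rule negligible_locally_Lipschitz_image[OF _ negl[unfolded ball]])
      fix x assume "x \<in> A - (\<Union>i\<in>C. {fst i..snd i})"
      show "\<exists>T B. open T \<and> x \<in> T \<and>
        (\<forall>y\<in>(A - (\<Union>i\<in>C. {fst i..snd i})) \<inter> T. norm (\<phi> y - \<phi> x) \<le> B * norm (y - x))"
        using lipschitz_onD[OF lip] by (intro exI[of _ UNIV] exI[of _ L]) (auto simp: dist_norm)
    qed auto
    have djC: "disjoint_family_on (\<lambda>i. {fst i..snd i}) C"
      using disj unfolding disjoint_family_on_def pairwise_def disjnt_def ball by auto
    have dj': "disjoint_family_on (\<lambda>i. {\<phi> (fst i)..\<phi> (snd i)}) C"
      unfolding disjoint_family_on_def
    proof (intro ballI impI)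
      fix i j assume ij: "i \<in> C" "j \<in> C" "i \<noteq> j"
      then have "{fst i..snd i} \<inter> {fst j..snd j} = {}"
        using djC unfolding disjoint_family_on_def by blast
      moreover have "fst i < snd i" "fst j < snd j" using ij C(2) by (auto simp: K_def)
      ultimately have "snd i < fst j \<or> snd j < fst i"
        by (auto simp: Int_atLeastAtMost)
      then show "{\<phi> (fst i)..\<phi> (snd i)} \<inter> {\<phi> (fst j)..\<phi> (snd j)} = {}"
        using strict_monoD[OF mono] by force
    qed
    have "\<phi> ` A \<subseteq> ?N \<union> (\<Union>i\<in>C. {\<phi> (fst i)..\<phi> (snd i)})"
      using strict_mono_less_eq[OF mono] by fastforce
    then have "outer_measure_of lebesgue (\<phi> ` A)
        \<le> outer_measure_of lebesgue (?N \<union> (\<Union>i\<in>C. {\<phi> (fst i)..\<phi> (snd i)}))"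
      by (rule outer_measure_of_mono)
    also have "\<dots> = emeasure lebesgue (?N \<union> (\<Union>i\<in>C. {\<phi> (fst i)..\<phi> (snd i)}))"
      using neglN C(1) by (intro outer_measure_of_eq sets.Un sets.countable_UN'')
        (auto simp: negligible_iff_null_sets)
    also have "\<dots> = emeasure lebesgue (\<Union>i\<in>C. {\<phi> (fst i)..\<phi> (snd i)})"
      using neglN C(1) by (subst Un_commute, intro emeasure_Un_null_set sets.countable_UN'')
        (auto simp: negligible_iff_null_sets)
    also have "\<dots> = (\<integral>\<^sup>+i. emeasure lebesgue {\<phi> (fst i)..\<phi> (snd i)} \<partial>count_space C)"
      by (rule emeasure_UN_countable) (auto simp: C dj')
    also have "\<dots> \<le> (\<integral>\<^sup>+i. ennreal p * emeasure lebesgue {fst i..snd i} \<partial>count_space C)"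
    proof (rule nn_integral_mono)
      fix i assume "i \<in> space (count_space C)"
      then have i: "fst i < snd i" "\<phi> (snd i) - \<phi> (fst i) \<le> p * (snd i - fst i)"
        using C by (auto simp: K_def)
      then show "emeasure lebesgue {\<phi> (fst i)..\<phi> (snd i)} \<le> ennreal p * emeasure lebesgue {fst i..snd i}"
        using strict_monoD[OF mono i(1)] \<open>0 < p\<close>
        by (simp add: ennreal_mult'[symmetric] ennreal_leI)
    qed
    also have "\<dots> = ennreal p * (\<integral>\<^sup>+i. emeasure lebesgue {fst i..snd i} \<partial>count_space C)"
      by (rule nn_integral_cmult) auto
    also have "(\<integral>\<^sup>+i. emeasure lebesgue {fst i..snd i} \<partial>count_space C) = emeasure lebesgue (\<Union>i\<in>C. {fst i..snd i})"
      by (rule emeasure_UN_countable[symmetric]) (auto simp: C djC)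
    also have "ennreal p * \<dots> \<le> ennreal p * emeasure lebesgue T"
      using C(2) T(1) by (intro mult_left_mono emeasure_mono) (fastforce simp: K_def)+
    finally show ?thesis .
  qed
  have "outer_measure_of lebesgue (\<phi> ` A) \<le> ennreal p * (emeasure lebesgue B + ennreal e)" if "e > 0" for e
  proof -
    obtain T where T: "open T" "B \<subseteq> T" "emeasure lebesgue (T - B) < ennreal e"
      using sets_lebesgue_outer_open[OF B(1) \<open>e > 0\<close>] by metis
    have "emeasure lebesgue T = emeasure lebesgue (B \<union> (T - B))" using T by (simp add: Un_absorb1)
    also have "\<dots> \<le> emeasure lebesgue B + emeasure lebesgue (T - B)"
      using B T by (intro emeasure_subadditive) auto
    also have "\<dots> \<le> emeasure lebesgue B + ennreal e" using T by (intro add_left_mono) auto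
    finally show ?thesis using le_open[OF T(1,2)]
      by (meson mult_left_mono order_trans zero_le)
  qed
  then have "outer_measure_of lebesgue (\<phi> ` A) \<le> ennreal p * emeasure lebesgue B + ennreal (p * e)" if "e > 0" for e
    using that \<open>0 < p\<close> by (simp add: distrib_left ennreal_mult' ennreal_mult)
  note le_eps = this
  show ?thesis unfolding B(3)
  proof (rule ennreal_le_epsilon)
    fix e :: real assume "0 < e"
    then show "outer_measure_of lebesgue (\<phi> ` A) \<le> ennreal p * emeasure lebesgue B + ennreal e"
      using le_eps[of "e / p"] \<open>0 < p\<close> by simp
  qed
qed

text \<open>The preceding lemma is used twice: for \<open>\<phi>\<close> with slope \<open>p\<close>, and for the inverse of \<open>\<phi>\<close>, where
  slopes at least \<open>q\<close> turn into slopes at most \<open>1 / q\<close>. Together they bound the outer measure of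
  \<open>A\<close> by \<open>p / q < 1\<close> times itself.\<close>

lemma negligible_both_slopes:
  fixes \<phi> :: "real \<Rightarrow> real"
  assumes "0 < l" and lip: "L-lipschitz_on UNIV \<phi>"
    and grow: "\<And>x y. x \<le> y \<Longrightarrow> l * (y - x) \<le> \<phi> y - \<phi> x"
    and "bounded A" and "0 < p" "p < q"
    and low: "\<And>x d. x \<in> A \<Longrightarrow> 0 < d \<Longrightarrow>
      \<exists>u v. u \<le> x \<and> x \<le> v \<and> u < v \<and> v - u < d \<and> \<phi> v - \<phi> u \<le> p * (v - u)"
    and high: "\<And>x d. x \<in> A \<Longrightarrow> 0 < d \<Longrightarrow>
      \<exists>u v. u \<le> x \<and> x \<le> v \<and> u < v \<and> v - u < d \<and> q * (v - u) \<le> \<phi> v - \<phi> u"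
  shows "negligible A"
proof -
  let ?\<mu> = "outer_measure_of lebesgue"
  have less: "\<phi> x < \<phi> y" if "x < y" for x y
    using grow[of x y] that \<open>0 < l\<close> mult_pos_pos[of l "y - x"] by linarith
  then have mono: "strict_mono \<phi>" by (rule strict_monoI)
  have cont: "continuous_on UNIV \<phi>" by (rule lipschitz_on_continuous_on[OF lip])
  have surj: "surj \<phi>"
  proof -
    have "\<exists>x. \<phi> x = y" for y
    proof -
      define a where "a = \<bar>y - \<phi> 0\<bar> / l"
      have a: "a \<ge> 0" "l * a = \<bar>y - \<phi> 0\<bar>" using \<open>0 < l\<close> by (auto simp: a_def)
      have "\<phi> (- a) \<le> y" "y \<le> \<phi> a"
        using grow[of "-a" 0] grow[of 0 a] a by auto
      then show ?thesis
        using IVT'[of \<phi> "-a" y a] a continuous_on_subset[OF cont] by auto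
    qed
    then show ?thesis by (metis surjI)
  qed
  define \<psi> where "\<psi> = inv \<phi>"
  have inv: "\<phi> (\<psi> y) = y" "\<psi> (\<phi> x) = x" for x y
    using surj strict_mono_imp_inj_on[OF mono] by (auto simp: \<psi>_def surj_f_inv_f)
  have less': "\<psi> x < \<psi> y" if "x < y" for x y
    using that inv strict_mono_less[OF mono] by metis
  have lip': "(1 / l)-lipschitz_on UNIV \<psi>"
  proof (rule lipschitz_onI)
    fix x y
    have *: "l * (\<psi> b - \<psi> a) \<le> b - a" if "a \<le> b" for a b
      using grow[of "\<psi> a" "\<psi> b"] less'[of a b] that inv by (cases "a = b") auto
    show "dist (\<psi> x) (\<psi> y) \<le> 1 / l * dist x y"
      using *[of x y] *[of y x] less'[of x y] less'[of y x] \<open>0 < l\<close>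
      by (cases x y rule: linorder_cases) (auto simp: dist_real_def field_simps)
  qed (use \<open>0 < l\<close> in auto)
  have "q > 0" using assms by simp
  have "L \<ge> 0" using lip lipschitz_on_def by blast
  have 1: "?\<mu> (\<phi> ` A) \<le> ennreal p * ?\<mu> A"
    by (rule outer_measure_image_le_slope[OF mono lip \<open>0 < p\<close> low])
  have "?\<mu> (\<psi> ` \<phi> ` A) \<le> ennreal (1 / q) * ?\<mu> (\<phi> ` A)"
  proof (rule outer_measure_image_le_slope[OF _ lip'])
    fix y d :: real assume "y \<in> \<phi> ` A" "0 < d"
    then obtain x where x: "x \<in> A" "y = \<phi> x" by auto
    obtain u v where uv: "u \<le> x" "x \<le> v" "u < v" "v - u < d / (L + 1)" "q * (v - u) \<le> \<phi> v - \<phi> u"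
      using high[OF x(1), of "d / (L + 1)"] \<open>0 < d\<close> \<open>L \<ge> 0\<close> by auto
    have "\<phi> v - \<phi> u \<le> L * (v - u)"
      using lipschitz_onD[OF lip, of v u] less[OF uv(3)] uv(3) by (auto simp: dist_real_def)
    also have "\<dots> \<le> (L + 1) * (v - u)" using uv by (intro mult_right_mono) auto
    also have "\<dots> < d" using uv(4) \<open>L \<ge> 0\<close> by (simp add: field_simps)
    finally have "\<phi> v - \<phi> u < d" .
    then show "\<exists>u v. u \<le> y \<and> y \<le> v \<and> u < v \<and> v - u < d \<and> \<psi> v - \<psi> u \<le> 1 / q * (v - u)"
      using uv x less[OF uv(3)] strict_mono_less_eq[OF mono] \<open>q > 0\<close>
      by (intro exI[of _ "\<phi> u"] exI[of _ "\<phi> v"]) (auto simp: inv field_simps)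
  qed (use less' \<open>q > 0\<close> in \<open>auto intro: strict_monoI\<close>)
  also have "\<psi> ` \<phi> ` A = A" using inv by (auto simp: image_image)
  also have "ennreal (1 / q) * ?\<mu> (\<phi> ` A) \<le> ennreal (1 / q) * (ennreal p * ?\<mu> A)"
    by (intro mult_left_mono 1) auto
  also have "\<dots> = ennreal (p / q) * ?\<mu> A"
    using \<open>0 < p\<close> \<open>0 < q\<close> by (simp add: mult.assoc[symmetric] ennreal_mult[symmetric])
  finally have le: "?\<mu> A \<le> ennreal (p / q) * ?\<mu> A" .
  obtain B where B: "B \<in> sets lebesgue" "A \<subseteq> B" "?\<mu> A = emeasure lebesgue B"
    using outer_measure_of_attain[of A lebesgue] by auto
  obtain R where R: "A \<subseteq> cball 0 R" using bounded_subset_ballD[OF \<open>bounded A\<close>, of 0] ball_subset_cball by (meson order_trans)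
  have "emeasure lebesgue (cball (0::real) R) < \<infinity>"
    using emeasure_bounded_finite[of "cball (0::real) R"] by (simp add: less_top)
  then have fin: "?\<mu> A < \<infinity>"
    using outer_measure_of_mono[OF R, of lebesgue] outer_measure_of_eq[of "cball 0 R" lebesgue]
    by (simp add: order_le_less_trans)
  define m where "m = enn2real (?\<mu> A)"
  have m: "m \<ge> 0" "?\<mu> A = ennreal m"
    using fin by (simp_all add: m_def)
  have "m \<le> p / q * m" using le m \<open>0 < p\<close> \<open>0 < q\<close>
    by (simp add: ennreal_mult'[symmetric] del: ennreal_mult')
  then have "m * (1 - p / q) \<le> 0" by (simp add: algebra_simps)
  moreover have "1 - p / q > 0" using assms by (simp add: field_simps)
  ultimately have "m = 0" using m(1) by (simp add: mult_le_0_iff)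
  then have "B \<in> null_sets lebesgue" using B m by auto
  then show ?thesis using B(2) negligible_iff_null_sets negligible_subset by blast
qed

text \<open>Adding a large multiple of the identity makes a Lipschitz function increasing and
  bi-Lipschitz without changing where it is differentiable. Where it is not, the lower and the
  upper limit of the difference quotients are separated by rationals \<open>p < q\<close>, and there are only
  countably many such pairs.\<close>

theorem lipschitz_ae_differentiable:
  fixes g :: "real \<Rightarrow> real"
  assumes lip: "L-lipschitz_on UNIV g"
  shows "negligible {x\<in>{a..b}. \<not> g differentiable (at x)}"
proof -
  define K where "K = L + 1"
  have K: "K > 0" using lip by (auto simp: K_def lipschitz_on_def add_nonneg_pos)
  have gK: "\<bar>g y - g x\<bar> \<le> K * \<bar>y - x\<bar>" for x y
    using lipschitz_onD[OF lip, of y x] abs_ge_zero[of "y - x"] by (auto simp: dist_real_def K_def algebra_simps)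
  define \<phi> where "\<phi> x = g x + 2 * K * x" for x
  have \<phi>_lower: "K * (y - x) \<le> \<phi> y - \<phi> x" and \<phi>_upper: "\<phi> y - \<phi> x \<le> 3 * K * (y - x)" if "x \<le> y" for x y
    using gK[of y x] that by (auto simp: \<phi>_def algebra_simps abs_le_iff)
  have lip\<phi>: "(3 * K)-lipschitz_on UNIV \<phi>"
  proof (rule lipschitz_onI)
    fix x y :: real
    have "\<bar>\<phi> x - \<phi> y\<bar> \<le> 3 * K * \<bar>x - y\<bar>"
    proof (induction x y rule: linorder_wlog)
      case (le x y)
      then have "0 \<le> K * (y - x)" "\<bar>x - y\<bar> = y - x" using K by auto
      with \<phi>_lower[OF le] \<phi>_upper[OF le] show ?case by simp
    qed (simp add: abs_minus_commute)
    then show "dist (\<phi> x) (\<phi> y) \<le> 3 * K * dist x y" by (simp add: dist_real_def)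
  qed (use K in auto)
  define E where "E p q = {x \<in> {a..b}.
      (\<forall>d>0. \<exists>u v. u \<le> x \<and> x \<le> v \<and> u < v \<and> v - u < d \<and> \<phi> v - \<phi> u \<le> p * (v - u)) \<and>
      (\<forall>d>0. \<exists>u v. u \<le> x \<and> x \<le> v \<and> u < v \<and> v - u < d \<and> q * (v - u) \<le> \<phi> v - \<phi> u)}" for p q
  have neglE: "negligible (E p q)" if "0 < p" "p < q" for p q
  proof (rule negligible_both_slopes[OF K lip\<phi> \<phi>_lower _ that])
    show "bounded (E p q)" by (rule bounded_subset[of "{a..b}"]) (auto simp: E_def)
  qed (auto simp: E_def)
  have "{x\<in>{a..b}. \<not> g differentiable (at x)} \<subseteq> (\<Union>(p, q)\<in>{(p, q)\<in>\<rat> \<times> \<rat>. 0 < p \<and> p < q}. E p q)"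
  proof safe
    fix x assume x: "x \<in> {a..b}" and nd: "\<not> g differentiable (at x)"
    define s where "s y = (\<phi> y - \<phi> x) / (y - x)" for y
    have s_bd: "K \<le> s y \<and> s y \<le> 3 * K" if "y \<noteq> x" for y
      using \<phi>_lower[of x y] \<phi>_upper[of x y] \<phi>_lower[of y x] \<phi>_upper[of y x] that
      by (cases "x < y") (auto simp: s_def field_simps)
    let ?lo = "Liminf (at x) (\<lambda>y. ereal (s y))" and ?up = "Limsup (at x) (\<lambda>y. ereal (s y))"
    have ev: "\<forall>\<^sub>F y in at x. y \<noteq> x" by (auto simp: eventually_at_filter)
    have lo: "ereal K \<le> ?lo"
      by (intro Liminf_bounded eventually_mono[OF ev]) (use s_bd in auto)
    have up: "?up \<le> ereal (3 * K)"
      by (intro Limsup_bounded eventually_mono[OF ev]) (use s_bd in auto)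
    have le: "?lo \<le> ?up" by (intro Liminf_le_Limsup) auto
    have "?lo \<noteq> ?up"
    proof
      assume eq: "?lo = ?up"
      then obtain D where D: "?lo = ereal D" "?up = ereal D"
        using lo up by (cases "?up") auto
      have "((\<lambda>y. ereal (s y)) \<longlongrightarrow> ereal D) (at x)"
        using D by (intro Liminf_eq_Limsup) auto
      then have "(s \<longlongrightarrow> D) (at x)" by simp
      then have "(\<phi> has_field_derivative D) (at x)"
        unfolding has_field_derivative_iff s_def .
      then have "((\<lambda>y. \<phi> y - 2 * K * y) has_field_derivative D - 2 * K) (at x)"
        by (auto intro!: derivative_eq_intros)
      then have "(g has_field_derivative D - 2 * K) (at x)" by (simp add: \<phi>_def)
      with nd show False using field_differentiable_imp_differentiable real_differentiable_def by blast
    qed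
    with le have "?lo < ?up" by simp
    then obtain p' where p': "?lo < ereal p'" "ereal p' < ?up" using ereal_dense2 by blast
    then obtain q' where q': "ereal p' < ereal q'" "ereal q' < ?up" using ereal_dense2 by blast
    obtain p where p: "p \<in> \<rat>" "p' < p" "p < (p' + q') / 2"
      using Rats_dense_in_real[of p' "(p' + q') / 2"] q' by auto
    obtain q where q: "q \<in> \<rat>" "(p' + q') / 2 < q" "q < q'"
      using Rats_dense_in_real[of "(p' + q') / 2" q'] q' by auto
    have "ereal K < ereal p'" using lo p'(1) by (rule order_le_less_trans)
    then have "K < p" using p by simp
    have slopes: "u \<le> x \<and> x \<le> v \<and> u < v \<and> v - u < d \<and> \<phi> v - \<phi> u = s y * (v - u)"
      if "y \<noteq> x" "\<bar>y - x\<bar> < d" "u = min x y" "v = max x y" for y u v d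
    proof (cases "x < y")
      case True
      then show ?thesis using that by (simp add: s_def)
    next
      case False
      then have "y < x" using that by simp
      then have "\<phi> x - \<phi> y = s y * (x - y)"
        by (simp add: s_def field_simps)
      with \<open>y < x\<close> show ?thesis using that by simp
    qed
    have near: "\<exists>y. y \<noteq> x \<and> \<bar>y - x\<bar> < d \<and> P y" if "\<not> (\<forall>\<^sub>F y in at x. \<not> P y)" "d > 0" for P d
      using that unfolding eventually_at by (auto simp: dist_real_def)
    have "\<not> (\<forall>\<^sub>F y in at x. \<not> s y \<le> p)"
    proof
      assume "\<forall>\<^sub>F y in at x. \<not> s y \<le> p"
      then have "ereal p \<le> ?lo" by (intro Liminf_bounded) (auto elim: eventually_mono)
      then have "ereal p < ereal p'" using p'(1) by (rule order_le_less_trans)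
      with p show False by simp
    qed
    note freq_lo = near[OF this]
    have "\<not> (\<forall>\<^sub>F y in at x. \<not> q \<le> s y)"
    proof
      assume "\<forall>\<^sub>F y in at x. \<not> q \<le> s y"
      then have "?up \<le> ereal q" by (intro Limsup_bounded) (auto elim: eventually_mono)
      with q'(2) have "ereal q' < ereal q" by (rule order_less_le_trans)
      with q show False by simp
    qed
    note freq_up = near[OF this]
    have "x \<in> E p q"
      unfolding E_def
    proof (intro CollectI conjI x allI impI)
      fix d :: real assume "d > 0"
      obtain y where y: "y \<noteq> x" "\<bar>y - x\<bar> < d" "s y \<le> p" using freq_lo[OF \<open>d > 0\<close>] by auto
      show "\<exists>u v. u \<le> x \<and> x \<le> v \<and> u < v \<and> v - u < d \<and> \<phi> v - \<phi> u \<le> p * (v - u)"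
        using slopes[OF y(1,2) refl refl] y(3) by (metis mult_right_mono diff_ge_0_iff_ge less_imp_le)
      obtain y where y: "y \<noteq> x" "\<bar>y - x\<bar> < d" "q \<le> s y" using freq_up[OF \<open>d > 0\<close>] by auto
      show "\<exists>u v. u \<le> x \<and> x \<le> v \<and> u < v \<and> v - u < d \<and> q * (v - u) \<le> \<phi> v - \<phi> u"
        using slopes[OF y(1,2) refl refl] y(3)
        by (intro exI[of _ "min x y"] exI[of _ "max x y"]) (auto intro!: mult_right_mono)
    qed
    then show "x \<in> (\<Union>(p, q)\<in>{(p, q)\<in>\<rat> \<times> \<rat>. 0 < p \<and> p < q}. E p q)"
      using p q \<open>K < p\<close> K by (intro UN_I[of "(p, q)"]) auto
  qed
  moreover have "negligible (\<Union>(p, q)\<in>{(p, q)\<in>\<rat> \<times> \<rat>. 0 < p \<and> p < (q::real)}. E p q)"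
  proof (rule negligible_countable_Union)
    have "countable (\<rat> \<times> \<rat> :: (real \<times> real) set)"
      by (intro countable_SIGMA countable_rat)
    then have "countable {(p, q)\<in>\<rat> \<times> \<rat>. 0 < p \<and> p < (q::real)}"
      by (rule countable_subset[rotated]) auto
    then show "countable ((\<lambda>(p, q). E p q) ` {(p, q)\<in>\<rat> \<times> \<rat>. 0 < p \<and> p < (q::real)})"
      by (rule countable_image)
    fix S assume "S \<in> (\<lambda>(p, q). E p q) ` {(p, q)\<in>\<rat> \<times> \<rat>. 0 < p \<and> p < (q::real)}"
    then show "negligible S" using neglE by auto
  qed
  ultimately show ?thesis using negligible_subset by blast
qed

section \<open>Path costs as limits of chain costs\<close>

text \<open>Applied to the coordinates of the path, extended to all times by clamping.\<close>

lemma lipschitz_path_ae_velocity: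
  fixes \<gamma> :: "real \<Rightarrow> 'a::euclidean_space"
  assumes lip: "L-lipschitz_on {0..1} \<gamma>"
  shows "AE t in lebesgue. t \<in> {0..1} \<longrightarrow> (\<gamma> has_vector_derivative velocity \<gamma> t) (at t within {0..1})"
proof -
  define c :: "real \<Rightarrow> real" where "c t = max 0 (min 1 t)" for t
  have c: "c t \<in> {0..1}" "\<bar>c s - c t\<bar> \<le> \<bar>s - t\<bar>" for s t by (auto simp: c_def)
  have "L \<ge> 0" using lip lipschitz_on_def by blast
  have lip': "L-lipschitz_on UNIV (\<lambda>t. \<gamma> (c t) \<bullet> i)" if "i \<in> Basis" for i
  proof (rule lipschitz_onI)
    fix s t :: real
    have "\<bar>\<gamma> (c s) \<bullet> i - \<gamma> (c t) \<bullet> i\<bar> \<le> norm (\<gamma> (c s) - \<gamma> (c t))"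
      using Basis_le_norm[OF that, of "\<gamma> (c s) - \<gamma> (c t)"] by (simp add: inner_diff_left)
    also have "\<dots> \<le> L * \<bar>c s - c t\<bar>"
      using lipschitz_onD[OF lip c(1) c(1), of s t] by (simp add: dist_norm)
    also have "\<dots> \<le> L * \<bar>s - t\<bar>" using c(2) \<open>L \<ge> 0\<close> by (intro mult_left_mono) auto
    finally show "dist (\<gamma> (c s) \<bullet> i) (\<gamma> (c t) \<bullet> i) \<le> L * dist s t" by (simp add: dist_real_def)
  qed fact
  define N where "N = (\<Union>i\<in>Basis. {t\<in>{0..1}. \<not> (\<lambda>t. \<gamma> (c t) \<bullet> i) differentiable (at t)})"
  have "negligible N"
    unfolding N_def
  proof (rule negligible_Union)
    fix S assume "S \<in> (\<lambda>i. {t\<in>{0..1}. \<not> (\<lambda>t. \<gamma> (c t) \<bullet> i) differentiable (at t)}) ` Basis"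
    then show "negligible S" using lipschitz_ae_differentiable[OF lip'] by blast
  qed auto
  moreover have "(\<gamma> has_vector_derivative velocity \<gamma> t) (at t within {0..1})" if "t \<in> {0..1}" "t \<notin> N" for t
  proof -
    have "(\<lambda>t. \<gamma> (c t)) differentiable (at t)"
      using that differentiable_componentwise_within[of "\<lambda>t. \<gamma> (c t)" t UNIV] by (auto simp: N_def)
    then have "(\<lambda>t. \<gamma> (c t)) differentiable (at t within {0..1})"
      by (rule differentiable_at_withinI)
    then have "\<gamma> differentiable (at t within {0..1})"
      by (rule differentiable_transform_within[OF _ zero_less_one that(1)]) (auto simp: c_def)
    then show ?thesis unfolding velocity_def by (simp add: vector_derivative_works)
  qed
  ultimately show ?thesis
    unfolding negligible_iff_null_sets by (intro AE_I'[of N]) auto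
qed

text \<open>The cells of a partition straddle the time \<open>t\<close>, so the difference quotients over them need
  not have \<open>t\<close> as an end point.\<close>

lemma straddle_quotient_tendsto:
  fixes \<gamma> :: "real \<Rightarrow> 'a::real_normed_vector"
  assumes der: "(\<gamma> has_vector_derivative d) (at t within S)"
    and uv: "\<And>n. u n \<in> S" "\<And>n. v n \<in> S" "\<And>n. u n \<le> t" "\<And>n. t \<le> v n" "\<And>n. u n < v n"
    and lim: "(\<lambda>n. v n - u n) \<longlonglongrightarrow> 0"
  shows "(\<lambda>n. (1 / (v n - u n)) *\<^sub>R (\<gamma> (v n) - \<gamma> (u n))) \<longlonglongrightarrow> d"
proof (rule metric_LIMSEQ_I)
  fix e :: real assume "e > 0"
  have "\<forall>e>0. \<exists>\<delta>>0. \<forall>y\<in>S. norm (y - t) < \<delta> \<longrightarrow> norm (\<gamma> y - \<gamma> t - (y - t) *\<^sub>R d) \<le> e * norm (y - t)"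
    using der unfolding has_vector_derivative_def has_derivative_within_alt by blast
  then obtain \<delta> where \<delta>: "\<delta> > 0" "\<And>y. y \<in> S \<Longrightarrow> norm (y - t) < \<delta> \<Longrightarrow>
      norm (\<gamma> y - \<gamma> t - (y - t) *\<^sub>R d) \<le> (e / 2) * norm (y - t)"
    using \<open>e > 0\<close> half_gt_zero by metis
  obtain N where N: "\<And>n. n \<ge> N \<Longrightarrow> v n - u n < \<delta>"
    using LIMSEQ_D[OF lim \<delta>(1)] by (auto simp: abs_less_iff)
  show "\<exists>N. \<forall>n\<ge>N. dist ((1 / (v n - u n)) *\<^sub>R (\<gamma> (v n) - \<gamma> (u n))) d < e"
  proof (intro exI[of _ N] allI impI)
    fix n assume "n \<ge> N"
    let ?h = "v n - u n"
    have h: "?h > 0" "?h < \<delta>" using uv(5)[of n] N[OF \<open>n \<ge> N\<close>] by auto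
    have 1: "norm (\<gamma> (v n) - \<gamma> t - (v n - t) *\<^sub>R d) \<le> (e / 2) * (v n - t)"
      using \<delta>(2)[OF uv(2)[of n]] h uv(3,4)[of n] by auto
    have 2: "norm (\<gamma> (u n) - \<gamma> t - (u n - t) *\<^sub>R d) \<le> (e / 2) * (t - u n)"
      using \<delta>(2)[OF uv(1)[of n]] h uv(3,4)[of n] by auto
    have "(1 / ?h) *\<^sub>R (\<gamma> (v n) - \<gamma> (u n)) - d = (1 / ?h) *\<^sub>R (\<gamma> (v n) - \<gamma> (u n) - ?h *\<^sub>R d)"
      using h by (simp add: scaleR_diff_right)
    also have "\<gamma> (v n) - \<gamma> (u n) - ?h *\<^sub>R d
        = (\<gamma> (v n) - \<gamma> t - (v n - t) *\<^sub>R d) - (\<gamma> (u n) - \<gamma> t - (u n - t) *\<^sub>R d)"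
      by (simp add: algebra_simps)
    finally have "norm ((1 / ?h) *\<^sub>R (\<gamma> (v n) - \<gamma> (u n)) - d) =
        (1 / ?h) * norm ((\<gamma> (v n) - \<gamma> t - (v n - t) *\<^sub>R d) - (\<gamma> (u n) - \<gamma> t - (u n - t) *\<^sub>R d))"
      using h by simp
    also have "\<dots> \<le> (1 / ?h) * ((e / 2) * (v n - t) + (e / 2) * (t - u n))"
      using h 1 2 by (intro mult_left_mono order_trans[OF norm_triangle_ineq4]) auto
    also have "\<dots> = e / 2" using h by (simp add: field_simps)
    finally show "dist ((1 / ?h) *\<^sub>R (\<gamma> (v n) - \<gamma> (u n))) d < e"
      using \<open>e > 0\<close> by (simp add: dist_norm)
  qed
qed

definition chain_cost :: "('a::real_vector \<Rightarrow> 'a \<Rightarrow> real) \<Rightarrow> (nat \<Rightarrow> 'a) \<Rightarrow> nat \<Rightarrow> real" where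
  "chain_cost f z m = (\<Sum>i<m. f (z i) (z (Suc i) - z i))"

abbreviation grid :: "(real \<Rightarrow> 'a) \<Rightarrow> nat \<Rightarrow> nat \<Rightarrow> 'a" where
  "grid \<gamma> N \<equiv> \<lambda>i. \<gamma> (real i / real N)"

lemma grid_in_unit_interval: "i \<le> N \<Longrightarrow> real i / real N \<in> {0..1}"
  by (auto simp: divide_le_eq_1)

lemma lip_paths_in: "\<gamma> \<in> lip_paths D u v \<Longrightarrow> t \<in> {0..1} \<Longrightarrow> \<gamma> t \<in> D"
  by (auto simp: lip_paths_def path_image_def)

lemma lip_paths_ends: "\<gamma> \<in> lip_paths D u v \<Longrightarrow> \<gamma> 0 = u" "\<gamma> \<in> lip_paths D u v \<Longrightarrow> \<gamma> 1 = v"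
  by (auto simp: lip_paths_def pathstart_def pathfinish_def)

lemma lipschitz_grid_step:
  assumes "L-lipschitz_on {0..1} \<gamma>" "i < N"
  shows "dist (grid \<gamma> N i) (grid \<gamma> N (Suc i)) \<le> L / real N"
proof -
  have "dist (real i / real N) (real (Suc i) / real N) = 1 / real N"
    using assms(2) by (simp add: dist_real_def diff_divide_distrib[symmetric])
  then show ?thesis
    using lipschitz_onD[OF assms(1) grid_in_unit_interval grid_in_unit_interval, of i N "Suc i" N] assms(2)
    by simp
qed

lemma dist_le_sum_steps:
  assumes "j \<le> k" shows "dist (z j) (z k) \<le> (\<Sum>l\<in>{j..<k}. dist (z l) (z (Suc l)))"
  using assms
proof (induction k rule: dec_induct)
  case (step k)
  then show ?case using dist_triangle[of "z j" "z (Suc k)" "z k"] by simp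
qed simp

abbreviation list_cost :: "('a::real_vector \<Rightarrow> 'a \<Rightarrow> real) \<Rightarrow> 'a list \<Rightarrow> real" where
  "list_cost f v \<equiv> chain_cost f ((!) v) (hops v)"

text \<open>The last assumption is the Lipschitz condition in multiplicative form, which fits chains:
  all errors become factors close to \<open>1\<close>.\<close>

locale finsler_integrand =
  fixes D :: "'a::euclidean_space set" and f :: "'a \<Rightarrow> 'a \<Rightarrow> real" and m1 m2 \<kappa> :: real
  assumes D_convex: "convex D" and D_compact: "compact D"
    and cont: "continuous_on (D \<times> UNIV) (\<lambda>(x, v). f x v)"
    and scale: "\<And>x l v. x \<in> D \<Longrightarrow> 0 \<le> l \<Longrightarrow> f x (l *\<^sub>R v) = l * f x v"
    and subadd: "\<And>x u v. x \<in> D \<Longrightarrow> f x (u + v) \<le> f x u + f x v"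
    and lower: "\<And>x v. x \<in> D \<Longrightarrow> m1 * norm v \<le> f x v"
    and upper: "\<And>x v. x \<in> D \<Longrightarrow> f x v \<le> m2 * norm v"
    and m1_pos: "0 < m1" and m2_pos: "0 < m2" and \<kappa>_nonneg: "0 \<le> \<kappa>"
    and compare: "\<And>x y v. x \<in> D \<Longrightarrow> y \<in> D \<Longrightarrow> f x v \<le> (1 + \<kappa> * dist x y) * f y v"
begin

lemma nonneg: "x \<in> D \<Longrightarrow> 0 \<le> f x v"
  using lower[of x v] m1_pos by (meson mult_nonneg_nonneg norm_ge_zero order_trans less_imp_le)

lemma chain_length_le:
  assumes "\<And>l. l < m \<Longrightarrow> z l \<in> D"
  shows "(\<Sum>l<m. dist (z l) (z (Suc l))) \<le> chain_cost f z m / m1"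
  unfolding chain_cost_def sum_divide_distrib
proof (intro sum_mono)
  fix l assume "l \<in> {..<m}"
  then have "m1 * norm (z (Suc l) - z l) \<le> f (z l) (z (Suc l) - z l)" by (intro lower assms) simp
  then show "dist (z l) (z (Suc l)) \<le> f (z l) (z (Suc l) - z l) / m1"
    using m1_pos by (simp add: dist_norm norm_minus_commute field_simps)
qed

lemma f_zero: "x \<in> D \<Longrightarrow> f x 0 = 0"
  using scale[of x 0 0] by simp

lemma f_tendsto:
  assumes "p \<longlonglongrightarrow> x" "q \<longlonglongrightarrow> v" "\<And>n. p n \<in> D" "x \<in> D"
  shows "(\<lambda>n. f (p n) (q n)) \<longlonglongrightarrow> f x v"
  using continuous_on_tendsto_compose[OF cont tendsto_Pair[OF assms(1,2)]] assms(3,4) by auto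

text \<open>By dominated convergence: at almost every time the difference quotients over the cells
  of the equidistant partition converge to the velocity.\<close>

theorem chain_cost_tendsto_path_cost:
  assumes "\<gamma> \<in> lip_paths D u v"
  shows "(\<lambda>N. chain_cost f (grid \<gamma> N) N) \<longlonglongrightarrow> path_cost f \<gamma>"
proof -
  obtain L where lip: "L-lipschitz_on {0..1} \<gamma>" using assms by (auto simp: lip_paths_def)
  note inD = lip_paths_in[OF assms]
  have "L \<ge> 0" using lip lipschitz_on_def by blast
  define c where "c N i = f (grid \<gamma> N i) (real N *\<^sub>R (grid \<gamma> N (Suc i) - grid \<gamma> N i))" for N i
  define s where "s N t = (\<Sum>i<N. c N i * indicator {real i / real N..<real (Suc i) / real N} t)" for N t
  have cell: "s N t = c N i" if "i < N" and cell_t: "t \<in> {real i / real N..<real (Suc i) / real N}" for N t i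
  proof -
    have "t \<notin> {real j / real N..<real (Suc j) / real N}" if "j \<noteq> i" for j
    proof
      assume *: "t \<in> {real j / real N..<real (Suc j) / real N}"
      have "N > 0" using \<open>i < N\<close> by simp
      have "real j / real N < real (Suc i) / real N" "real i / real N < real (Suc j) / real N"
        using * cell_t by auto
      then show False using \<open>N > 0\<close> \<open>j \<noteq> i\<close> by (simp add: divide_less_cancel)
    qed
    then have "s N t = (\<Sum>k<N. if k = i then c N i else 0)"
      unfolding s_def using that by (intro sum.cong) auto
    then show ?thesis using that by simp
  qed
  have c_bound: "\<bar>c N i\<bar> \<le> m2 * L" if "i < N" for N i
  proof -
    let ?w = "real N *\<^sub>R (grid \<gamma> N (Suc i) - grid \<gamma> N i)"
    have xD: "grid \<gamma> N i \<in> D" using that by (intro inD grid_in_unit_interval) simp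
    have "norm ?w \<le> L"
      using lipschitz_grid_step[OF lip that] that
      by (simp add: dist_norm norm_minus_commute pos_le_divide_eq mult.commute)
    then have "m2 * norm ?w \<le> m2 * L" using m2_pos by simp
    with nonneg[OF xD] upper[OF xD, of ?w] show ?thesis
      unfolding c_def by (metis abs_of_nonneg order_trans)
  qed
  have s_int: "(LINT t|lebesgue. s N t) = chain_cost f (grid \<gamma> N) N" for N
  proof -
    have "(LINT t|lebesgue. s N t) = (\<Sum>i<N. LINT t|lebesgue. c N i * indicator {real i / real N..<real (Suc i) / real N} t)"
      unfolding s_def by (rule Bochner_Integration.integral_sum)
        (intro integrable_mult_right integrable_real_indicator; simp add: divide_right_mono)
    also have "\<dots> = (\<Sum>i<N. c N i * (1 / real N))"
      by (intro sum.cong refl) (simp add: measure_def divide_right_mono diff_divide_distrib[symmetric])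
    also have "\<dots> = chain_cost f (grid \<gamma> N) N"
      unfolding chain_cost_def c_def
    proof (intro sum.cong refl)
      fix i assume "i \<in> {..<N}"
      then have "grid \<gamma> N i \<in> D" "N > 0" by (auto intro!: inD grid_in_unit_interval simp del: atLeastAtMost_iff)
      then show "f (grid \<gamma> N i) (real N *\<^sub>R (grid \<gamma> N (Suc i) - grid \<gamma> N i)) * (1 / real N)
          = f (grid \<gamma> N i) (grid \<gamma> N (Suc i) - grid \<gamma> N i)"
        by (simp add: scale)
    qed
    finally show ?thesis .
  qed
  define g where "g t = indicator {0..1} t * f (\<gamma> t) (velocity \<gamma> t)" for t
  have null1: "AE t in lebesgue. t \<noteq> (1::real)"
    by (intro AE_I'[of "{1}"]) auto
  have lim: "AE t in lebesgue. (\<lambda>N. s N t) \<longlonglongrightarrow> g t"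
    using lipschitz_path_ae_velocity[OF lip] null1
  proof eventually_elim
    case (elim t)
    show "(\<lambda>N. s N t) \<longlonglongrightarrow> g t"
    proof (cases "t \<in> {0..<1}")
      case False
      then have "t \<notin> {0..1}" using elim by auto
      then have "s N t = 0" for N
        unfolding s_def
      proof (intro sum.neutral ballI)
        fix i assume "i \<in> {..<N}" 
        then have "0 \<le> real i / real N" "real (Suc i) / real N \<le> 1" by auto
        then have "t \<notin> {real i / real N..<real (Suc i) / real N}"
          using \<open>t \<notin> {0..1}\<close> unfolding atLeastLessThan_iff atLeastAtMost_iff by linarith
        then show "c N i * indicator {real i / real N..<real (Suc i) / real N} t = 0"
          by simp
      qed
      with \<open>t \<notin> {0..1}\<close> show ?thesis by (simp add: g_def)
    next
      case True
      define i where "i N = nat \<lfloor>real (Suc N) * t\<rfloor>" for N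
      define p where "p N = real (i N) / real (Suc N)" for N
      define q where "q N = real (Suc (i N)) / real (Suc N)" for N
      have iN: "real (i N) \<le> real (Suc N) * t" "real (Suc N) * t < real (Suc (i N))" for N
        using True by (auto simp: i_def) linarith+
      have pq: "p N \<le> t" "t < q N" for N
        using iN[of N] by (auto simp: p_def q_def field_simps)
      have iless: "i N < Suc N" for N
      proof -
        have "real (Suc N) * t < real (Suc N) * 1"
          using True by (intro mult_strict_left_mono) auto
        from le_less_trans[OF iN(1) this] show ?thesis by simp
      qed
      have pq01: "p N \<in> {0..1}" "q N \<in> {0..1}" for N
        unfolding p_def q_def using iless[of N] by (intro grid_in_unit_interval; simp)+
      have qp: "q N - p N = 1 / real (Suc N)" for N by (simp add: p_def q_def field_simps)
      have s_eq: "s (Suc N) t = f (\<gamma> (p N)) ((1 / (q N - p N)) *\<^sub>R (\<gamma> (q N) - \<gamma> (p N)))" for N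
        using cell[OF iless, of t N] pq[of N] unfolding qp unfolding c_def p_def q_def by simp
      have qp_lim: "(\<lambda>N. q N - p N) \<longlonglongrightarrow> 0"
        unfolding qp using LIMSEQ_inverse_real_of_nat by (simp add: inverse_eq_divide)
      have p_lim: "p \<longlonglongrightarrow> t"
      proof (rule tendsto_sandwich[of "\<lambda>N. t - (q N - p N)" p _ "\<lambda>N. t"])
        show "\<forall>\<^sub>F N in sequentially. t - (q N - p N) \<le> p N" using pq by (auto simp: less_imp_le)
        show "(\<lambda>N. t - (q N - p N)) \<longlonglongrightarrow> t" using tendsto_diff[OF tendsto_const qp_lim, of t] by simp
      qed (use pq in auto)
      have "continuous_on {0..1} \<gamma>" by (rule lipschitz_on_continuous_on[OF lip])
      then have \<gamma>p: "(\<lambda>N. \<gamma> (p N)) \<longlonglongrightarrow> \<gamma> t"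
        by (rule continuous_on_tendsto_compose[OF _ p_lim]) (use True pq01 in auto)
      have "(\<lambda>N. (1 / (q N - p N)) *\<^sub>R (\<gamma> (q N) - \<gamma> (p N))) \<longlonglongrightarrow> velocity \<gamma> t"
        by (rule straddle_quotient_tendsto[OF _ pq01 _ _ _ qp_lim])
          (use elim True pq in \<open>auto intro: less_imp_le le_less_trans\<close>)
      then have "(\<lambda>N. f (\<gamma> (p N)) ((1 / (q N - p N)) *\<^sub>R (\<gamma> (q N) - \<gamma> (p N)))) \<longlonglongrightarrow> f (\<gamma> t) (velocity \<gamma> t)"
        using True pq01 by (intro f_tendsto \<gamma>p inD) auto
      then have "(\<lambda>N. s (Suc N) t) \<longlonglongrightarrow> g t"
        using True unfolding s_eq by (simp add: g_def)
      then show ?thesis by (rule LIMSEQ_imp_Suc)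
    qed
  qed
  have s_meas: "s N \<in> borel_measurable lebesgue" for N
    unfolding s_def by (intro borel_measurable_sum borel_measurable_times borel_measurable_indicator) auto
  have "(\<lambda>t. lim (\<lambda>N. s N t)) \<in> borel_measurable lebesgue"
    by (intro borel_measurable_lim_metric s_meas)
  moreover have "AE t in lebesgue. lim (\<lambda>N. s N t) = g t"
    using lim by eventually_elim (rule limI)
  ultimately have g_meas: "g \<in> borel_measurable lebesgue"
    by (rule borel_measurable_AE)
  have "(\<lambda>N. LINT t|lebesgue. s N t) \<longlonglongrightarrow> (LINT t|lebesgue. g t)"
  proof (rule integral_dominated_convergence[where w="\<lambda>t. (m2 * L) * indicator {0..<1} t"])
    show "integrable lebesgue (\<lambda>t. (m2 * L) * indicator {0..<1::real} t :: real)"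
      by (auto intro!: integrable_mult_right integrable_real_indicator)
    fix N
    show "AE t in lebesgue. norm (s N t) \<le> (m2 * L) * indicator {0..<1} t"
    proof (rule AE_I2)
      fix t
      show "norm (s N t) \<le> (m2 * L) * indicator {0..<1} t"
      proof (cases "\<exists>i<N. t \<in> {real i / real N..<real (Suc i) / real N}")
        case True
        then obtain i where i: "i < N" "t \<in> {real i / real N..<real (Suc i) / real N}" by blast
        have "0 \<le> real i / real N" "real (Suc i) / real N \<le> 1" using i(1) by auto
        then have "t \<in> {0..<1}" using i(2) unfolding atLeastLessThan_iff by linarith
        with cell[OF i] c_bound[OF i(1)] show ?thesis by simp
      next
        case False
        then have "s N t = 0" unfolding s_def by (intro sum.neutral) auto
        then show ?thesis using m2_pos \<open>L \<ge> 0\<close> by simp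
      qed
    qed
  qed (use g_meas s_meas lim in auto)
  then show ?thesis
    unfolding s_int by (simp add: path_cost_def set_lebesgue_integral_def g_def)
qed

end

section \<open>Polygonal paths and lower semicontinuity\<close>

lemma interpolation_cell:
  assumes "i < hops v" "0 \<le> s" "s \<le> 1"
  shows "interpolation v ((real i + s) / real (hops v)) = (1 - s) *\<^sub>R (v ! i) + s *\<^sub>R (v ! Suc i)"
proof -
  have m: "real (hops v) > 0" using assms by simp
  have eq: "real (hops v) * ((real i + s) / real (hops v)) = real i + s" using m by simp
  show ?thesis
  proof (cases "s = 1")
    case False
    then have "nat \<lfloor>real i + s\<rfloor> = i" using assms by linarith
    then show ?thesis unfolding interpolation_def Let_def eq using assms by simp
  next
    case True
    then have fl: "nat \<lfloor>real i + s\<rfloor> = Suc i" by linarith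
    show ?thesis
    proof (cases "Suc i = hops v")
      case True
      then have "min (Suc i) (hops v - 1) = i" by simp
      then show ?thesis unfolding interpolation_def Let_def eq fl using \<open>s = 1\<close> by simp
    next
      case False
      then have "min (Suc i) (hops v - 1) = Suc i" using assms by simp
      then show ?thesis unfolding interpolation_def Let_def eq fl using \<open>s = 1\<close> by simp
    qed
  qed
qed

text \<open>The time \<open>1\<close> belongs to the last cell, with \<open>s = 1\<close>, in accordance with the capped index
  in \<^const>\<open>interpolation\<close>.\<close>

lemma unit_interval_cell:
  assumes "t \<in> {0..1}" "0 < m"
  obtains i s where "i < m" "0 \<le> s" "s \<le> 1" "t = (real i + s) / real m"
proof (cases "t = 1")
  case True
  show ?thesis by (rule that[of "m - 1" 1]) (use True assms in auto)
next
  case False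
  define i where "i = nat \<lfloor>real m * t\<rfloor>"
  have "0 \<le> real m * t" using assms by simp
  then have i: "real i \<le> real m * t" "real m * t < real i + 1"
    unfolding i_def by linarith+
  have "real m * t < real m * 1" using assms False by (intro mult_strict_left_mono) auto
  then have "i < m" using i by simp
  then show ?thesis by (rule that[of i "real m * t - real i"]) (use i assms in \<open>auto simp: field_simps\<close>)
qed

lemma chain_cost_Cons:
  "chain_cost f ((!) (x # v)) (Suc m) = f x (v ! 0 - x) + chain_cost f ((!) v) m"
  unfolding chain_cost_def by (subst sum.lessThan_Suc_shift) simp

context finsler_integrand
begin

text \<open>At the fixed base point \<open>x\<close> this is subadditivity; moving the base point to the vertices
  of the chain costs the factor \<open>1 + \<kappa> * w\<close>.\<close>

lemma shortcut_le:
  assumes "x \<in> D" "j \<le> k" "0 \<le> w" and near: "\<And>l. j \<le> l \<Longrightarrow> l < k \<Longrightarrow> z l \<in> D \<and> dist x (z l) \<le> w"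
  shows "f x (z k - z j) \<le> (1 + \<kappa> * w) * (\<Sum>l\<in>{j..<k}. f (z l) (z (Suc l) - z l))"
  using assms(2) near
proof (induction k rule: dec_induct)
  case base
  then show ?case by (simp add: f_zero \<open>x \<in> D\<close>)
next
  case (step k)
  have zk: "z k \<in> D" "dist x (z k) \<le> w" using step by auto
  have "f x (z (Suc k) - z j) \<le> f x (z k - z j) + f x (z (Suc k) - z k)"
    using subadd[OF \<open>x \<in> D\<close>, of "z k - z j" "z (Suc k) - z k"] by simp
  also have "f x (z (Suc k) - z k) \<le> (1 + \<kappa> * dist x (z k)) * f (z k) (z (Suc k) - z k)"
    by (rule compare[OF \<open>x \<in> D\<close> zk(1)])
  also have "\<dots> \<le> (1 + \<kappa> * w) * f (z k) (z (Suc k) - z k)"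
    using zk \<kappa>_nonneg by (intro mult_right_mono nonneg add_left_mono mult_left_mono) auto
  also have "f x (z k - z j) \<le> (1 + \<kappa> * w) * (\<Sum>l\<in>{j..<k}. f (z l) (z (Suc l) - z l))"
    using step by auto
  finally show ?case using step by (simp add: algebra_simps)
qed

lemma refine_le:
  assumes lip: "L-lipschitz_on {0..1} \<gamma>" and inD: "\<And>t. t \<in> {0..1} \<Longrightarrow> \<gamma> t \<in> D"
    and "0 < N" "0 < M"
  shows "chain_cost f (grid \<gamma> N) N
    \<le> (1 + \<kappa> * (L / real N)) * chain_cost f (grid \<gamma> (N * M)) (N * M)"
proof -
  define z where "z l = \<gamma> (real l / real (N * M))" for l
  have "L \<ge> 0" using lip lipschitz_on_def by blast
  note in01 = grid_in_unit_interval[of _ "N * M"]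
  have coarse: "grid \<gamma> N i = z (i * M)" for i
    using assms(3,4) by (simp add: z_def)
  have "chain_cost f (grid \<gamma> N) N = (\<Sum>i<N. f (z (i * M)) (z (i * M + M) - z (i * M)))"
    unfolding chain_cost_def coarse by (simp add: add.commute)
  also have "\<dots> \<le> (\<Sum>i<N. (1 + \<kappa> * (L / real N)) * (\<Sum>l\<in>{i * M..<i * M + M}. f (z l) (z (Suc l) - z l)))"
  proof (intro sum_mono shortcut_le)
    fix i assume i: "i \<in> {..<N}"
    then have "Suc i * M \<le> N * M" by (intro mult_right_mono) auto
    then have iM: "i * M + M \<le> N * M" by simp
    have "i * M \<le> N * M" using iM by linarith
    then show "z (i * M) \<in> D" unfolding z_def by (intro inD in01)
    show "0 \<le> L / real N" using \<open>L \<ge> 0\<close> by simp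
    fix l assume l: "i * M \<le> l" "l < i * M + M"
    then have lN: "l \<le> N * M" "i * M \<le> N * M" using iM by linarith+
    have "real l - real (i * M) \<le> real M" using l by (simp flip: of_nat_mult of_nat_diff)
    have "dist (z (i * M)) (z l) \<le> L * dist (real (i * M) / real (N * M)) (real l / real (N * M))"
      unfolding z_def by (rule lipschitz_onD[OF lip in01[OF lN(2)] in01[OF lN(1)]])
    also have "dist (real (i * M) / real (N * M)) (real l / real (N * M)) = (real l - real (i * M)) / real (N * M)"
      using l(1) by (simp add: dist_real_def diff_divide_distrib[symmetric] flip: of_nat_mult)
    also have "\<dots> \<le> real M / real (N * M)"
      by (rule divide_right_mono) (use \<open>real l - real (i * M) \<le> real M\<close> in auto)
    also have "real M / real (N * M) = 1 / real N" using assms(3,4) by simp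
    finally have "dist (z (i * M)) (z l) \<le> L * (1 / real N)" using \<open>L \<ge> 0\<close> by (simp add: mult_left_mono)
    then show "z l \<in> D \<and> dist (z (i * M)) (z l) \<le> L / real N"
      unfolding z_def using inD[OF in01[OF lN(1)]] by simp
  qed simp
  also have "\<dots> = (1 + \<kappa> * (L / real N)) * (\<Sum>l<N * M. f (z l) (z (Suc l) - z l))"
    by (simp add: sum_distrib_left[symmetric] sum.nat_group)
  finally show ?thesis by (simp add: chain_cost_def z_def)
qed

text \<open>Refine the partition and let the refinement tend to the path cost.\<close>

theorem chain_cost_le_path_cost:
  assumes \<gamma>: "\<gamma> \<in> lip_paths D u v" and lip: "L-lipschitz_on {0..1} \<gamma>" and "0 < N"
  shows "chain_cost f (grid \<gamma> N) N \<le> (1 + \<kappa> * (L / real N)) * path_cost f \<gamma>"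
proof -
  note inD = lip_paths_in[OF \<gamma>]
  have "strict_mono (\<lambda>M. N * Suc M)" using \<open>0 < N\<close> by (intro strict_monoI) simp
  from LIMSEQ_subseq_LIMSEQ[OF chain_cost_tendsto_path_cost[OF \<gamma>] this]
  have "(\<lambda>M. chain_cost f (grid \<gamma> (N * Suc M)) (N * Suc M)) \<longlonglongrightarrow> path_cost f \<gamma>"
    by (simp only: o_def)
  then have "(\<lambda>M. (1 + \<kappa> * (L / real N)) * chain_cost f (grid \<gamma> (N * Suc M)) (N * Suc M))
      \<longlonglongrightarrow> (1 + \<kappa> * (L / real N)) * path_cost f \<gamma>"
    by (intro tendsto_mult tendsto_const)
  then show ?thesis
    by (rule LIMSEQ_le_const) (use refine_le[OF lip inD \<open>0 < N\<close>] in blast)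
qed

lemma path_cost_nonneg:
  assumes "\<gamma> \<in> lip_paths D u v" shows "0 \<le> path_cost f \<gamma>"
proof (rule LIMSEQ_le_const[OF chain_cost_tendsto_path_cost[OF assms]], intro exI allI impI)
  fix N :: nat
  show "0 \<le> chain_cost f (grid \<gamma> N) N"
    unfolding chain_cost_def
    by (intro sum_nonneg nonneg lip_paths_in[OF assms] grid_in_unit_interval) simp
qed

text \<open>For a fixed partition the chain cost is continuous under pointwise convergence of the paths,
  and it is bounded by the path cost up to a factor that tends to \<open>1\<close> uniformly in the paths.\<close>

theorem path_cost_lsc:
  assumes \<gamma>: "\<And>k. \<gamma> k \<in> lip_paths D u v" and lip: "\<And>k. L-lipschitz_on {0..1} (\<gamma> k)"
    and lim: "\<And>t. t \<in> {0..1} \<Longrightarrow> (\<lambda>k. \<gamma> k t) \<longlonglongrightarrow> \<sigma> t"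
    and cost: "\<And>k. path_cost f (\<gamma> k) \<le> c k" and "c \<longlonglongrightarrow> c'"
  shows "\<sigma> \<in> lip_paths D u v" and "path_cost f \<sigma> \<le> c'"
proof -
  note inD = lip_paths_in[OF \<gamma>]
  have \<sigma>D: "\<sigma> t \<in> D" if "t \<in> {0..1}" for t
    by (rule closed_sequentially[OF compact_imp_closed[OF D_compact] inD[OF that] lim[OF that]])
  have "L \<ge> 0" using lip lipschitz_on_def by blast
  have "L-lipschitz_on {0..1} \<sigma>"
  proof (rule lipschitz_onI)
    fix s t :: real assume st: "s \<in> {0..1}" "t \<in> {0..1}"
    have "(\<lambda>k. dist (\<gamma> k s) (\<gamma> k t)) \<longlonglongrightarrow> dist (\<sigma> s) (\<sigma> t)"
      by (intro tendsto_dist lim st)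
    then show "dist (\<sigma> s) (\<sigma> t) \<le> L * dist s t"
      by (rule LIMSEQ_le_const2) (use lipschitz_onD[OF lip st] in blast)
  qed fact
  moreover have "\<sigma> 0 = u" "\<sigma> 1 = v"
    using lim[of 0] lim[of 1] by (auto simp: lip_paths_ends[OF \<gamma>] LIMSEQ_const_iff)
  ultimately show \<sigma>: "\<sigma> \<in> lip_paths D u v"
    using \<sigma>D by (auto simp: lip_paths_def path_image_def pathstart_def pathfinish_def)
  have bound: "chain_cost f (grid \<sigma> N) N \<le> (1 + \<kappa> * (L / real N)) * c'" if "0 < N" for N
  proof -
    have "(\<lambda>k. chain_cost f (grid (\<gamma> k) N) N) \<longlonglongrightarrow> chain_cost f (grid \<sigma> N) N"
      unfolding chain_cost_def
      by (intro tendsto_sum f_tendsto tendsto_diff lim inD \<sigma>D grid_in_unit_interval) auto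
    moreover have "(\<lambda>k. (1 + \<kappa> * (L / real N)) * c k) \<longlonglongrightarrow> (1 + \<kappa> * (L / real N)) * c'"
      by (intro tendsto_mult tendsto_const assms)
    moreover have "chain_cost f (grid (\<gamma> k) N) N \<le> (1 + \<kappa> * (L / real N)) * c k" for k
    proof -
      have "chain_cost f (grid (\<gamma> k) N) N \<le> (1 + \<kappa> * (L / real N)) * path_cost f (\<gamma> k)"
        by (rule chain_cost_le_path_cost[OF \<gamma> lip that])
      also have "\<dots> \<le> (1 + \<kappa> * (L / real N)) * c k"
        using cost[of k] \<kappa>_nonneg \<open>L \<ge> 0\<close> by (intro mult_left_mono add_nonneg_nonneg mult_nonneg_nonneg) auto
      finally show ?thesis .
    qed
    ultimately show ?thesis by (intro LIMSEQ_le) auto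
  qed
  have "(\<lambda>N. (1 + \<kappa> * (L / real N)) * c') \<longlonglongrightarrow> (1 + \<kappa> * 0) * c'"
    by (intro tendsto_mult tendsto_add tendsto_const lim_const_over_n)
  moreover have "\<exists>N\<^sub>0. \<forall>N\<ge>N\<^sub>0. chain_cost f (grid \<sigma> N) N \<le> (1 + \<kappa> * (L / real N)) * c'"
    using bound by (intro exI[of _ 1]) auto
  ultimately have "path_cost f \<sigma> \<le> (1 + \<kappa> * 0) * c'"
    by (rule LIMSEQ_le[OF chain_cost_tendsto_path_cost[OF \<sigma>]])
  then show "path_cost f \<sigma> \<le> c'" by simp
qed

text \<open>The cost bound follows from partitions into \<open>m * M\<close> cells: \<open>M\<close> consecutive cells share one side
  of the polygon, so their steps are parallel and add up to the cost of the side.\<close>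

theorem interpolation_lip_path:
  assumes "length v \<ge> 2" and vD: "set v \<subseteq> D" and "0 \<le> h"
    and steps: "\<And>i. i < hops v \<Longrightarrow> dist (v ! i) (v ! Suc i) \<le> h"
  shows "(real (hops v) * h)-lipschitz_on {0..1} (interpolation v)"
    and "interpolation v \<in> lip_paths D (hd v) (last v)"
    and "path_cost f (interpolation v) \<le> (1 + \<kappa> * h) * list_cost f v"
proof -
  let ?m = "hops v"
  have m: "0 < ?m" "Suc ?m = length v" using assms(1) by (auto simp: hops_def)
  have nthD: "v ! i \<in> D" if "i \<le> ?m" for i using vD that m(2) by auto
  show lip: "(real ?m * h)-lipschitz_on {0..1} (interpolation v)"
  proof (rule lipschitz_on_closed_Union[where I="{..<?m}" and U="\<lambda>i. {real i / real ?m..real (Suc i) / real ?m}"])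
    fix i assume "i \<in> {..<?m}"
    then have i: "i < ?m" by simp
    show "(real ?m * h)-lipschitz_on {real i / real ?m..real (Suc i) / real ?m} (interpolation v)"
    proof (rule lipschitz_onI)
      fix x y assume "x \<in> {real i / real ?m..real (Suc i) / real ?m}" "y \<in> {real i / real ?m..real (Suc i) / real ?m}"
      then have s: "x = (real i + (real ?m * x - real i)) / real ?m" "0 \<le> real ?m * x - real i" "real ?m * x - real i \<le> 1"
        "y = (real i + (real ?m * y - real i)) / real ?m" "0 \<le> real ?m * y - real i" "real ?m * y - real i \<le> 1"
        using m by (auto simp: field_simps)
      have xy: "interpolation v x = (1 - (real ?m * x - real i)) *\<^sub>R (v ! i) + (real ?m * x - real i) *\<^sub>R (v ! Suc i)"
        "interpolation v y = (1 - (real ?m * y - real i)) *\<^sub>R (v ! i) + (real ?m * y - real i) *\<^sub>R (v ! Suc i)"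
        using interpolation_cell[OF i s(2,3)] interpolation_cell[OF i s(5,6)] s(1,4) by metis+
      have "interpolation v x - interpolation v y = (real ?m * (x - y)) *\<^sub>R (v ! Suc i - v ! i)"
        unfolding xy by (simp add: algebra_simps)
      then have "dist (interpolation v x) (interpolation v y) = real ?m * \<bar>x - y\<bar> * dist (v ! i) (v ! Suc i)"
        by (simp add: dist_norm abs_mult norm_minus_commute)
      also have "\<dots> \<le> real ?m * \<bar>x - y\<bar> * h" using steps[OF i] by (intro mult_left_mono) auto
      finally show "dist (interpolation v x) (interpolation v y) \<le> real ?m * h * dist x y"
        by (simp add: dist_real_def mult.assoc mult.commute[of h])
    qed (use \<open>0 \<le> h\<close> in simp)
  next
    show "{0..1} \<subseteq> (\<Union>i\<in>{..<?m}. {real i / real ?m..real (Suc i) / real ?m})"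
    proof
      fix t :: real assume "t \<in> {0..1}"
      then obtain i s where "i < ?m" "0 \<le> s" "s \<le> 1" "t = (real i + s) / real ?m"
        using unit_interval_cell m(1) by metis
      then show "t \<in> (\<Union>i\<in>{..<?m}. {real i / real ?m..real (Suc i) / real ?m})"
        by (intro UN_I[of i]) (auto simp: divide_right_mono)
    qed
  qed (use \<open>0 \<le> h\<close> in auto)
  have convD: "(1 - s) *\<^sub>R (v ! i) + s *\<^sub>R (v ! Suc i) \<in> D" if "i < ?m" "0 \<le> s" "s \<le> 1" for i s
    using that by (intro convexD[OF D_convex] nthD) auto
  have inD: "interpolation v t \<in> D" if t: "t \<in> {0..1}" for t
    by (rule unit_interval_cell[OF t m(1)]) (metis interpolation_cell convD)
  have "interpolation v 0 = v ! 0" using interpolation_cell[of 0 v 0] m by simp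
  moreover have "interpolation v 1 = v ! ?m"
    using interpolation_cell[of "?m - 1" v 1] m by (simp add: of_nat_diff)
  moreover have "v \<noteq> []" using assms(1) by auto
  ultimately show path: "interpolation v \<in> lip_paths D (hd v) (last v)"
    using lip inD by (auto simp: lip_paths_def path_image_def pathstart_def pathfinish_def hd_conv_nth last_conv_nth hops_def)
  have bound: "chain_cost f (grid (interpolation v) (?m * M)) (?m * M)
      \<le> (1 + \<kappa> * h) * list_cost f v" if "0 < M" for M
  proof -
    let ?z = "\<lambda>j. interpolation v (real j / real (?m * M))"
    have z: "?z (i * M + r) = (1 - real r / real M) *\<^sub>R (v ! i) + (real r / real M) *\<^sub>R (v ! Suc i)"
      if "i < ?m" "r \<le> M" for i r
    proof -
      have "real (i * M + r) / real (?m * M) = (real i + real r / real M) / real ?m"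
        using \<open>0 < M\<close> m(1) by (simp add: field_simps)
      then show ?thesis using interpolation_cell[of i v "real r / real M"] that \<open>0 < M\<close>
        by (simp add: divide_le_eq_1)
    qed
    have "chain_cost f ?z (?m * M) = (\<Sum>i<?m. \<Sum>j\<in>{i * M..<i * M + M}. f (?z j) (?z (Suc j) - ?z j))"
      unfolding chain_cost_def by (rule sum.nat_group[symmetric])
    also have "\<dots> = (\<Sum>i<?m. \<Sum>r<M. f (?z (i * M + r)) (?z (i * M + Suc r) - ?z (i * M + r)))"
    proof (rule sum.cong[OF refl])
      fix i
      show "(\<Sum>j\<in>{i * M..<i * M + M}. f (?z j) (?z (Suc j) - ?z j)) =
          (\<Sum>r<M. f (?z (i * M + r)) (?z (i * M + Suc r) - ?z (i * M + r)))"
        using sum.shift_bounds_nat_ivl[of "\<lambda>j. f (?z j) (?z (Suc j) - ?z j)" 0 "i * M" M]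
        by (simp add: atLeast0LessThan add.commute[of _ "i * M"] del: of_nat_add of_nat_mult of_nat_Suc)
    qed
    also have "\<dots> \<le> (\<Sum>i<?m. \<Sum>r<M. (1 + \<kappa> * h) * ((1 / real M) * f (v ! i) (v ! Suc i - v ! i)))"
    proof (intro sum_mono)
      fix i r assume "i \<in> {..<?m}" "r \<in> {..<M}"
      then have ir: "i < ?m" "r < M" by auto
      let ?x = "?z (i * M + r)"
      have x: "?x = (1 - real r / real M) *\<^sub>R (v ! i) + (real r / real M) *\<^sub>R (v ! Suc i)"
        using z[of i r] ir by simp
      have xD: "?x \<in> D" unfolding x using ir by (intro convD) auto
      have "?x - v ! i = (real r / real M) *\<^sub>R (v ! Suc i - v ! i)" unfolding x by (simp add: algebra_simps)
      then have "dist ?x (v ! i) = real r / real M * dist (v ! i) (v ! Suc i)"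
        by (simp add: dist_norm norm_minus_commute)
      also have "\<dots> \<le> 1 * dist (v ! i) (v ! Suc i)"
        using ir by (intro mult_right_mono) auto
      finally have dx: "dist ?x (v ! i) \<le> h" using steps[OF ir(1)] by simp
      have "?z (i * M + Suc r) - ?x = (real (Suc r) / real M - real r / real M) *\<^sub>R (v ! Suc i - v ! i)"
        using z[of i "Suc r"] ir unfolding x by (simp add: algebra_simps del: of_nat_Suc)
      also have "real (Suc r) / real M - real r / real M = 1 / real M" by (simp add: diff_divide_distrib[symmetric])
      finally have "f ?x (?z (i * M + Suc r) - ?x) = 1 / real M * f ?x (v ! Suc i - v ! i)"
        using scale[OF xD] by simp
      also have "f ?x (v ! Suc i - v ! i) \<le> (1 + \<kappa> * dist ?x (v ! i)) * f (v ! i) (v ! Suc i - v ! i)"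
        using ir by (intro compare xD nthD) auto
      also have "\<dots> \<le> (1 + \<kappa> * h) * f (v ! i) (v ! Suc i - v ! i)"
        using dx \<kappa>_nonneg ir by (intro mult_right_mono nonneg nthD add_left_mono mult_left_mono) auto
      finally show "f ?x (?z (i * M + Suc r) - ?x) \<le> (1 + \<kappa> * h) * ((1 / real M) * f (v ! i) (v ! Suc i - v ! i))"
        by (simp add: mult_left_mono divide_right_mono)
    qed
    also have "\<dots> = (1 + \<kappa> * h) * list_cost f v"
      using \<open>0 < M\<close> by (simp add: chain_cost_def sum_distrib_left)
    finally show ?thesis .
  qed
  have "strict_mono (\<lambda>M. ?m * Suc M)" using m(1) by (intro strict_monoI) simp
  from LIMSEQ_subseq_LIMSEQ[OF chain_cost_tendsto_path_cost[OF path] this]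
  have "(\<lambda>M. chain_cost f (grid (interpolation v) (?m * Suc M)) (?m * Suc M)) \<longlonglongrightarrow> path_cost f (interpolation v)"
    by (simp only: o_def)
  then show "path_cost f (interpolation v) \<le> (1 + \<kappa> * h) * list_cost f v"
    by (rule LIMSEQ_le_const2) (use bound in blast)
qed

end

section \<open>Compactness and existence of minimizers\<close>

context finsler_integrand
begin

text \<open>Greedy resampling: from a chain with tiny steps, always jump to the first point that is
  farther than \<open>h / 2\<close> away. Each jump but the last uses up at least \<open>h / 2\<close> of the length,
  which bounds the number of jumps.\<close>

lemma greedy_resample:
  assumes "0 < h" and yD: "\<And>i. i \<le> N \<Longrightarrow> y i \<in> D"
    and fine: "\<And>i. i < N \<Longrightarrow> dist (y i) (y (Suc i)) \<le> h / 2" and "j < N"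
  shows "\<exists>v. 2 \<le> length v \<and> set v \<subseteq> D \<and> hd v = y j \<and> last v = y N \<and>
    (\<forall>i<hops v. dist (v ! i) (v ! Suc i) \<le> h) \<and>
    list_cost f v \<le> (1 + \<kappa> * h) * (\<Sum>l\<in>{j..<N}. f (y l) (y (Suc l) - y l)) \<and>
    (real (hops v) - 1) * (h / 2) \<le> (\<Sum>l\<in>{j..<N}. dist (y l) (y (Suc l)))"
  using \<open>j < N\<close>
proof (induction "N - j" arbitrary: j rule: less_induct)
  case less
  let ?S = "\<lambda>j k. \<Sum>l\<in>{j..<k}. f (y l) (y (Suc l) - y l)"
  let ?T = "\<lambda>j k. \<Sum>l\<in>{j..<k}. dist (y l) (y (Suc l))"
  let ?far = "\<lambda>k. j < k \<and> h / 2 < dist (y j) (y k)"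
  have near_step: "dist (y j) (y (Suc l)) \<le> h" if "l < N" "dist (y j) (y l) \<le> h / 2" for l
    using dist_triangle[of "y j" "y (Suc l)" "y l"] fine[OF that(1)] that(2) by simp
  have step_le: "f (y j) (y k - y j) \<le> (1 + \<kappa> * h) * ?S j k"
    if "j < k" "k \<le> N" "\<And>l. j < l \<Longrightarrow> l < k \<Longrightarrow> dist (y j) (y l) \<le> h / 2" for k
  proof (rule shortcut_le)
    fix l assume "j \<le> l" "l < k"
    then have "l = j \<or> dist (y j) (y l) \<le> h / 2" "l \<le> N"
      using that(2) that(3)[of l] by (cases "j < l"; force)+
    then show "y l \<in> D \<and> dist (y j) (y l) \<le> h" using yD[of l] \<open>0 < h\<close> by auto
  qed (use that yD \<open>0 < h\<close> in auto)
  show ?case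
  proof (cases "\<exists>k<N. ?far k")
    case False
    then have near: "dist (y j) (y l) \<le> h / 2" if "j < l" "l < N" for l using that by force
    have "dist (y j) (y (N - 1)) \<le> h / 2"
      using near[of "N - 1"] less.prems \<open>0 < h\<close> by (cases "j = N - 1") auto
    then have "dist (y j) (y N) \<le> h" using near_step[of "N - 1"] less.prems by simp
    then show ?thesis
      using less.prems yD step_le[of N] near
      by (intro exI[of _ "[y j, y N]"]) (auto simp: hops_def chain_cost_def sum_nonneg)
  next
    case True
    define k where "k = (LEAST k. ?far k)"
    obtain k\<^sub>0 where k\<^sub>0: "k\<^sub>0 < N" "?far k\<^sub>0" using True by auto
    have k: "?far k" unfolding k_def by (rule LeastI[of ?far, OF k\<^sub>0(2)])
    have "k \<le> k\<^sub>0" unfolding k_def by (rule Least_le[of ?far, OF k\<^sub>0(2)])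
    then have "k < N" using k\<^sub>0(1) by simp
    have min: "dist (y j) (y l) \<le> h / 2" if "j < l" "l < k" for l
    proof -
      have "\<not> ?far l" by (rule not_less_Least) (use that in \<open>simp add: k_def\<close>)
      then show ?thesis using that by simp
    qed
    have "dist (y j) (y (k - 1)) \<le> h / 2"
      using min[of "k - 1"] k \<open>0 < h\<close> by (cases "j = k - 1") auto
    then have jk: "dist (y j) (y k) \<le> h" using near_step[of "k - 1"] k \<open>k < N\<close> by simp
    have "N - k < N - j" using k \<open>k < N\<close> by linarith
    from less.hyps[OF this \<open>k < N\<close>]
    obtain v where v: "2 \<le> length v" "set v \<subseteq> D" "hd v = y k" "last v = y N"
      "\<forall>i<hops v. dist (v ! i) (v ! Suc i) \<le> h"
      "list_cost f v \<le> (1 + \<kappa> * h) * ?S k N"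
      "(real (hops v) - 1) * (h / 2) \<le> ?T k N"
      by (elim exE conjE)
    have "v \<noteq> []" using v(1) by auto
    then have v0: "v ! 0 = y k" using v(3) by (simp add: hd_conv_nth)
    have hops: "hops (y j # v) = Suc (hops v)" using v(1) by (auto simp: hops_def)
    have "dist (y j) (y k) \<le> ?T j k" using k by (intro dist_le_sum_steps) simp
    moreover have "?T j N = ?T j k + ?T k N" "?S j N = ?S j k + ?S k N"
      using k \<open>k < N\<close> by (simp_all add: sum.atLeastLessThan_concat)
    ultimately show ?thesis
      using v jk k \<open>k < N\<close> \<open>v \<noteq> []\<close> step_le[of k] min yD[of j] less.prems
      by (intro exI[of _ "y j # v"])
        (auto simp: hops chain_cost_Cons v0 nth_Cons algebra_simps split: nat.split)
  qed
qed

text \<open>The last condition bounds the speed of the interpolation, in which each step takes the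
  same time.\<close>

definition (in -) short_steps :: "'a::euclidean_space set \<Rightarrow> 'a \<Rightarrow> 'a \<Rightarrow> real \<Rightarrow> real \<Rightarrow> 'a list \<Rightarrow> bool" where
  "short_steps D u v h B w \<longleftrightarrow> 2 \<le> length w \<and> set w \<subseteq> D \<and> hd w = u \<and> last w = v \<and>
    (\<forall>i<hops w. dist (w ! i) (w ! Suc i) \<le> h) \<and> real (hops w) * h \<le> B"

text \<open>The resampling starts from a partition that is finer than \<open>h / 2\<close> and whose chain cost
  exceeds the path cost by less than \<open>e\<close>; the length of a chain is at most its cost divided by \<open>m1\<close>.\<close>

lemma resampled_polygon:
  assumes \<gamma>: "\<gamma> \<in> lip_paths D u v" and "0 < h" "0 < e"
  shows "\<exists>w. short_steps D u v h (2 * ((path_cost f \<gamma> + e) / m1) + h) w \<and>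
    list_cost f w \<le> (1 + \<kappa> * h) * (path_cost f \<gamma> + e)"
proof -
  obtain L where lip: "L-lipschitz_on {0..1} \<gamma>" using \<gamma> by (auto simp: lip_paths_def)
  have "\<forall>\<^sub>F N in sequentially. chain_cost f (grid \<gamma> N) N < path_cost f \<gamma> + e"
    using \<open>0 < e\<close> by (intro order_tendstoD(2)[OF chain_cost_tendsto_path_cost[OF \<gamma>]]) simp
  moreover have "\<forall>\<^sub>F N in sequentially. L / real N < h / 2"
    using \<open>0 < h\<close> by (intro order_tendstoD(2)[OF lim_const_over_n]) simp
  moreover have "\<forall>\<^sub>F N::nat in sequentially. 0 < N" by (rule eventually_gt_at_top)
  ultimately have "\<forall>\<^sub>F N in sequentially. chain_cost f (grid \<gamma> N) N < path_cost f \<gamma> + e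
      \<and> L / real N < h / 2 \<and> 0 < N"
    by eventually_elim auto
  then obtain N where N: "chain_cost f (grid \<gamma> N) N < path_cost f \<gamma> + e"
      "L / real N < h / 2" "0 < N"
    by (auto simp: eventually_sequentially)
  define y where "y i = grid \<gamma> N i" for i
  have yD: "y i \<in> D" if "i \<le> N" for i
    unfolding y_def by (intro lip_paths_in[OF \<gamma>] grid_in_unit_interval that)
  have fine: "dist (y i) (y (Suc i)) \<le> h / 2" if "i < N" for i
    unfolding y_def using lipschitz_grid_step[OF lip that] N(2) by linarith
  let ?C = "chain_cost f y N"
  have "y = (grid \<gamma> N)" by (auto simp: y_def)
  with N(1) have C: "?C < path_cost f \<gamma> + e" by simp
  have len: "(\<Sum>l<N. dist (y l) (y (Suc l))) \<le> ?C / m1" by (intro chain_length_le yD) simp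
  obtain w where w: "2 \<le> length w" "set w \<subseteq> D" "hd w = y 0" "last w = y N"
    "\<forall>i<hops w. dist (w ! i) (w ! Suc i) \<le> h"
    "list_cost f w \<le> (1 + \<kappa> * h) * ?C"
    "(real (hops w) - 1) * (h / 2) \<le> (\<Sum>l<N. dist (y l) (y (Suc l)))"
    using greedy_resample[of h N y 0, OF \<open>0 < h\<close> yD fine \<open>0 < N\<close>] by (auto simp: atLeast0LessThan chain_cost_def)
  have "(1 + \<kappa> * h) * ?C \<le> (1 + \<kappa> * h) * (path_cost f \<gamma> + e)"
    using C \<kappa>_nonneg \<open>0 < h\<close> by (intro mult_left_mono) auto
  moreover have "?C / m1 \<le> (path_cost f \<gamma> + e) / m1"
    using C m1_pos by (intro divide_right_mono) auto
  then have q: "(real (hops w) - 1) * (h / 2) \<le> (path_cost f \<gamma> + e) / m1"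
    using w(7) len by linarith
  have "a * h \<le> 2 * q + h" if "(a - 1) * (h / 2) \<le> q" for a q
    using that by (simp add: algebra_simps)
  from this[OF q] have "real (hops w) * h \<le> 2 * ((path_cost f \<gamma> + e) / m1) + h" .
  moreover have "y 0 = u" "y N = v" using lip_paths_ends[OF \<gamma>] \<open>0 < N\<close> by (simp_all add: y_def)
  ultimately show ?thesis
    using w(1-6) unfolding short_steps_def by (intro exI[of _ w]) (metis order_trans)
qed

text \<open>By the theorem of Arzela and Ascoli a subsequence of the \<open>B\<close>-Lipschitz interpolations converges
  uniformly, and lower semicontinuity bounds the cost of the limit.\<close>

theorem polygons_compact:
  assumes short: "\<And>k. short_steps D u v (h k) B (w k)" and h: "\<And>k. 0 \<le> h k" "h \<longlonglongrightarrow> 0"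
    and c: "\<And>k. list_cost f (w k) \<le> c k" "c \<longlonglongrightarrow> c'"
  shows "\<exists>\<gamma> r. strict_mono r \<and> \<gamma> \<in> lip_paths D u v \<and> path_cost f \<gamma> \<le> c' \<and>
    uniform_limit {0..1} (\<lambda>k. interpolation (w (r k))) \<gamma> sequentially"
proof -
  let ?l = "\<lambda>k. interpolation (w k)"
  have w: "2 \<le> length (w k)" "set (w k) \<subseteq> D" "hd (w k) = u" "last (w k) = v"
    and steps: "i < hops (w k) \<Longrightarrow> dist (w k ! i) (w k ! Suc i) \<le> h k"
    and B: "real (hops (w k)) * h k \<le> B" for k i
    using short[of k] by (auto simp: short_steps_def)
  note ip = interpolation_lip_path[OF w(1,2) h(1) steps]
  have lip: "B-lipschitz_on {0..1} (?l k)" for k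
    using lipschitz_on_mono[OF ip(1) subset_refl B] .
  have path: "?l k \<in> lip_paths D u v" for k using ip(2)[of k] w(3,4) by simp
  have "B \<ge> 0" using lip lipschitz_on_def by blast
  obtain R where R: "\<And>x. x \<in> D \<Longrightarrow> norm x \<le> R"
    using compact_imp_bounded[OF D_compact] by (auto simp: bounded_iff)
  have bdd: "norm (?l k t) \<le> R" if "t \<in> {0..1}" for k t
    by (intro R lip_paths_in[OF path] that)
  have equi: "\<exists>d>0. \<forall>n y. y \<in> {0..1} \<and> norm (x - y) < d \<longrightarrow> norm (?l n x - ?l n y) < e"
    if "x \<in> {0..1}" "0 < e" for x e :: real
  proof (intro exI[of _ "e / (B + 1)"] conjI allI impI)
    show "0 < e / (B + 1)" using \<open>B \<ge> 0\<close> that by simp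
    fix n y assume y: "y \<in> {0..1} \<and> norm (x - y) < e / (B + 1)"
    have "norm (?l n x - ?l n y) \<le> B * norm (x - y)"
      using lipschitz_onD[OF lip that(1), of y n] y by (simp add: dist_norm)
    also have "\<dots> \<le> (B + 1) * norm (x - y)" by (intro mult_right_mono) auto
    also have "\<dots> < e" using y \<open>B \<ge> 0\<close> by (simp add: field_simps)
    finally show "norm (?l n x - ?l n y) < e" .
  qed
  obtain \<gamma> r where r: "strict_mono (r :: nat \<Rightarrow> nat)"
    and conv: "\<And>e. 0 < e \<Longrightarrow> \<exists>N. \<forall>n x. n \<ge> N \<and> x \<in> {0..1} \<longrightarrow> norm (?l (r n) x - \<gamma> x) < e"
    using Arzela_Ascoli[of "{0..1}" ?l R, OF compact_Icc bdd equi] by metis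
  have ul: "uniform_limit {0..1} (\<lambda>k. ?l (r k)) \<gamma> sequentially"
    unfolding uniform_limit_iff eventually_sequentially dist_norm using conv by metis
  have cr: "(\<lambda>k. (1 + \<kappa> * h (r k)) * c (r k)) \<longlonglongrightarrow> (1 + \<kappa> * 0) * c'"
    using LIMSEQ_subseq_LIMSEQ[OF h(2) r] LIMSEQ_subseq_LIMSEQ[OF c(2) r]
    by (intro tendsto_mult tendsto_add tendsto_const) (auto simp: o_def)
  have cost: "path_cost f (?l (r k)) \<le> (1 + \<kappa> * h (r k)) * c (r k)" for k
  proof -
    have "path_cost f (?l (r k)) \<le> (1 + \<kappa> * h (r k)) * chain_cost f ((!) (w (r k))) (hops (w (r k)))"
      by (rule ip(3))
    also have "\<dots> \<le> (1 + \<kappa> * h (r k)) * c (r k)"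
      using h(1)[of "r k"] \<kappa>_nonneg by (intro mult_left_mono c) auto
    finally show ?thesis .
  qed
  have "\<gamma> \<in> lip_paths D u v" "path_cost f \<gamma> \<le> (1 + \<kappa> * 0) * c'"
    using path_cost_lsc[OF path lip tendsto_uniform_limitI[OF ul] cost cr] by auto
  with r ul show ?thesis by auto
qed

theorem minimizer_exists:
  assumes "u \<in> D" "v \<in> D"
  shows "argmin_set (path_cost f) (lip_paths D u v) \<noteq> {}"
proof -
  let ?P = "lip_paths D u v"
  define \<mu> where "\<mu> = (INF \<gamma>\<in>?P. path_cost f \<gamma>)"
  have "interpolation [u, v] \<in> lip_paths D (hd [u, v]) (last [u, v])"
    by (rule interpolation_lip_path(2)[where h="dist u v"]) (use assms in \<open>auto simp: hops_def\<close>)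
  then have ne: "?P \<noteq> {}" by auto
  have bdd: "bdd_below (path_cost f ` ?P)"
    by (rule bdd_belowI[of _ 0]) (auto simp: path_cost_nonneg)
  have \<mu>_le: "\<mu> \<le> path_cost f \<gamma>" if "\<gamma> \<in> ?P" for \<gamma>
    unfolding \<mu>_def by (rule cINF_lower[OF bdd that])
  define h where "h k = 1 / real (Suc k)" for k
  have h: "0 < h k" "h k \<le> 1" for k by (auto simp: h_def)
  have "\<exists>\<gamma>\<in>?P. path_cost f \<gamma> < \<mu> + h k" for k
    using cINF_less_iff[OF ne bdd, of "\<mu> + h k"] h(1)[of k] by (simp add: \<mu>_def)
  then obtain \<gamma> where \<gamma>: "\<And>k. \<gamma> k \<in> ?P" "\<And>k. path_cost f (\<gamma> k) < \<mu> + h k" by metis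
  obtain w where w: "\<And>k. short_steps D u v (h k) (2 * ((path_cost f (\<gamma> k) + h k) / m1) + h k) (w k)"
    and cost: "\<And>k. list_cost f (w k) \<le> (1 + \<kappa> * h k) * (path_cost f (\<gamma> k) + h k)"
  proof -
    have "\<exists>w. short_steps D u v (h k) (2 * ((path_cost f (\<gamma> k) + h k) / m1) + h k) w \<and>
        list_cost f w \<le> (1 + \<kappa> * h k) * (path_cost f (\<gamma> k) + h k)" for k
      by (intro resampled_polygon \<gamma>(1) h(1))
    then show thesis using that by metis
  qed
  have hlim: "h \<longlonglongrightarrow> 0"
    unfolding h_def using LIMSEQ_inverse_real_of_nat by (simp add: inverse_eq_divide)
  have "\<exists>\<sigma> r. strict_mono r \<and> \<sigma> \<in> ?P \<and> path_cost f \<sigma> \<le> (1 + \<kappa> * 0) * (\<mu> + 2 * 0) \<and>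
    uniform_limit {0..1} (\<lambda>k. interpolation (w (r k))) \<sigma> sequentially"
  proof (rule polygons_compact[OF _ less_imp_le[OF h(1)] hlim])
    fix k
    have "path_cost f (\<gamma> k) + h k \<le> \<mu> + 2 * h k" using \<gamma>(2)[of k] by simp
    then have "(1 + \<kappa> * h k) * (path_cost f (\<gamma> k) + h k) \<le> (1 + \<kappa> * h k) * (\<mu> + 2 * h k)"
      using \<kappa>_nonneg h(1)[of k] by (intro mult_left_mono) auto
    with cost show "list_cost f (w k) \<le> (1 + \<kappa> * h k) * (\<mu> + 2 * h k)"
      by (rule order_trans)
    have "(path_cost f (\<gamma> k) + h k) / m1 \<le> (\<mu> + 2) / m1"
      using \<gamma>(2)[of k] h(2)[of k] m1_pos by (intro divide_right_mono) auto
    then show "short_steps D u v (h k) (2 * ((\<mu> + 2) / m1) + 1) (w k)"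
      using w[of k] h(2)[of k] unfolding short_steps_def by (meson add_mono mult_left_mono order_trans zero_le_numeral)
  next
    show "(\<lambda>k. (1 + \<kappa> * h k) * (\<mu> + 2 * h k)) \<longlonglongrightarrow> (1 + \<kappa> * 0) * (\<mu> + 2 * 0)"
      by (intro tendsto_intros hlim)
  qed
  then obtain \<sigma> where "\<sigma> \<in> ?P" "path_cost f \<sigma> \<le> \<mu>" by auto
  then have "\<sigma> \<in> argmin_set (path_cost f) ?P"
    using \<mu>_le unfolding argmin_set_def is_arg_min_def by force
  then show ?thesis by blast
qed

end

section \<open>Paths in finite graphs\<close>

lemma graph_pathsD:
  assumes "v \<in> graph_paths S \<epsilon> a b"
  shows "2 \<le> length v" "set v \<subseteq> S" "hd v = a" "last v = b" "Suc (hops v) = length v"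
    "v ! 0 = a" "v ! hops v = b" "a \<in> S"
    and "\<And>i. i < hops v \<Longrightarrow> dist (v ! i) (v ! Suc i) < \<epsilon>"
    and "\<And>i. i < hops v \<Longrightarrow> v ! i \<noteq> v ! Suc i"
    and "\<And>i. i \<le> hops v \<Longrightarrow> v ! i \<in> S"
proof -
  have v: "2 \<le> length v" "set v \<subseteq> S" "hd v = a" "last v = b"
    and step: "\<And>i. Suc i < length v \<Longrightarrow> 0 < norm (v ! Suc i - v ! i) \<and> norm (v ! Suc i - v ! i) < \<epsilon>"
    using assms by (auto simp: graph_paths_def)
  then have ne: "v \<noteq> []" by auto
  show "2 \<le> length v" "set v \<subseteq> S" "hd v = a" "last v = b" by fact+
  show hops: "Suc (hops v) = length v" using v(1) by (simp add: hops_def)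
  show "v ! 0 = a" "v ! hops v = b"
    using v ne by (auto simp: hops_def hd_conv_nth last_conv_nth)
  show "a \<in> S" using v(2,3) ne by auto
  show "dist (v ! i) (v ! Suc i) < \<epsilon>" if "i < hops v" for i
    using step[of i] that hops by (simp add: dist_norm norm_minus_commute)
  show "v ! i \<noteq> v ! Suc i" if "i < hops v" for i
    using step[of i] that hops by auto
  show "v ! i \<in> S" if "i \<le> hops v" for i
    using v(2) that hops by (metis le_imp_less_Suc nth_mem subsetD)
qed

lemma graph_pathsI:
  assumes "2 \<le> length v" "set v \<subseteq> S" "hd v = a" "last v = b"
    and "\<And>i. i < hops v \<Longrightarrow> v ! i \<noteq> v ! Suc i \<and> dist (v ! i) (v ! Suc i) < \<epsilon>"
  shows "v \<in> graph_paths S \<epsilon> a b"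
  using assms by (force simp: graph_paths_def hops_def dist_norm norm_minus_commute)

text \<open>Moving the points of a partition to sample points may produce repetitions, which are not
  allowed in graph paths.\<close>

lemma chain_cost_remdups_adj:
  assumes "\<And>x. x \<in> set v \<Longrightarrow> f x 0 = 0"
  shows "list_cost f (remdups_adj v) = list_cost f v"
  using assms
proof (induction v rule: remdups_adj.induct)
  case (3 x y xs)
  have Cons: "list_cost f (z # w) = f z (w ! 0 - z) + list_cost f w"
    if "w \<noteq> []" for z w
    using that chain_cost_Cons[of f z w "hops w"] by (cases w) (auto simp: hops_def)
  have hd0: "remdups_adj (y # xs) ! 0 = y"
    by (simp add: hd_conv_nth[symmetric])
  show ?case
    using 3 by (auto simp: Cons hd0)
qed auto

text \<open>By the intermediate value theorem \<open>s\<close> is onto.\<close>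

lemma lipschitz_reparametrization_image:
  fixes s :: "real \<Rightarrow> real"
  assumes "s ` {0..1} \<subseteq> {0..1}" "L-lipschitz_on {0..1} s" "s 0 = 0" "s 1 = 1"
    and "\<And>t. t \<in> {0..1} \<Longrightarrow> \<sigma> t = \<gamma> (s t)"
  shows "path_image \<sigma> = path_image \<gamma>"
proof -
  have "{0..1} \<subseteq> s ` {0..1}"
  proof
    fix y :: real assume "y \<in> {0..1}"
    then show "y \<in> s ` {0..1}"
      using IVT'[of s 0 y 1] lipschitz_on_continuous_on[OF assms(2)] assms(3,4) by auto
  qed
  with assms(1) have "s ` {0..1} = {0..1}" by blast
  then have "\<gamma> ` {0..1} = \<gamma> ` s ` {0..1}" by simp
  also have "\<dots> = \<sigma> ` {0..1}" using assms(5) by (auto simp: image_image)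
  finally show ?thesis by (simp add: path_image_def)
qed

text \<open>The vertices are values of the interpolation, and each of its values is within one step of a
  vertex.\<close>

lemma d_haus_interpolation:
  fixes v :: "'a::euclidean_space list"
  assumes "2 \<le> length v" and steps: "\<And>i. i < hops v \<Longrightarrow> dist (v ! i) (v ! Suc i) \<le> h"
    and near: "\<And>t. t \<in> {0..1} \<Longrightarrow> dist (interpolation v t) (\<gamma> t) \<le> e"
  shows "0 \<le> d_haus (set v) (path_image \<gamma>)" "d_haus (set v) (path_image \<gamma>) \<le> e + h"
proof -
  have m: "0 < hops v" "Suc (hops v) = length v" and ne: "v \<noteq> []" using assms(1) by (auto simp: hops_def)
  have "0 \<le> h" using steps[OF m(1)] zero_le_dist order_trans by blast
  have "hd v \<in> set v" using ne by simp
  then have "infdist (hd v) (path_image \<gamma>) \<le> (SUP x\<in>set v. infdist x (path_image \<gamma>))"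
    by (intro cSUP_upper) auto
  then show "0 \<le> d_haus (set v) (path_image \<gamma>)"
    unfolding d_haus_def using infdist_nonneg[of "hd v" "path_image \<gamma>"] by linarith
  have "(SUP x\<in>set v. infdist x (path_image \<gamma>)) \<le> e + h"
  proof (rule cSUP_least)
    fix x assume "x \<in> set v"
    then obtain i where i: "i < length v" "x = v ! i" by (auto simp: in_set_conv_nth)
    define t where "t = real i / real (hops v)"
    have t: "t \<in> {0..1}" unfolding t_def by (intro grid_in_unit_interval) (use i m in simp)
    have "interpolation v t = x"
    proof (cases "i = hops v")
      case True
      then show ?thesis using interpolation_cell[of "hops v - 1" v 1] m i by (simp add: t_def of_nat_diff)
    next
      case False
      then show ?thesis using interpolation_cell[of i v 0] m i by (simp add: t_def)
    qed
    then have "infdist x (path_image \<gamma>) \<le> e"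
      using near[OF t] infdist_le2[of "\<gamma> t" "path_image \<gamma>"] t by (auto simp: path_image_def)
    with \<open>0 \<le> h\<close> show "infdist x (path_image \<gamma>) \<le> e + h" by simp
  qed (use ne in simp)
  moreover have "(SUP y\<in>path_image \<gamma>. infdist y (set v)) \<le> e + h"
  proof (rule cSUP_least)
    fix y assume "y \<in> path_image \<gamma>"
    then obtain t where t: "t \<in> {0..1}" "y = \<gamma> t" by (auto simp: path_image_def)
    obtain i s where i: "i < hops v" "0 \<le> s" "s \<le> 1" "t = (real i + s) / real (hops v)"
      by (rule unit_interval_cell[OF t(1) m(1)])
    have "interpolation v t - v ! i = s *\<^sub>R (v ! Suc i - v ! i)"
      unfolding i(4) interpolation_cell[OF i(1-3)] by (simp add: algebra_simps)
    then have "dist (interpolation v t) (v ! i) = s * dist (v ! i) (v ! Suc i)"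
      using i(2) by (simp add: dist_norm norm_minus_commute)
    also have "\<dots> \<le> 1 * h" using i(2,3) \<open>0 \<le> h\<close> steps[OF i(1)] by (intro mult_mono) auto
    finally have "dist y (v ! i) \<le> e + h"
      using near[OF t(1)] dist_triangle3[of y "v ! i" "interpolation v t"] t(2) by simp
    then show "infdist y (set v) \<le> e + h"
      using i(1) m(2) by (intro infdist_le2[of "v ! i"]) auto
  qed (simp add: path_image_def)
  ultimately show "d_haus (set v) (path_image \<gamma>) \<le> e + h"
    unfolding d_haus_def by simp
qed

lemma d_haus_tendsto:
  fixes v :: "nat \<Rightarrow> 'a::euclidean_space list"
  assumes "\<And>k. 2 \<le> length (v k)" and "\<And>k i. i < hops (v k) \<Longrightarrow> dist (v k ! i) (v k ! Suc i) \<le> h k"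
    and "h \<longlonglongrightarrow> 0" and ul: "uniform_limit {0..1} (\<lambda>k. interpolation (v k)) \<gamma> sequentially"
  shows "(\<lambda>k. d_haus (set (v k)) (path_image \<gamma>)) \<longlonglongrightarrow> 0"
proof (rule order_tendstoI)
  fix y :: real assume "y < 0"
  have near: "\<forall>\<^sub>F k in sequentially. \<forall>t\<in>{0..1}. dist (interpolation (v k) t) (\<gamma> t) < 1"
    using uniform_limitD[OF ul zero_less_one] .
  then show "\<forall>\<^sub>F k in sequentially. y < d_haus (set (v k)) (path_image \<gamma>)"
  proof eventually_elim
    case (elim k)
    have "0 \<le> d_haus (set (v k)) (path_image \<gamma>)"
      by (rule d_haus_interpolation(1)[of "v k" "h k" \<gamma> 1]) (use assms elim in \<open>auto intro: less_imp_le\<close>)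
    with \<open>y < 0\<close> show ?case by simp
  qed
next
  fix y :: real assume "0 < y"
  have "\<forall>\<^sub>F k in sequentially. \<forall>t\<in>{0..1}. dist (interpolation (v k) t) (\<gamma> t) < y / 2"
    using uniform_limitD[OF ul half_gt_zero[OF \<open>0 < y\<close>]] .
  moreover have "\<forall>\<^sub>F k in sequentially. h k < y / 2"
    using order_tendstoD(2)[OF \<open>h \<longlonglongrightarrow> 0\<close>, of "y / 2"] \<open>0 < y\<close> by simp
  ultimately show "\<forall>\<^sub>F k in sequentially. d_haus (set (v k)) (path_image \<gamma>) < y"
  proof eventually_elim
    case (elim k)
    have "d_haus (set (v k)) (path_image \<gamma>) \<le> y / 2 + h k"
      by (rule d_haus_interpolation(2)) (use assms elim in \<open>auto intro: less_imp_le\<close>)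
    with elim(2) show ?case by simp
  qed
qed

context finsler_integrand
begin

lemma discrete_cost_eq_chain_cost:
  assumes "2 \<le> length v" "set v \<subseteq> D"
  shows "discrete_cost f v = list_cost f v"
proof -
  have m: "0 < hops v" "Suc (hops v) = length v" using assms(1) by (auto simp: hops_def)
  have "discrete_cost f v = (\<Sum>i<hops v. 1 / real (hops v) * (real (hops v) * f (v ! i) (v ! Suc i - v ! i)))"
    unfolding discrete_cost_def sum_distrib_left
  proof (intro sum.cong refl)
    fix i assume "i \<in> {..<hops v}"
    then have "v ! i \<in> D" using assms(2) m(2) by auto
    then show "1 / real (hops v) * f (v ! i) (real (hops v) *\<^sub>R (v ! Suc i - v ! i)) =
        1 / real (hops v) * (real (hops v) * f (v ! i) (v ! Suc i - v ! i))"
      by (simp add: scale)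
  qed
  then show ?thesis using m(1) by (simp add: chain_cost_def)
qed

lemma graph_cost:
  assumes "v \<in> graph_paths S \<epsilon> a b" "S \<subseteq> D"
  shows "discrete_cost f v = list_cost f v"
    "0 \<le> discrete_cost f v"
    "(\<Sum>i<hops v. dist (v ! i) (v ! Suc i)) \<le> discrete_cost f v / m1"
proof -
  note v = graph_pathsD[OF assms(1)]
  show eq: "discrete_cost f v = list_cost f v"
    using v(1,2) assms(2) by (intro discrete_cost_eq_chain_cost) auto
  have vD: "v ! i \<in> D" if "i \<le> hops v" for i using v(11)[OF that] assms(2) by auto
  show "0 \<le> discrete_cost f v"
    unfolding eq chain_cost_def by (intro sum_nonneg nonneg vD) auto
  show "(\<Sum>i<hops v. dist (v ! i) (v ! Suc i)) \<le> discrete_cost f v / m1"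
    unfolding eq by (intro chain_length_le vD) simp
qed

text \<open>The set of paths is infinite, but a bound on the cost bounds the number of hops,
  because the hops cannot be arbitrarily short in a finite graph.\<close>

lemma graph_argmin_exists:
  assumes "finite S" "S \<subseteq> D" "graph_paths S \<epsilon> a b \<noteq> {}"
  shows "argmin_set (discrete_cost f) (graph_paths S \<epsilon> a b) \<noteq> {}"
proof -
  let ?V = "graph_paths S \<epsilon> a b"
  obtain v\<^sub>0 where v0: "v\<^sub>0 \<in> ?V" using assms by blast
  define \<delta> where "\<delta> = Min (insert 1 ((\<lambda>(x, y). dist x y) ` ({(x, y). x \<noteq> y} \<inter> S \<times> S)))"
  have fin: "finite (insert 1 ((\<lambda>(x, y). dist x y) ` ({(x, y). x \<noteq> y} \<inter> S \<times> S)))"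
    using assms(1) by auto
  have \<delta>: "0 < \<delta>" unfolding \<delta>_def using fin by (subst Min_gr_iff) auto
  have \<delta>_le: "\<delta> \<le> dist x y" if "x \<in> S" "y \<in> S" "x \<noteq> y" for x y
    unfolding \<delta>_def using fin that by (intro Min_le) auto
  define P where "P = {v \<in> ?V. discrete_cost f v \<le> discrete_cost f v\<^sub>0}"
  have "P \<subseteq> {v. set v \<subseteq> S \<and> length v \<le> nat \<lceil>discrete_cost f v\<^sub>0 / m1 / \<delta>\<rceil> + 1}"
  proof
    fix v assume "v \<in> P"
    then have v: "v \<in> ?V" "discrete_cost f v \<le> discrete_cost f v\<^sub>0" by (auto simp: P_def)
    note p = graph_pathsD[OF v(1)]
    have "real (hops v) * \<delta> = (\<Sum>i<hops v. \<delta>)" by simp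
    also have "\<dots> \<le> (\<Sum>i<hops v. dist (v ! i) (v ! Suc i))"
      by (intro sum_mono \<delta>_le p(11) p(10)) auto
    also have "\<dots> \<le> discrete_cost f v / m1" by (rule graph_cost(3)[OF v(1) assms(2)])
    also have "\<dots> \<le> discrete_cost f v\<^sub>0 / m1" using v(2) m1_pos by (intro divide_right_mono) auto
    finally have "real (hops v) \<le> discrete_cost f v\<^sub>0 / m1 / \<delta>" by (simp only: pos_le_divide_eq[OF \<delta>])
    then have "hops v \<le> nat \<lceil>discrete_cost f v\<^sub>0 / m1 / \<delta>\<rceil>" by linarith
    then show "v \<in> {v. set v \<subseteq> S \<and> length v \<le> nat \<lceil>discrete_cost f v\<^sub>0 / m1 / \<delta>\<rceil> + 1}"
      using p(2,5) by simp
  qed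
  then have "finite P" using finite_lists_length_le[OF assms(1)] finite_subset by blast
  moreover have "P \<noteq> {}" using v0 by (auto simp: P_def)
  ultimately obtain v where "is_arg_min (discrete_cost f) (\<lambda>x. x \<in> P) v"
    using ex_is_arg_min_if_finite by blast
  then have v: "v \<in> P" "\<And>w. w \<in> P \<Longrightarrow> discrete_cost f v \<le> discrete_cost f w"
    by (auto simp: is_arg_min_linorder)
  have "v \<in> argmin_set (discrete_cost f) ?V"
    unfolding argmin_set_def is_arg_min_def
  proof (intro CollectI conjI notI)
    show "v \<in> ?V" using v(1) by (simp add: P_def)
    assume "\<exists>y. y \<in> ?V \<and> discrete_cost f y < discrete_cost f v"
    then obtain y where y: "y \<in> ?V" "discrete_cost f y < discrete_cost f v" by blast
    then have "y \<in> P" using v(1) by (auto simp: P_def)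
    then show False using v(2) y(2) by force
  qed
  then show ?thesis by blast
qed

end

section \<open>Convergence of the discrete minima\<close>

context finsler_integrand
begin

text \<open>The error consists of \<open>N\<close> terms of order \<open>c * \<epsilon>\<close>, one for each moved point of the partition,
  and \<open>N * \<epsilon>\<close> is bounded in terms of the Lipschitz constant.\<close>

lemma sampled_path:
  assumes \<gamma>: "\<gamma> \<in> lip_paths D a b" and lip: "L-lipschitz_on {0..1} \<gamma>" and "a \<noteq> b"
    and \<epsilon>: "0 < \<epsilon>" "\<epsilon> \<le> 1" and S: "S \<subseteq> D" "a \<in> S" "b \<in> S" and c: "0 < c" "c \<le> 1 / 8"
    and cover: "\<And>x. x \<in> D \<Longrightarrow> \<exists>y\<in>S. dist x y < c * \<epsilon>"
  shows "\<exists>v\<in>graph_paths S \<epsilon> a b. discrete_cost f v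
    \<le> (1 + \<kappa> * \<epsilon>) * ((1 + \<kappa> * \<epsilon>) * path_cost f \<gamma> + 2 * m2 * c * (2 * (L + 1) + 1))"
proof -
  have L: "0 \<le> L" using lip lipschitz_on_def by blast
  \<comment> \<open>Steps of the partition have length at most \<open>\<epsilon> / 2\<close>, which leaves room for moving both end
    points by \<open>\<epsilon> / 8\<close>; using \<open>L + 1\<close> instead of \<open>L\<close> makes \<open>N\<close> positive.\<close>
  have Q: "0 < 2 * (L + 1) / \<epsilon>" using L \<epsilon> by simp
  define N where "N = nat \<lceil>2 * (L + 1) / \<epsilon>\<rceil>"
  have N_ge: "2 * (L + 1) / \<epsilon> \<le> real N" and N_le: "real N \<le> 2 * (L + 1) / \<epsilon> + 1"
    unfolding N_def using Q by linarith+
  have "0 < real N" using Q N_ge by linarith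
  then have N: "0 < N" by simp
  have LN: "L / real N \<le> \<epsilon> / 2"
    using N_ge \<open>0 < real N\<close> \<epsilon>(1) by (simp add: field_simps)
  then have L\<epsilon>: "L / real N \<le> \<epsilon>" using \<epsilon>(1) by linarith
  have N\<epsilon>: "real N * \<epsilon> \<le> 2 * (L + 1) + 1"
  proof -
    have "real N * \<epsilon> \<le> (2 * (L + 1) / \<epsilon> + 1) * \<epsilon>" using N_le \<epsilon> by (intro mult_right_mono) auto
    also have "\<dots> = 2 * (L + 1) + \<epsilon>" using \<epsilon>(1) by (simp add: field_simps)
    finally show ?thesis using \<epsilon>(2) by simp
  qed
  define y where "y i = grid \<gamma> N i" for i
  have yD: "y i \<in> D" if "i \<le> N" for i
    unfolding y_def by (intro lip_paths_in[OF \<gamma>] grid_in_unit_interval that)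
  have ends_y: "y 0 = a" "y N = b" using lip_paths_ends[OF \<gamma>] N by (auto simp: y_def)
  have y_step: "dist (y i) (y (Suc i)) \<le> \<epsilon> / 2" if "i < N" for i
    unfolding y_def using lipschitz_grid_step[OF lip that] LN by (rule order_trans)
  define w where "w i = (if i = 0 then a else if i = N then b else SOME z. z \<in> S \<and> dist (y i) z < c * \<epsilon>)" for i
  have wab: "w 0 = a" "w N = b" using N by (auto simp: w_def)
  have w: "w i \<in> S" "dist (y i) (w i) < c * \<epsilon>" if "i \<le> N" for i
  proof -
    have "\<exists>z. z \<in> S \<and> dist (y i) z < c * \<epsilon>" using cover[OF yD[OF that]] by blast
    from someI_ex[OF this] have "w i \<in> S \<and> dist (y i) (w i) < c * \<epsilon>"
      using S(2,3) ends_y c(1) \<epsilon>(1) by (auto simp: w_def)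
    then show "w i \<in> S" "dist (y i) (w i) < c * \<epsilon>" by auto
  qed
  have c\<epsilon>: "c * \<epsilon> \<le> \<epsilon> / 8" using c(2) \<epsilon>(1) by simp
  have w_step: "dist (w i) (w (Suc i)) < \<epsilon>" if "i < N" for i
  proof -
    have "dist (w i) (w (Suc i)) \<le> dist (w i) (y i) + dist (y i) (y (Suc i)) + dist (y (Suc i)) (w (Suc i))"
      using dist_triangle[of "w i" "w (Suc i)" "y i"] dist_triangle[of "y i" "w (Suc i)" "y (Suc i)"]
      by linarith
    moreover have "dist (w i) (y i) < c * \<epsilon>" "dist (y (Suc i)) (w (Suc i)) < c * \<epsilon>"
      using w(2)[of i] w(2)[of "Suc i"] that by (simp_all add: dist_commute)
    ultimately show ?thesis using y_step[OF that] c\<epsilon> \<epsilon>(1) by linarith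
  qed
  define xs where "xs = map w [0..<Suc N]"
  have xs: "length xs = Suc N" "\<And>i. i \<le> N \<Longrightarrow> xs ! i = w i" "hops xs = N"
    unfolding xs_def hops_def by (auto simp del: upt_Suc)
  have xsS: "set xs \<subseteq> S" unfolding xs_def using w(1) by (auto simp del: upt_Suc)
  have "xs \<noteq> []" using xs(1) by auto
  then have xs_ends: "hd xs = a" "last xs = b"
    using xs wab by (auto simp: hd_conv_nth last_conv_nth)
  define v where "v = remdups_adj xs"
  have "successively (\<lambda>x y. dist x y < \<epsilon>) xs"
    unfolding successively_conv_nth using xs w_step by simp
  then have succ: "successively (\<lambda>x y. dist x y < \<epsilon>) v"
    unfolding v_def by (rule successively_remdups_adjI)
  have v_ends: "hd v = a" "last v = b" using xs_ends by (auto simp: v_def)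
  have "v \<noteq> []" using \<open>xs \<noteq> []\<close> by (simp add: v_def)
  then have len: "2 \<le> length v"
    using v_ends \<open>a \<noteq> b\<close> by (cases v; cases "tl v") auto
  have vS: "set v \<subseteq> S" using xsS by (simp add: v_def)
  have "v \<in> graph_paths S \<epsilon> a b"
  proof (rule graph_pathsI[OF len vS v_ends])
    fix i assume "i < hops v"
    then have "Suc i < length v" by (simp add: hops_def)
    then show "v ! i \<noteq> v ! Suc i \<and> dist (v ! i) (v ! Suc i) < \<epsilon>"
      using succ remdups_adj_adjacent[of i xs] by (simp add: v_def successively_conv_nth)
  qed
  moreover have "discrete_cost f v \<le> (1 + \<kappa> * \<epsilon>) * ((1 + \<kappa> * \<epsilon>) * path_cost f \<gamma> + 2 * m2 * c * (2 * (L + 1) + 1))"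
  proof -
    have "discrete_cost f v = list_cost f v"
      using len vS S(1) by (intro discrete_cost_eq_chain_cost) auto
    also have "\<dots> = list_cost f xs"
      unfolding v_def using xsS S(1) by (intro chain_cost_remdups_adj f_zero) auto
    also have "\<dots> = chain_cost f w N" unfolding xs(3) chain_cost_def using xs(2) by simp
    also have "\<dots> \<le> (\<Sum>i<N. (1 + \<kappa> * \<epsilon>) * (f (y i) (y (Suc i) - y i) + 2 * m2 * c * \<epsilon>))"
      unfolding chain_cost_def
    proof (intro sum_mono)
      fix i assume "i \<in> {..<N}"
      then have i: "i < N" by simp
      then have D: "w i \<in> D" "y i \<in> D" using w(1)[of i] yD S(1) by auto
      have d: "dist (w i) (y i) < c * \<epsilon>" "dist (w (Suc i)) (y (Suc i)) < c * \<epsilon>"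
        using w(2)[of i] w(2)[of "Suc i"] i by (auto simp: dist_commute)
      have d\<epsilon>: "dist (w i) (y i) \<le> \<epsilon>" using d(1) c\<epsilon> \<epsilon>(1) by linarith
      have "f (w i) (w (Suc i) - w i) \<le> (1 + \<kappa> * dist (w i) (y i)) * f (y i) (w (Suc i) - w i)"
        by (rule compare[OF D])
      also have "\<dots> \<le> (1 + \<kappa> * \<epsilon>) * f (y i) (w (Suc i) - w i)"
        using d\<epsilon> \<kappa>_nonneg by (intro mult_right_mono nonneg D add_left_mono mult_left_mono) auto
      also have "f (y i) (w (Suc i) - w i) \<le> f (y i) (y (Suc i) - y i) + f (y i) ((w (Suc i) - y (Suc i)) + (y i - w i))"
        using subadd[OF D(2), of "y (Suc i) - y i" "(w (Suc i) - y (Suc i)) + (y i - w i)"] by (simp add: algebra_simps)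
      also have "f (y i) ((w (Suc i) - y (Suc i)) + (y i - w i)) \<le> m2 * norm ((w (Suc i) - y (Suc i)) + (y i - w i))"
        by (rule upper[OF D(2)])
      also have "\<dots> \<le> m2 * (2 * c * \<epsilon>)"
      proof -
        have "norm ((w (Suc i) - y (Suc i)) + (y i - w i)) \<le> norm (w (Suc i) - y (Suc i)) + norm (y i - w i)"
          by (rule norm_triangle_ineq)
        also have "\<dots> \<le> 2 * c * \<epsilon>" using d by (simp add: dist_norm norm_minus_commute)
        finally show ?thesis using m2_pos by (intro mult_left_mono) auto
      qed
      finally show "f (w i) (w (Suc i) - w i) \<le> (1 + \<kappa> * \<epsilon>) * (f (y i) (y (Suc i) - y i) + 2 * m2 * c * \<epsilon>)"
        using \<kappa>_nonneg \<epsilon>(1) by (simp add: mult_left_mono mult.assoc mult.left_commute)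
    qed
    also have "\<dots> = (1 + \<kappa> * \<epsilon>) * (chain_cost f y N + 2 * m2 * c * (real N * \<epsilon>))"
      unfolding sum_distrib_left[symmetric] chain_cost_def sum.distrib by simp
    also have "\<dots> \<le> (1 + \<kappa> * \<epsilon>) * ((1 + \<kappa> * \<epsilon>) * path_cost f \<gamma> + 2 * m2 * c * (2 * (L + 1) + 1))"
    proof (intro mult_left_mono add_mono)
      have "chain_cost f y N = chain_cost f (grid \<gamma> N) N" by (simp add: y_def chain_cost_def)
      also have "\<dots> \<le> (1 + \<kappa> * (L / real N)) * path_cost f \<gamma>" by (rule chain_cost_le_path_cost[OF \<gamma> lip N])
      also have "\<dots> \<le> (1 + \<kappa> * \<epsilon>) * path_cost f \<gamma>"
        using L\<epsilon> \<kappa>_nonneg by (intro mult_right_mono add_left_mono mult_left_mono path_cost_nonneg[OF \<gamma>]) auto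
      finally show "chain_cost f y N \<le> (1 + \<kappa> * \<epsilon>) * path_cost f \<gamma>" .
    qed (use N\<epsilon> m2_pos c \<kappa>_nonneg \<epsilon>(1) in auto)
    finally show ?thesis .
  qed
  ultimately show ?thesis by blast
qed

text \<open>If the end points coincide, a graph path still needs a second vertex. It is found near a point
  \<open>x\<close> at distance \<open>\<epsilon> / 2\<close> from \<open>a\<close>, hence is different from \<open>a\<close> and adjacent to it.\<close>

lemma sampled_loop:
  assumes "a \<in> S" "S \<subseteq> D" "q \<in> D" "q \<noteq> a" "0 < \<epsilon>" "\<epsilon> \<le> dist a q"
    and cover: "\<And>x. x \<in> D \<Longrightarrow> \<exists>y\<in>S. dist x y < \<epsilon> / 4"
  shows "\<exists>v\<in>graph_paths S \<epsilon> a a. discrete_cost f v \<le> 2 * m2 * \<epsilon>"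
proof -
  define t where "t = \<epsilon> / (2 * dist a q)"
  have t: "0 \<le> t" "t \<le> 1" using assms by (auto simp: t_def divide_le_eq)
  have aD: "a \<in> D" using assms by auto
  define x where "x = (1 - t) *\<^sub>R a + t *\<^sub>R q"
  have "x \<in> D" unfolding x_def using t assms aD by (intro convexD[OF D_convex]) auto
  have "x - a = t *\<^sub>R (q - a)" by (simp add: x_def algebra_simps)
  then have "dist x a = t * dist a q" using t(1) by (simp add: dist_norm norm_minus_commute)
  then have ax: "dist a x = \<epsilon> / 2" using assms(4) by (simp add: t_def dist_commute)
  obtain y where y: "y \<in> S" "dist x y < \<epsilon> / 4" using cover[OF \<open>x \<in> D\<close>] by blast
  have ay: "a \<noteq> y" using ax y(2) \<open>0 < \<epsilon>\<close> by (auto simp: dist_commute)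
  have day: "dist a y < \<epsilon>" using dist_triangle[of a y x] ax y(2) \<open>0 < \<epsilon>\<close> by simp
  let ?v = "[a, y, a]"
  have hops: "hops ?v = 2" by (simp add: hops_def)
  have v: "?v \<in> graph_paths S \<epsilon> a a"
    using assms y ay day by (intro graph_pathsI) (auto simp: hops less_2_cases_iff dist_commute)
  have yD: "y \<in> D" using y assms by auto
  have "discrete_cost f ?v = f a (y - a) + f y (a - y)"
    unfolding graph_cost(1)[OF v \<open>S \<subseteq> D\<close>] hops by (simp add: chain_cost_def numeral_2_eq_2)
  also have "\<dots> \<le> m2 * norm (y - a) + m2 * norm (a - y)" by (intro add_mono upper aD yD)
  also have "\<dots> \<le> m2 * \<epsilon> + m2 * \<epsilon>"
    using day m2_pos by (intro add_mono mult_left_mono) (auto simp: dist_norm norm_minus_commute)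
  finally have "discrete_cost f ?v \<le> 2 * m2 * \<epsilon>" by (simp add: mult.commute)
  with v show ?thesis by blast
qed

lemma const_lip_path: "a \<in> D \<Longrightarrow> (\<lambda>_. a) \<in> lip_paths D a a"
  unfolding lip_paths_def
  by (auto simp: path_image_def pathstart_def pathfinish_def intro!: exI[of _ 0] lipschitz_on_constant)

lemma const_path_cost: "a \<in> D \<Longrightarrow> path_cost f (\<lambda>_. a) = 0"
  using LIMSEQ_unique[OF chain_cost_tendsto_path_cost[OF const_lip_path]]
  by (simp add: chain_cost_def f_zero)

lemma minimal_path_cost_le_discrete_cost:
  assumes "v \<in> graph_paths S \<epsilon> a b" "S \<subseteq> D"
  shows "(INF \<gamma>\<in>lip_paths D a b. path_cost f \<gamma>) \<le> (1 + \<kappa> * \<epsilon>) * discrete_cost f v"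
proof -
  note v = graph_pathsD[OF assms(1)]
  have "0 < hops v" using v(1) by (simp add: hops_def)
  have "0 \<le> \<epsilon>" using v(9)[OF \<open>0 < hops v\<close>] zero_le_dist[of "v ! 0"] by (meson le_less_trans less_imp_le)
  have vD: "set v \<subseteq> D" using v(2) assms(2) by auto
  note ip = interpolation_lip_path[OF v(1) vD \<open>0 \<le> \<epsilon>\<close> less_imp_le[OF v(9)], unfolded v(3,4)]
  have "bdd_below (path_cost f ` lip_paths D a b)"
    by (rule bdd_belowI[of _ 0]) (auto simp: path_cost_nonneg)
  then have "(INF \<gamma>\<in>lip_paths D a b. path_cost f \<gamma>) \<le> path_cost f (interpolation v)"
    using ip(2) by (intro cINF_lower) auto
  also have "\<dots> \<le> (1 + \<kappa> * \<epsilon>) * discrete_cost f v"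
    using ip(3) graph_cost(1)[OF assms] by simp
  finally show ?thesis .
qed

end

text \<open>The vertices become dense at a rate that is negligible compared with \<open>\<epsilon> n\<close>. A second point
  \<open>q\<close> of \<open>D\<close> is present, because otherwise there would be no hops at all.\<close>

locale dense_graphs = finsler_integrand D f m1 m2 \<kappa>
  for D :: "'a::euclidean_space set" and f m1 m2 \<kappa> +
  fixes S :: "nat \<Rightarrow> 'a set" and \<epsilon> :: "nat \<Rightarrow> real" and a b q :: 'a
  assumes S: "\<And>n. S n \<subseteq> D" "\<And>n. a \<in> S n" "\<And>n. b \<in> S n" "\<And>n. finite (S n)"
    and \<epsilon>: "\<forall>\<^sub>F n in sequentially. 0 < \<epsilon> n" "\<epsilon> \<longlonglongrightarrow> 0"
    and cover: "\<And>c. 0 < c \<Longrightarrow> \<forall>\<^sub>F n in sequentially. \<forall>x\<in>D. \<exists>y\<in>S n. dist x y < c * \<epsilon> n"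
    and q: "q \<in> D" "q \<noteq> a"
begin

theorem near_optimal_graph_paths:
  assumes \<gamma>: "\<gamma> \<in> lip_paths D a b" and "0 < e"
  shows "\<forall>\<^sub>F n in sequentially. \<exists>v\<in>graph_paths (S n) (\<epsilon> n) a b. discrete_cost f v < path_cost f \<gamma> + e"
proof (cases "a = b")
  case True
  have "\<forall>\<^sub>F n in sequentially. \<epsilon> n < min (dist a q) (e / (2 * m2))"
    using q \<open>0 < e\<close> m2_pos by (intro order_tendstoD(2)[OF \<epsilon>(2)]) auto
  then show ?thesis
    using \<epsilon>(1) cover[of "1/4", simplified]
  proof eventually_elim
    case (elim n)
    then obtain v where v: "v \<in> graph_paths (S n) (\<epsilon> n) a a" "discrete_cost f v \<le> 2 * m2 * \<epsilon> n"
      using sampled_loop[OF S(2,1) q, of "\<epsilon> n" n] by force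
    have "2 * m2 * \<epsilon> n < e" using elim(1) m2_pos by (simp add: field_simps)
    with v(2) path_cost_nonneg[OF \<gamma>] have "discrete_cost f v < path_cost f \<gamma> + e" by linarith
    with v(1) True show ?case by blast
  qed
next
  case False
  obtain L where lip: "L-lipschitz_on {0..1} \<gamma>" using \<gamma> by (auto simp: lip_paths_def)
  then have L: "0 \<le> L" using lipschitz_on_def by blast
  define C where "C = 2 * m2 * (2 * (L + 1) + 1)"
  have C: "0 < C" using m2_pos L by (simp add: C_def)
  define c where "c = min (1 / 8) (e / (2 * C))"
  have c: "0 < c" "c \<le> 1 / 8" using \<open>0 < e\<close> C by (auto simp: c_def)
  have "C * c \<le> C * (e / (2 * C))" using C by (intro mult_left_mono) (auto simp: c_def)
  then have Cc: "C * c \<le> e / 2" using C by simp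
  have "(\<lambda>n. (1 + \<kappa> * \<epsilon> n) * ((1 + \<kappa> * \<epsilon> n) * path_cost f \<gamma> + C * c)) \<longlonglongrightarrow>
      (1 + \<kappa> * 0) * ((1 + \<kappa> * 0) * path_cost f \<gamma> + C * c)"
    by (intro tendsto_intros \<epsilon>(2))
  then have "\<forall>\<^sub>F n in sequentially. (1 + \<kappa> * \<epsilon> n) * ((1 + \<kappa> * \<epsilon> n) * path_cost f \<gamma> + C * c) < path_cost f \<gamma> + e"
    using Cc \<open>0 < e\<close> by (intro order_tendstoD(2)) auto
  moreover have "\<forall>\<^sub>F n in sequentially. \<epsilon> n < 1" using order_tendstoD(2)[OF \<epsilon>(2)] by simp
  ultimately show ?thesis
    using \<epsilon>(1) cover[OF c(1)]
  proof eventually_elim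
    case (elim n)
    obtain v where v: "v \<in> graph_paths (S n) (\<epsilon> n) a b" "discrete_cost f v
      \<le> (1 + \<kappa> * \<epsilon> n) * ((1 + \<kappa> * \<epsilon> n) * path_cost f \<gamma> + 2 * m2 * c * (2 * (L + 1) + 1))"
      using sampled_path[OF \<gamma> lip False elim(3) less_imp_le[OF elim(2)] S(1-3) c] elim(4) by blast
    have Cc: "2 * m2 * c * (2 * (L + 1) + 1) = C * c" by (simp add: C_def)
    have "discrete_cost f v < path_cost f \<gamma> + e"
      using v(2)[unfolded Cc] elim(1) by (rule order_le_less_trans)
    with v(1) show ?case by blast
  qed
qed

text \<open>The upper bound compares with an exact minimizer; the lower bound holds for every graph path.\<close>

theorem discrete_minimum_tendsto:
  shows "\<forall>\<^sub>F n in sequentially. argmin_set (discrete_cost f) (graph_paths (S n) (\<epsilon> n) a b) \<noteq> {}"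
    and "(\<lambda>n. INF v\<in>graph_paths (S n) (\<epsilon> n) a b. discrete_cost f v)
      \<longlonglongrightarrow> (INF \<gamma>\<in>lip_paths D a b. path_cost f \<gamma>)"
proof -
  let ?V = "\<lambda>n. graph_paths (S n) (\<epsilon> n) a b"
  let ?H = "\<lambda>n. INF v\<in>?V n. discrete_cost f v"
  let ?\<mu> = "INF \<gamma>\<in>lip_paths D a b. path_cost f \<gamma>"
  have "a \<in> D" "b \<in> D" using S by blast+
  then obtain \<gamma> where \<gamma>: "\<gamma> \<in> argmin_set (path_cost f) (lip_paths D a b)"
    using minimizer_exists by blast
  have \<gamma>P: "\<gamma> \<in> lip_paths D a b" using \<gamma> by (simp add: argmin_set_def is_arg_min_def)
  have \<gamma>\<mu>: "path_cost f \<gamma> = ?\<mu>"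
    using \<gamma> by (intro cInf_eq_minimum[symmetric]) (auto simp: argmin_set_def is_arg_min_linorder)
  have near: "\<forall>\<^sub>F n in sequentially. \<exists>v\<in>?V n. discrete_cost f v < ?\<mu> + e" if "0 < e" for e
    unfolding \<gamma>\<mu>[symmetric] by (rule near_optimal_graph_paths[OF \<gamma>P that])
  have nonempty: "\<forall>\<^sub>F n in sequentially. ?V n \<noteq> {}"
    using near[OF zero_less_one] by eventually_elim auto
  then show "\<forall>\<^sub>F n in sequentially. argmin_set (discrete_cost f) (?V n) \<noteq> {}"
    by eventually_elim (rule graph_argmin_exists[OF S(4,1)])
  have bdd: "bdd_below (discrete_cost f ` ?V n)" for n
    by (rule bdd_belowI[of _ 0]) (auto intro: graph_cost(2)[OF _ S(1)])
  show "?H \<longlonglongrightarrow> ?\<mu>"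
  proof (rule order_tendstoI)
    fix y assume "?\<mu> < y"
    then have "0 < y - ?\<mu>" by simp
    from near[OF this] show "\<forall>\<^sub>F n in sequentially. ?H n < y"
    proof eventually_elim
      case (elim n)
      then obtain v where v: "v \<in> ?V n" "discrete_cost f v < y" by auto
      have "?H n \<le> discrete_cost f v" by (rule cINF_lower[OF bdd v(1)])
      with v(2) show ?case by linarith
    qed
  next
    fix y assume "y < ?\<mu>"
    have "(\<lambda>n. ?\<mu> / (1 + \<kappa> * \<epsilon> n)) \<longlonglongrightarrow> ?\<mu> / (1 + \<kappa> * 0)"
      by (intro tendsto_intros \<epsilon>(2)) auto
    then have "\<forall>\<^sub>F n in sequentially. y < ?\<mu> / (1 + \<kappa> * \<epsilon> n)"
      using \<open>y < ?\<mu>\<close> by (intro order_tendstoD(1)) auto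
    then show "\<forall>\<^sub>F n in sequentially. y < ?H n"
      using nonempty \<epsilon>(1)
    proof eventually_elim
      case (elim n)
      have pos: "0 < 1 + \<kappa> * \<epsilon> n" using elim(3) \<kappa>_nonneg by (simp add: add_pos_nonneg)
      have "?\<mu> / (1 + \<kappa> * \<epsilon> n) \<le> ?H n"
      proof (rule cINF_greatest[OF elim(2)])
        fix v assume "v \<in> ?V n"
        then show "?\<mu> / (1 + \<kappa> * \<epsilon> n) \<le> discrete_cost f v"
          using minimal_path_cost_le_discrete_cost[OF _ S(1), of v n "\<epsilon> n" a b] pos
          by (simp add: pos_divide_le_eq mult.commute)
      qed
      with elim(1) show ?case by linarith
    qed
  qed
qed

end

section \<open>The number of hops of optimal paths\<close>

context finsler_integrand
begin

text \<open>Comparison with the path \<open>w\<close> in which the piece is replaced by a single hop.\<close>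

lemma optimal_shortcut:
  assumes opt: "v \<in> argmin_set (discrete_cost f) (graph_paths S \<epsilon> a b)" and "S \<subseteq> D"
    and ij: "i < j" "j \<le> hops v" and hop: "v ! i \<noteq> v ! j" "dist (v ! i) (v ! j) < \<epsilon>"
  shows "(\<Sum>l\<in>{i..<j}. f (v ! l) (v ! Suc l - v ! l)) \<le> f (v ! i) (v ! j - v ! i)"
proof -
  have vV: "v \<in> graph_paths S \<epsilon> a b" using opt by (simp add: argmin_set_def is_arg_min_def)
  note v = graph_pathsD[OF vV]
  let ?m = "hops v"
  let ?g = "\<lambda>l. f (v ! l) (v ! Suc l - v ! l)"
  define w where "w = take (Suc i) v @ drop j v"
  have len: "length w = Suc i + (Suc ?m - j)" using ij v(5) by (simp add: w_def)
  then have hw: "hops w = Suc i + (?m - j)" using ij by (simp add: hops_def)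
  have nth1: "w ! l = v ! l" if "l \<le> i" for l using that ij v(5) by (simp add: w_def nth_append)
  have nth2: "w ! (Suc i + l) = v ! (j + l)" if "l \<le> ?m - j" for l
    using that ij v(5) by (simp add: w_def nth_append)
  have wS: "set w \<subseteq> S" using v(2) set_take_subset set_drop_subset unfolding w_def by fastforce
  have w: "w \<in> graph_paths S \<epsilon> a b"
  proof (rule graph_pathsI[OF _ wS])
    show "2 \<le> length w" using len ij by simp
    show "hd w = a" using v(1,3) by (cases v) (auto simp: w_def)
    show "last w = b" using v(4,5) ij by (simp add: w_def)
    fix l assume l: "l < hops w"
    consider "l < i" | "l = i" | "i < l" by linarith
    then show "w ! l \<noteq> w ! Suc l \<and> dist (w ! l) (w ! Suc l) < \<epsilon>"
    proof cases
      case 1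
      then show ?thesis using v(9,10)[of l] nth1[of l] nth1[of "Suc l"] ij by simp
    next
      case 2
      then show ?thesis using hop nth1[of i] nth2[of 0] by simp
    next
      case 3
      then obtain r where r: "l = Suc i + r" using less_iff_Suc_add by auto
      then have "r < ?m - j" using l hw by simp
      then show ?thesis using v(9,10)[of "j + r"] nth2[of r] nth2[of "Suc r"] r by simp
    qed
  qed
  have "discrete_cost f v = (\<Sum>l<?m. ?g l)"
    unfolding graph_cost(1)[OF vV \<open>S \<subseteq> D\<close>] chain_cost_def ..
  also have "\<dots> = (\<Sum>l\<in>{0..<i}. ?g l) + (\<Sum>l\<in>{i..<j}. ?g l) + (\<Sum>l\<in>{j..<?m}. ?g l)"
    using ij by (simp add: sum.atLeastLessThan_concat lessThan_atLeast0)
  finally have cv: "discrete_cost f v = (\<Sum>l\<in>{0..<i}. ?g l) + (\<Sum>l\<in>{i..<j}. ?g l) + (\<Sum>l\<in>{j..<?m}. ?g l)" .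
  let ?h = "\<lambda>l. f (w ! l) (w ! Suc l - w ! l)"
  have "discrete_cost f w = (\<Sum>l<Suc i + (?m - j). ?h l)"
    unfolding graph_cost(1)[OF w \<open>S \<subseteq> D\<close>] chain_cost_def hw ..
  also have "\<dots> = (\<Sum>l\<in>{0..<i}. ?h l) + ?h i + (\<Sum>l\<in>{Suc i..<Suc i + (?m - j)}. ?h l)"
    using sum.atLeastLessThan_concat[of 0 "Suc i" "Suc i + (?m - j)" ?h] by (simp add: lessThan_atLeast0)
  also have "(\<Sum>l\<in>{0..<i}. ?h l) = (\<Sum>l\<in>{0..<i}. ?g l)"
    by (intro sum.cong refl) (simp add: nth1)
  also have "?h i = f (v ! i) (v ! j - v ! i)" using nth1[of i] nth2[of 0] by simp
  also have "(\<Sum>l\<in>{Suc i..<Suc i + (?m - j)}. ?h l) = (\<Sum>r\<in>{0..<?m - j}. ?h (r + Suc i))"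
    using sum.shift_bounds_nat_ivl[of ?h 0 "Suc i" "?m - j"] by (simp add: add.commute)
  also have "\<dots> = (\<Sum>r\<in>{0..<?m - j}. ?g (r + j))"
  proof (intro sum.cong refl)
    fix r assume "r \<in> {0..<?m - j}"
    then show "?h (r + Suc i) = ?g (r + j)"
      using nth2[of r] nth2[of "Suc r"] by (simp add: add.commute)
  qed
  also have "\<dots> = (\<Sum>l\<in>{j..<?m}. ?g l)"
    using sum.shift_bounds_nat_ivl[of ?g 0 j "?m - j"] ij by (simp add: add.commute)
  finally have cw: "discrete_cost f w = (\<Sum>l\<in>{0..<i}. ?g l) + f (v ! i) (v ! j - v ! i) + (\<Sum>l\<in>{j..<?m}. ?g l)" .
  have "discrete_cost f v \<le> discrete_cost f w"
    using opt w by (auto simp: argmin_set_def is_arg_min_linorder)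
  with cv cw show ?thesis by simp
qed

text \<open>A loop cannot be removed by a hop of length zero. Therefore the loop is extended by the hop
  before it, or after it if it starts at \<open>a\<close>, and this longer piece is cut short: the new hop
  costs exactly as much as the added one, so the loop would have to be free. As \<open>a \<noteq> b\<close>, one of
  the two neighbouring hops exists.\<close>

lemma optimal_path_distinct:
  assumes opt: "v \<in> argmin_set (discrete_cost f) (graph_paths S \<epsilon> a b)" and "S \<subseteq> D" and "a \<noteq> b"
    and ij: "i < j" "j \<le> hops v"
  shows "v ! i \<noteq> v ! j"
proof
  assume eq: "v ! i = v ! j"
  have vV: "v \<in> graph_paths S \<epsilon> a b" using opt by (simp add: argmin_set_def is_arg_min_def)
  note v = graph_pathsD[OF vV]
  let ?g = "\<lambda>l. f (v ! l) (v ! Suc l - v ! l)"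
  have vD: "v ! l \<in> D" if "l \<le> hops v" for l using v(11)[OF that] \<open>S \<subseteq> D\<close> by auto
  have pos: "0 < ?g l" if "l < hops v" for l
  proof -
    have "0 < m1 * norm (v ! Suc l - v ! l)" using v(10)[OF that] m1_pos by simp
    also have "\<dots> \<le> ?g l" using that by (intro lower vD) simp
    finally show ?thesis .
  qed
  have sum_pos: "0 < (\<Sum>l\<in>{i..<j}. ?g l)" using ij by (intro sum_pos pos) auto
  show False
  proof (cases "i = 0")
    case False
    then obtain k where k: "i = Suc k" by (cases i) auto
    have "(\<Sum>l\<in>{k..<j}. ?g l) \<le> f (v ! k) (v ! j - v ! k)"
      by (rule optimal_shortcut[OF opt \<open>S \<subseteq> D\<close>])
        (use ij k v(9,10)[of k] eq in auto)
    also have "\<dots> = ?g k" using eq k by simp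
    finally have "(\<Sum>l\<in>{i..<j}. ?g l) \<le> 0"
      using ij k by (simp add: sum.atLeast_Suc_lessThan)
    with sum_pos show False by simp
  next
    case True
    have "j < hops v"
    proof (rule ccontr)
      assume "\<not> j < hops v"
      then have "j = hops v" using ij by simp
      then show False using eq True v(6,7) \<open>a \<noteq> b\<close> by simp
    qed
    then have "(\<Sum>l\<in>{i..<Suc j}. ?g l) \<le> f (v ! i) (v ! Suc j - v ! i)"
      by (intro optimal_shortcut[OF opt \<open>S \<subseteq> D\<close>]) (use ij v(9,10)[of j] eq in auto)
    also have "\<dots> = ?g j" using eq by simp
    finally have "(\<Sum>l\<in>{i..<j}. ?g l) \<le> 0" using ij by simp
    with sum_pos show False by simp
  qed
qed

text \<open>The bound of (Pythag) for fixed constants.\<close>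

definition (in -) pythag_bound :: "real \<Rightarrow> 'a::euclidean_space set \<Rightarrow> ('a \<Rightarrow> 'a \<Rightarrow> real) \<Rightarrow> real \<Rightarrow> real \<Rightarrow> bool" where
  "pythag_bound \<alpha> D f c C \<longleftrightarrow> (\<forall>r u v w. 0 < r \<longrightarrow> r < 1 \<longrightarrow>
     (\<exists>\<eta>'<1. norm (u - w) < \<eta>' \<and> norm (v - w) < \<eta>' \<and> norm (u - v) < \<eta>') \<longrightarrow>
     r \<le> infdist w (closed_segment u v) \<longrightarrow> norm (u - v) \<le> c * r powr (1 / \<alpha>) \<longrightarrow>
     (\<forall>x\<in>D. f x (v - u) + C * r powr \<alpha> \<le> f x (w - u) + f x (v - w)))"

text \<open>Otherwise (Pythag) with \<open>r = \<epsilon> powr \<alpha>\<close> applies, its last condition being \<open>norm (u - v) \<le> \<epsilon>\<close>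
  with constant \<open>1\<close>. The resulting gain \<open>C * \<epsilon> powr \<alpha>\<^sup>2\<close> contradicts optimality, which leaves room
  only for the error \<open>\<kappa> * m2 * \<epsilon>\<^sup>2\<close> of the fixed base point \<open>v ! i\<close>.\<close>

lemma optimal_run_in_tube:
  assumes opt: "v \<in> argmin_set (discrete_cost f) (graph_paths S \<epsilon> a b)" and "S \<subseteq> D" and "a \<noteq> b"
    and \<epsilon>: "0 < \<epsilon>" "\<epsilon> < 1 / 2" and "0 < \<alpha>" and gain: "\<kappa> * m2 * \<epsilon>\<^sup>2 < C * \<epsilon> powr (\<alpha>\<^sup>2)"
    and pythag: "pythag_bound \<alpha> D f 1 C"
    and ij: "i < j" "j \<le> hops v"
    and near: "\<And>l. i \<le> l \<Longrightarrow> l \<le> j \<Longrightarrow> dist (v ! i) (v ! l) < \<epsilon>" and l: "i \<le> l" "l \<le> j"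
  shows "infdist (v ! l) (closed_segment (v ! i) (v ! j)) < \<epsilon> powr \<alpha>"
proof (rule ccontr)
  assume "\<not> ?thesis"
  then have far: "\<epsilon> powr \<alpha> \<le> infdist (v ! l) (closed_segment (v ! i) (v ! j))" by simp
  have vV: "v \<in> graph_paths S \<epsilon> a b" using opt by (simp add: argmin_set_def is_arg_min_def)
  have vD: "v ! l \<in> D" if "l \<le> hops v" for l
    using graph_pathsD(11)[OF vV that] \<open>S \<subseteq> D\<close> by auto
  have xD: "v ! i \<in> D" using ij by (intro vD) simp
  have r: "0 < \<epsilon> powr \<alpha>" "\<epsilon> powr \<alpha> < 1"
    using \<epsilon> \<open>0 < \<alpha>\<close> powr_less_mono2[of \<alpha> \<epsilon> 1] by auto
  have r_root: "(\<epsilon> powr \<alpha>) powr (1 / \<alpha>) = \<epsilon>" and r_pow: "(\<epsilon> powr \<alpha>) powr \<alpha> = \<epsilon> powr (\<alpha>\<^sup>2)"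
    using \<epsilon>(1) \<open>0 < \<alpha>\<close> by (simp_all add: powr_powr power2_eq_square)
  let ?g = "\<lambda>l. f (v ! l) (v ! Suc l - v ! l)"
  have dij: "dist (v ! i) (v ! j) < \<epsilon>" using near[of j] ij by simp
  have "dist (v ! j) (v ! l) < 2 * \<epsilon>"
    using dist_triangle3[of "v ! j" "v ! l" "v ! i"] dij near[OF l] by simp
  then have "norm (v ! i - v ! l) < 2 * \<epsilon>" "norm (v ! j - v ! l) < 2 * \<epsilon>" "norm (v ! i - v ! j) < 2 * \<epsilon>"
    using dij near[OF l] \<epsilon>(1) by (auto simp: dist_norm)
  then have small: "\<exists>\<eta>'<1. norm (v ! i - v ! l) < \<eta>' \<and> norm (v ! j - v ! l) < \<eta>' \<and> norm (v ! i - v ! j) < \<eta>'"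
    using \<epsilon>(2) by (intro exI[of _ "2 * \<epsilon>"]) auto
  have bend: "f (v ! i) (v ! j - v ! i) + C * \<epsilon> powr (\<alpha>\<^sup>2)
      \<le> f (v ! i) (v ! l - v ! i) + f (v ! i) (v ! j - v ! l)"
    using pythag[unfolded pythag_bound_def, rule_format, OF r small far _ xD] dij
    unfolding r_root r_pow by (simp add: dist_norm)
  have "f (v ! i) (v ! l - v ! i) \<le> (1 + \<kappa> * \<epsilon>) * (\<Sum>k\<in>{i..<l}. ?g k)"
    using l ij \<epsilon>(1) near by (intro shortcut_le[where z="(!) v"] xD) (auto intro!: vD less_imp_le)
  moreover have "f (v ! i) (v ! j - v ! l) \<le> (1 + \<kappa> * \<epsilon>) * (\<Sum>k\<in>{l..<j}. ?g k)"
    using l ij \<epsilon>(1) near by (intro shortcut_le[where z="(!) v"] xD) (auto intro!: vD less_imp_le)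
  ultimately have "f (v ! i) (v ! l - v ! i) + f (v ! i) (v ! j - v ! l)
      \<le> (1 + \<kappa> * \<epsilon>) * ((\<Sum>k\<in>{i..<l}. ?g k) + (\<Sum>k\<in>{l..<j}. ?g k))"
    by (simp add: distrib_left)
  also have "(\<Sum>k\<in>{i..<l}. ?g k) + (\<Sum>k\<in>{l..<j}. ?g k) = (\<Sum>k\<in>{i..<j}. ?g k)"
    by (rule sum.atLeastLessThan_concat[OF l])
  also have "(1 + \<kappa> * \<epsilon>) * (\<Sum>k\<in>{i..<j}. ?g k) \<le> (1 + \<kappa> * \<epsilon>) * f (v ! i) (v ! j - v ! i)"
    using optimal_shortcut[OF opt \<open>S \<subseteq> D\<close> ij optimal_path_distinct[OF opt \<open>S \<subseteq> D\<close> \<open>a \<noteq> b\<close> ij] dij]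
      \<kappa>_nonneg \<epsilon>(1) by (intro mult_left_mono) auto
  finally have "C * \<epsilon> powr (\<alpha>\<^sup>2) \<le> \<kappa> * \<epsilon> * f (v ! i) (v ! j - v ! i)"
    using bend by (simp add: algebra_simps)
  also have "\<dots> \<le> \<kappa> * \<epsilon> * (m2 * \<epsilon>)"
  proof (intro mult_left_mono)
    have "f (v ! i) (v ! j - v ! i) \<le> m2 * norm (v ! j - v ! i)" by (rule upper[OF xD])
    also have "\<dots> \<le> m2 * \<epsilon>" using dij m2_pos by (intro mult_left_mono) (auto simp: dist_norm norm_minus_commute)
    finally show "f (v ! i) (v ! j - v ! i) \<le> m2 * \<epsilon>" .
  qed (use \<kappa>_nonneg \<epsilon>(1) in auto)
  finally show False using gain by (simp add: power2_eq_square algebra_simps)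
qed

text \<open>If \<open>K\<close> consecutive hops had length less than \<open>\<epsilon>\<close> in total, their \<open>K + 1\<close> distinct vertices
  would lie in one tube, which contains at most \<open>K\<close> of them. So every block of \<open>K\<close> hops uses up length \<open>\<epsilon>\<close>, and the total length is
  at most the cost divided by \<open>m1\<close>.\<close>

lemma optimal_path_hops:
  assumes opt: "v \<in> argmin_set (discrete_cost f) (graph_paths S \<epsilon> a b)" and S: "S \<subseteq> D" "finite S" and "a \<noteq> b"
    and \<epsilon>: "0 < \<epsilon>" "\<epsilon> < 1 / 2" and "0 < \<alpha>" and gain: "\<kappa> * m2 * \<epsilon>\<^sup>2 < C * \<epsilon> powr (\<alpha>\<^sup>2)"
    and pythag: "pythag_bound \<alpha> D f 1 C"
    and tube: "\<And>p q. p \<in> D \<Longrightarrow> q \<in> D \<Longrightarrow> dist p q < \<epsilon> \<Longrightarrow>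
        card {x \<in> S. infdist x (closed_segment p q) < \<epsilon> powr \<alpha>} \<le> K" and "0 < K"
  shows "real (hops v) * \<epsilon> \<le> real K * (discrete_cost f v / m1 + \<epsilon>)"
proof -
  have vV: "v \<in> graph_paths S \<epsilon> a b" using opt by (simp add: argmin_set_def is_arg_min_def)
  note v = graph_pathsD[OF vV]
  let ?d = "\<lambda>l. dist (v ! l) (v ! Suc l)"
  have advance: "\<epsilon> \<le> (\<Sum>l\<in>{i..<i + K}. ?d l)" if "i + K \<le> hops v" for i
  proof (rule ccontr)
    assume "\<not> ?thesis"
    then have short: "(\<Sum>l\<in>{i..<i + K}. ?d l) < \<epsilon>" by simp
    have near: "dist (v ! i) (v ! l) < \<epsilon>" if "i \<le> l" "l \<le> i + K" for l
    proof -
      have "dist (v ! i) (v ! l) \<le> (\<Sum>l\<in>{i..<l}. ?d l)" using that(1) by (rule dist_le_sum_steps)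
      also have "\<dots> \<le> (\<Sum>l\<in>{i..<i + K}. ?d l)" using that by (intro sum_mono2) auto
      finally show ?thesis using short by simp
    qed
    let ?T = "{x \<in> S. infdist x (closed_segment (v ! i) (v ! (i + K))) < \<epsilon> powr \<alpha>}"
    have "(!) v ` {i..i + K} \<subseteq> ?T"
    proof (intro subsetI CollectI)
      fix x assume "x \<in> (!) v ` {i..i + K}"
      then obtain l where l: "i \<le> l" "l \<le> i + K" "x = v ! l" by auto
      have "infdist (v ! l) (closed_segment (v ! i) (v ! (i + K))) < \<epsilon> powr \<alpha>"
        by (rule optimal_run_in_tube[OF opt S(1) \<open>a \<noteq> b\<close> \<epsilon> \<open>0 < \<alpha>\<close> gain pythag _ \<open>i + K \<le> hops v\<close> near l(1,2)])
          (use \<open>0 < K\<close> in auto)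
      then show "x \<in> S \<and> infdist x (closed_segment (v ! i) (v ! (i + K))) < \<epsilon> powr \<alpha>"
        using v(11)[of l] l \<open>i + K \<le> hops v\<close> by simp
    qed
    moreover have "inj_on ((!) v) {i..i + K}"
    proof (rule linorder_inj_onI')
      fix k l assume "k \<in> {i..i + K}" "l \<in> {i..i + K}" "k < l"
      then show "v ! k \<noteq> v ! l"
        using \<open>i + K \<le> hops v\<close> by (intro optimal_path_distinct[OF opt S(1) \<open>a \<noteq> b\<close>]) auto
    qed
    ultimately have "card {i..i + K} \<le> card ?T"
      using S(2) by (intro card_inj_on_le[of "(!) v"]) auto
    also have "\<dots> \<le> K"
      using v(11)[of i] v(11)[of "i + K"] S(1) \<open>i + K \<le> hops v\<close> near[of "i + K"]
      by (intro tube) auto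
    finally show False by simp
  qed
  define q where "q = hops v div K"
  have "q * K \<le> hops v" by (simp add: q_def)
  have "real q * \<epsilon> = (\<Sum>i<q. \<epsilon>)" by simp
  also have "\<dots> \<le> (\<Sum>i<q. \<Sum>l\<in>{i * K..<i * K + K}. ?d l)"
  proof (intro sum_mono advance)
    fix i assume "i \<in> {..<q}"
    then have "Suc i * K \<le> q * K" by (intro mult_right_mono) auto
    then show "i * K + K \<le> hops v" using \<open>q * K \<le> hops v\<close> by simp
  qed
  also have "\<dots> = (\<Sum>l<q * K. ?d l)" by (rule sum.nat_group)
  also have "\<dots> \<le> (\<Sum>l<hops v. ?d l)" using \<open>q * K \<le> hops v\<close> by (intro sum_mono2) auto
  also have "\<dots> \<le> discrete_cost f v / m1" by (rule graph_cost(3)[OF vV S(1)])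
  finally have q: "real q * \<epsilon> \<le> discrete_cost f v / m1" .
  have "hops v = K * q + hops v mod K" by (simp add: q_def)
  then have "hops v \<le> K * q + K" using mod_less_divisor[OF \<open>0 < K\<close>, of "hops v"] by linarith
  then have "real (hops v) \<le> real (K * q + K)" by (simp only: of_nat_le_iff)
  then have "real (hops v) \<le> real K * (real q + 1)" by (simp add: algebra_simps)
  then have "real (hops v) * \<epsilon> \<le> real K * (real q + 1) * \<epsilon>" using \<epsilon>(1) by (intro mult_right_mono) auto
  also have "\<dots> = real K * (real q * \<epsilon> + \<epsilon>)" by (simp add: algebra_simps)
  also have "\<dots> \<le> real K * (discrete_cost f v / m1 + \<epsilon>)" using q by (intro mult_left_mono) auto
  finally show ?thesis .
qed

end

section \<open>Convergence of optimal paths\<close>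

context finsler_integrand
begin

text \<open>For \<open>a = b\<close> the costs of optimal paths tend to \<open>0\<close>, and by this estimate the paths shrink to
  the point \<open>a\<close>, however many hops they have.\<close>

lemma interpolation_near_start:
  assumes "v \<in> graph_paths S \<epsilon> a b" "S \<subseteq> D" "t \<in> {0..1}"
  shows "dist a (interpolation v t) \<le> discrete_cost f v / m1"
proof -
  note v = graph_pathsD[OF assms(1)]
  let ?d = "\<lambda>l. dist (v ! l) (v ! Suc l)"
  have near: "dist a (v ! n) \<le> discrete_cost f v / m1" if "n \<le> hops v" for n
  proof -
    have "dist a (v ! n) \<le> (\<Sum>l<n. ?d l)"
      using dist_le_sum_steps[of 0 n "(!) v"] v(6) by (simp add: lessThan_atLeast0)
    also have "\<dots> \<le> (\<Sum>l<hops v. ?d l)" using that by (intro sum_mono2) auto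
    also have "\<dots> \<le> discrete_cost f v / m1" by (rule graph_cost(3)[OF assms(1,2)])
    finally show ?thesis .
  qed
  have "0 < hops v" using v(1) by (simp add: hops_def)
  then obtain i s where i: "i < hops v" "0 \<le> s" "s \<le> 1" "t = (real i + s) / real (hops v)"
    by (rule unit_interval_cell[OF assms(3)])
  have "interpolation v t \<in> cball a (discrete_cost f v / m1)"
    unfolding i(4) interpolation_cell[OF i(1-3)]
    using near[of i] near[of "Suc i"] i by (intro convexD[OF convex_cball]) auto
  then show ?thesis by simp
qed

end

text \<open>For \<open>a \<noteq> b\<close> the bound on the number of hops makes the interpolations compact, and the limit is
  optimal because the discrete minima converge to the minimal path cost.\<close>

theorem (in dense_graphs) optimal_paths_subsequence:
  assumes \<alpha>: "1 < \<alpha>" "\<alpha> < sqrt 2" and pythag: "cond_Pythag \<alpha> D f"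
    and tube: "\<forall>\<^sub>F n in sequentially. \<forall>p\<in>D. \<forall>q\<in>D. dist p q < \<epsilon> n \<longrightarrow>
        card {x \<in> S n. infdist x (closed_segment p q) < \<epsilon> n powr \<alpha>} \<le> K"
    and opt: "\<forall>\<^sub>F n in sequentially. v n \<in> argmin_set (discrete_cost f) (graph_paths (S n) (\<epsilon> n) a b)"
    and r: "strict_mono (r :: nat \<Rightarrow> nat)"
  shows "\<exists>s. strict_mono s \<and> (\<exists>\<gamma>\<in>argmin_set (path_cost f) (lip_paths D a b).
      uniform_limit {0..1} (\<lambda>k. interpolation (v (r (s k)))) \<gamma> sequentially \<and>
      (\<lambda>k. d_haus (set (v (r (s k)))) (path_image \<gamma>)) \<longlonglongrightarrow> 0)"
proof -
  let ?V = "\<lambda>n. graph_paths (S n) (\<epsilon> n) a b"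
  let ?\<mu> = "INF \<gamma>\<in>lip_paths D a b. path_cost f \<gamma>"
  have ab: "a \<in> D" "b \<in> D" using S by blast+
  obtain C where "0 < C" and C: "pythag_bound \<alpha> D f 1 C"
    using pythag zero_less_one unfolding cond_Pythag_def pythag_bound_def by blast
  have gain: "\<forall>\<^sub>F n in sequentially. \<kappa> * m2 * (\<epsilon> n)\<^sup>2 < C * \<epsilon> n powr (\<alpha>\<^sup>2)"
  proof -
    have "\<alpha>\<^sup>2 < (sqrt 2)\<^sup>2" using \<alpha> by (intro power_strict_mono) auto
    then have pos: "0 < 2 - \<alpha>\<^sup>2" by simp
    have "((\<lambda>n. \<epsilon> n powr (2 - \<alpha>\<^sup>2)) \<longlongrightarrow> 0) sequentially"
      using \<epsilon> pos by (intro tendsto_zero_powrI[OF _ tendsto_const]) (auto elim: eventually_mono)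
    then have "(\<lambda>n. \<kappa> * m2 * \<epsilon> n powr (2 - \<alpha>\<^sup>2)) \<longlonglongrightarrow> \<kappa> * m2 * 0" by (intro tendsto_intros)
    then have "\<forall>\<^sub>F n in sequentially. \<kappa> * m2 * \<epsilon> n powr (2 - \<alpha>\<^sup>2) < C"
      using \<open>0 < C\<close> by (intro order_tendstoD(2)) auto
    then show ?thesis using \<epsilon>(1)
    proof eventually_elim
      case (elim n)
      have "\<kappa> * m2 * (\<epsilon> n)\<^sup>2 = \<kappa> * m2 * \<epsilon> n powr (2 - \<alpha>\<^sup>2) * \<epsilon> n powr (\<alpha>\<^sup>2)"
        using elim(2) by (simp add: powr_add[symmetric])
      also have "\<dots> < C * \<epsilon> n powr (\<alpha>\<^sup>2)" using elim by (intro mult_strict_right_mono) auto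
      finally show ?case .
    qed
  qed
  define H where "H n = (INF v\<in>?V n. discrete_cost f v)" for n
  have H_lim: "H \<longlonglongrightarrow> ?\<mu>"
    unfolding H_def by (rule discrete_minimum_tendsto(2))
  have vH: "discrete_cost f (v n) = H n" if "v n \<in> argmin_set (discrete_cost f) (?V n)" for n
    unfolding H_def using that
    by (intro cInf_eq_minimum[symmetric]) (auto simp: argmin_set_def is_arg_min_linorder)
  have small: "\<forall>\<^sub>F n in sequentially. \<epsilon> n < 1 / 2" using order_tendstoD(2)[OF \<epsilon>(2), of "1 / 2"] by simp
  have H_bdd: "\<forall>\<^sub>F n in sequentially. H n < ?\<mu> + 1" using order_tendstoD(2)[OF H_lim] by simp
  define B where "B = real (Suc K) * ((?\<mu> + 1) / m1 + 1)"
  have good: "\<forall>\<^sub>F n in sequentially. v n \<in> ?V n \<and> discrete_cost f (v n) = H n \<and> 0 < \<epsilon> n \<and>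
      (a \<noteq> b \<longrightarrow> real (hops (v n)) * \<epsilon> n \<le> B)"
    using opt \<epsilon>(1) small gain tube H_bdd
  proof eventually_elim
    case (elim n)
    have vV: "v n \<in> ?V n" using elim(1) by (simp add: argmin_set_def is_arg_min_def)
    have "real (hops (v n)) * \<epsilon> n \<le> B" if "a \<noteq> b"
    proof -
      have "0 < \<alpha>" using \<alpha> by simp
      have card: "card {x \<in> S n. infdist x (closed_segment p q) < \<epsilon> n powr \<alpha>} \<le> Suc K"
        if "p \<in> D" "q \<in> D" "dist p q < \<epsilon> n" for p q
        using elim(5) that by (meson le_SucI)
      have "real (hops (v n)) * \<epsilon> n \<le> real (Suc K) * (discrete_cost f (v n) / m1 + \<epsilon> n)"
        by (rule optimal_path_hops[OF elim(1) S(1,4) \<open>a \<noteq> b\<close> elim(2,3) \<open>0 < \<alpha>\<close> elim(4) C card]) auto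
      also have "\<dots> \<le> B"
        unfolding B_def using elim(3,6) vH[OF elim(1)] m1_pos
        by (intro mult_left_mono add_mono divide_right_mono) auto
      finally show ?thesis .
    qed
    then show ?case using vV vH[OF elim(1)] elim(2) by simp
  qed
  then obtain n\<^sub>0 where n0: "\<And>n. n \<ge> n\<^sub>0 \<Longrightarrow> v n \<in> ?V n \<and> discrete_cost f (v n) = H n \<and> 0 < \<epsilon> n \<and>
      (a \<noteq> b \<longrightarrow> real (hops (v n)) * \<epsilon> n \<le> B)"
    by (auto simp: eventually_sequentially)
  define \<rho> where "\<rho> k = r (k + n\<^sub>0)" for k
  have \<rho>_mono: "strict_mono \<rho>" using r by (auto simp: \<rho>_def strict_mono_def)
  have \<rho>_ge: "n\<^sub>0 \<le> \<rho> k" for k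
    unfolding \<rho>_def using seq_suble[OF r, of "k + n\<^sub>0"] by simp
  have \<rho>V: "v (\<rho> k) \<in> ?V (\<rho> k)" and \<rho>H: "discrete_cost f (v (\<rho> k)) = H (\<rho> k)" and \<rho>\<epsilon>: "0 < \<epsilon> (\<rho> k)"
    and \<rho>B: "a \<noteq> b \<Longrightarrow> real (hops (v (\<rho> k))) * \<epsilon> (\<rho> k) \<le> B" for k
    using n0[OF \<rho>_ge[of k]] by auto
  have H\<rho>: "(\<lambda>k. H (\<rho> k)) \<longlonglongrightarrow> ?\<mu>" and \<epsilon>\<rho>: "(\<lambda>k. \<epsilon> (\<rho> k)) \<longlonglongrightarrow> 0"
    using LIMSEQ_subseq_LIMSEQ[OF H_lim \<rho>_mono] LIMSEQ_subseq_LIMSEQ[OF \<epsilon>(2) \<rho>_mono] by (simp_all add: o_def)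
  note path = graph_pathsD[OF \<rho>V]
  have set_D: "set (v (\<rho> k)) \<subseteq> D" for k using path(2)[of k] S(1) by blast
  have steps: "dist (v (\<rho> k) ! i) (v (\<rho> k) ! Suc i) \<le> \<epsilon> (\<rho> k)" if "i < hops (v (\<rho> k))" for k i
    using path(9)[OF that] by simp
  have "\<exists>\<gamma> s. strict_mono s \<and> \<gamma> \<in> lip_paths D a b \<and> path_cost f \<gamma> \<le> ?\<mu> \<and>
      uniform_limit {0..1} (\<lambda>k. interpolation (v (\<rho> (s k)))) \<gamma> sequentially"
  proof (cases "a = b")
    case False
    have cost: "list_cost f (v (\<rho> k)) \<le> H (\<rho> k)" for k
      using graph_cost(1)[OF \<rho>V S(1)] \<rho>H by simp
    have short: "short_steps D a b (\<epsilon> (\<rho> k)) B (v (\<rho> k))" for k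
      using path(1,3,4)[of k] set_D[of k] steps[of _ k] \<rho>B[OF False, of k] by (simp add: short_steps_def)
    show ?thesis
      using polygons_compact[OF short less_imp_le[OF \<rho>\<epsilon>] \<epsilon>\<rho> cost H\<rho>] by blast
  next
    case True
    have \<mu>0: "?\<mu> = 0"
    proof (rule antisym)
      have "?\<mu> \<le> path_cost f (\<lambda>_. a)"
        using const_lip_path[OF ab(1)] True
        by (intro cINF_lower bdd_belowI[of _ 0]) (auto simp: path_cost_nonneg)
      then show "?\<mu> \<le> 0" using const_path_cost[OF ab(1)] by simp
      show "0 \<le> ?\<mu>" using const_lip_path[OF ab(1)] True
        by (intro cINF_greatest) (auto simp: path_cost_nonneg)
    qed
    have "uniform_limit {0..1} (\<lambda>k. interpolation (v (\<rho> k))) (\<lambda>_. a) sequentially"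
    proof (rule uniform_limitI)
      fix e :: real assume "0 < e"
      then have "\<forall>\<^sub>F k in sequentially. H (\<rho> k) < e * m1"
        using order_tendstoD(2)[OF H\<rho>] m1_pos \<mu>0 by simp
      then show "\<forall>\<^sub>F k in sequentially. \<forall>t\<in>{0..1}. dist (interpolation (v (\<rho> k)) t) a < e"
      proof eventually_elim
        case (elim k)
        have "H (\<rho> k) / m1 < e" using elim m1_pos by (simp add: pos_divide_less_eq)
        then show ?case
          using interpolation_near_start[OF \<rho>V S(1)] \<rho>H by (metis dist_commute order_le_less_trans)
      qed
    qed
    then show ?thesis
      using const_lip_path[OF ab(1)] const_path_cost[OF ab(1)] True \<mu>0
      by (intro exI[of _ "\<lambda>_. a"] exI[of _ id]) (simp add: strict_mono_id)
  qed
  then obtain \<gamma> s where s: "strict_mono s" and \<gamma>: "\<gamma> \<in> lip_paths D a b" "path_cost f \<gamma> \<le> ?\<mu>"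
    and ul: "uniform_limit {0..1} (\<lambda>k. interpolation (v (\<rho> (s k)))) \<gamma> sequentially" by blast
  have "?\<mu> \<le> path_cost f \<sigma>" if "\<sigma> \<in> lip_paths D a b" for \<sigma>
    using that by (intro cINF_lower bdd_belowI[of _ 0]) (auto simp: path_cost_nonneg)
  then have \<gamma>_min: "\<gamma> \<in> argmin_set (path_cost f) (lip_paths D a b)"
    using \<gamma> by (auto simp: argmin_set_def is_arg_min_linorder intro: order_trans)
  have "(\<lambda>k. \<epsilon> (\<rho> (s k))) \<longlonglongrightarrow> 0" using LIMSEQ_subseq_LIMSEQ[OF \<epsilon>\<rho> s] by (simp add: o_def)
  from d_haus_tendsto[OF path(1) steps this ul]
  have dh: "(\<lambda>k. d_haus (set (v (\<rho> (s k)))) (path_image \<gamma>)) \<longlonglongrightarrow> 0" .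
  have "strict_mono (\<lambda>k. s k + n\<^sub>0)" using s by (auto simp: strict_mono_def)
  then show ?thesis
    using \<gamma>_min ul dh unfolding \<rho>_def by (intro exI[of _ "\<lambda>k. s k + n\<^sub>0"]) blast
qed

text \<open>Subsequences converge to images of minimizers, and all of these have the image of \<open>\<gamma>\<close>.\<close>

lemma d_haus_tendsto_unique_minimizer:
  assumes subseq: "\<And>r :: nat \<Rightarrow> nat. strict_mono r \<Longrightarrow>
      \<exists>s. strict_mono s \<and> (\<exists>\<gamma>\<in>argmin_set (path_cost f) (lip_paths D a b).
        uniform_limit {0..1} (\<lambda>k. interpolation (v (r (s k)))) \<gamma> sequentially \<and>
        (\<lambda>k. d_haus (set (v (r (s k)))) (path_image \<gamma>)) \<longlonglongrightarrow> 0)"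
    and unique: "unique_minimizer D f a b \<gamma>"
  shows "(\<lambda>n. d_haus (set (v n)) (path_image \<gamma>)) \<longlonglongrightarrow> 0"
proof (rule ccontr)
  let ?d = "\<lambda>n. d_haus (set (v n)) (path_image \<gamma>)"
  assume "\<not> ?d \<longlonglongrightarrow> 0"
  then obtain e where e: "e > 0" "\<And>N. \<exists>n\<ge>N. e \<le> \<bar>?d n\<bar>"
    unfolding lim_sequentially by (auto simp: not_less dist_real_def)
  then have "infinite {n. e \<le> \<bar>?d n\<bar>}" unfolding infinite_nat_iff_unbounded_le by blast
  then obtain r :: "nat \<Rightarrow> nat" where r: "strict_mono r" "\<And>n. e \<le> \<bar>?d (r n)\<bar>"
    using infinite_enumerate by (metis (no_types, lifting) mem_Collect_eq)
  obtain s \<sigma> where s: "strict_mono s" "\<sigma> \<in> argmin_set (path_cost f) (lip_paths D a b)"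
    "(\<lambda>k. d_haus (set (v (r (s k)))) (path_image \<sigma>)) \<longlonglongrightarrow> 0"
    using subseq[OF r(1)] by blast
  obtain h :: "real \<Rightarrow> real" and L where h: "h ` {0..1} \<subseteq> {0..1}" "L-lipschitz_on {0..1} h" "h 0 = 0" "h 1 = 1"
    "\<forall>t\<in>{0..1}. \<sigma> t = \<gamma> (h t)"
    using unique s(2) unfolding unique_minimizer_def by blast
  have "path_image \<sigma> = path_image \<gamma>"
    using h(5) by (intro lipschitz_reparametrization_image[OF h(1-4)]) auto
  then have "(\<lambda>k. ?d (r (s k))) \<longlonglongrightarrow> 0" using s(3) by simp
  then have "\<forall>\<^sub>F k in sequentially. dist (?d (r (s k))) 0 < e" using e(1) by (rule tendstoD)
  then obtain k where "\<bar>?d (r (s k))\<bar> < e" by (auto simp: eventually_sequentially dist_real_def)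
  with r(2)[of "s k"] show False by simp
qed

section \<open>Covering events and tubes for random points\<close>

lemma convex_body_compact_convex:
  assumes "convex_body D" shows "compact D" "convex D"
  using assms by (auto simp: convex_body_def compact_eq_bounded_closed convex_closure)

text \<open>Shrinking \<open>D\<close> towards \<open>x\<close> moves a fixed inner ball of \<open>D\<close> into the intersection of
  \<open>D\<close> with a small ball around \<open>x\<close>, also when \<open>x\<close> is a boundary point.\<close>

lemma convex_body_inner_balls:
  assumes "convex_body D"
  obtains \<beta> where "0 < \<beta>" "\<And>x r. x \<in> D \<Longrightarrow> 0 < r \<Longrightarrow> r \<le> 1 \<Longrightarrow> \<exists>y. ball y (\<beta> * r) \<subseteq> D \<inter> ball x r"
proof -
  obtain U where U: "open U" "U \<noteq> {}" "bounded U" "convex U" "D = closure U"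
    using assms by (auto simp: convex_body_def)
  have cD: "convex D" using convex_body_compact_convex[OF assms] by simp
  obtain q \<rho> where q: "0 < \<rho>" "ball q \<rho> \<subseteq> U" using U(1,2) by (metis ex_in_conv openE)
  then have qD: "ball q \<rho> \<subseteq> D" using U(5) closure_subset by blast
  have "bounded D" unfolding U(5) by (rule bounded_closure[OF U(3)])
  then obtain R where R: "\<And>x. x \<in> D \<Longrightarrow> dist q x \<le> R" by (meson bounded_any_center)
  have "q \<in> D" using qD q(1) by auto
  then have "0 \<le> R" using R[of q] by simp
  \<comment> \<open>Shrinking by \<open>t = s * r\<close> moves the points of the inner ball to distance at most
    \<open>t * (\<rho> + R) < r\<close> from \<open>x\<close>.\<close>
  define s where "s = 1 / (\<rho> + R + 1)"
  have s: "0 < s" "s \<le> 1" "s * (\<rho> + R) < 1" using q(1) \<open>0 \<le> R\<close> by (auto simp: s_def divide_le_eq)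
  show ?thesis
  proof (rule that[of "s * \<rho>"])
    show "0 < s * \<rho>" using s q by simp
    fix x and r :: real assume x: "x \<in> D" and r: "0 < r" "r \<le> 1"
    define t where "t = s * r"
    have t: "0 < t" "t \<le> 1" using s r by (auto simp: t_def mult_le_one)
    have "ball (x + t *\<^sub>R (q - x)) (s * \<rho> * r) \<subseteq> D \<inter> ball x r"
    proof
      fix y assume "y \<in> ball (x + t *\<^sub>R (q - x)) (s * \<rho> * r)"
      then have y: "norm (y - (x + t *\<^sub>R (q - x))) < t * \<rho>"
        by (simp add: dist_norm norm_minus_commute t_def mult.commute mult.left_commute)
      define z where "z = q + (1 / t) *\<^sub>R (y - (x + t *\<^sub>R (q - x)))"
      have "dist q z = norm (y - (x + t *\<^sub>R (q - x))) / t"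
        using t(1) unfolding z_def dist_norm by (simp only: norm_minus_commute[of q]) simp
      with y t(1) have "dist q z < \<rho>" by (simp add: pos_divide_less_eq mult.commute)
      then have "z \<in> D" using qD by auto
      have "t *\<^sub>R z = t *\<^sub>R q + (y - (x + t *\<^sub>R (q - x)))" using t(1) by (simp add: z_def scaleR_add_right)
      then have "y = (1 - t) *\<^sub>R x + t *\<^sub>R z" by (simp add: algebra_simps)
      then have "y \<in> D" using x \<open>z \<in> D\<close> t by (auto intro!: convexD[OF cD])
      have "norm (y - x) \<le> norm (y - (x + t *\<^sub>R (q - x))) + norm (t *\<^sub>R (q - x))"
        using norm_triangle_ineq[of "y - (x + t *\<^sub>R (q - x))" "t *\<^sub>R (q - x)"] by simp
      also have "\<dots> < t * \<rho> + t * R"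
        using y t(1) R[OF x] by (intro add_less_le_mono) (auto simp: dist_norm intro!: mult_left_mono)
      also have "\<dots> = r * (s * (\<rho> + R))" by (simp add: t_def algebra_simps)
      also have "\<dots> < r" using s(3) r(1) by simp
      finally have "dist x y < r" by (simp add: dist_norm norm_minus_commute)
      with \<open>y \<in> D\<close> show "y \<in> D \<inter> ball x r" by simp
    qed
    then show "\<exists>y. ball y (s * \<rho> * r) \<subseteq> D \<inter> ball x r" by blast
  qed
qed

text \<open>One point is chosen from each nonempty cell of a grid of mesh \<open>h / d\<close>.\<close>

lemma bounded_polynomial_nets:
  fixes D :: "'a::euclidean_space set"
  assumes "bounded D"
  shows "\<exists>C>0. \<forall>h. 0 < h \<and> h \<le> 1 \<longrightarrow>
    (\<exists>Z. finite Z \<and> Z \<subseteq> D \<and> (\<forall>x\<in>D. \<exists>z\<in>Z. dist x z < h) \<and> real (card Z) \<le> C * (1 / h) ^ DIM('a))"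
proof -
  let ?d = "DIM('a)"
  obtain R where R: "0 < R" "\<And>x. x \<in> D \<Longrightarrow> norm x \<le> R" using assms bounded_pos by blast
  show ?thesis
  proof (intro exI[of _ "(2 * R * real ?d + 2) ^ ?d"] conjI allI impI)
    show "0 < (2 * R * real ?d + 2) ^ ?d" using R(1) by (intro zero_less_power add_nonneg_pos) auto
    fix h :: real assume "0 < h \<and> h \<le> 1"
    then have h: "0 < h" "h \<le> 1" by auto
    define k where "k = real ?d / h"
    have k: "0 < k" using h by (simp add: k_def)
    define \<phi> where "\<phi> x = (\<lambda>i\<in>Basis. \<lfloor>(x \<bullet> i) * k\<rfloor>)" for x :: 'a
    let ?G = "Basis \<rightarrow>\<^sub>E {\<lfloor>- R * k\<rfloor>..\<lfloor>R * k\<rfloor>} :: ('a \<Rightarrow> int) set"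
    have finG: "finite ?G" by (intro finite_PiE) auto
    have sub: "\<phi> ` D \<subseteq> ?G"
    proof
      fix g assume "g \<in> \<phi> ` D"
      then obtain x where x: "x \<in> D" "g = \<phi> x" by auto
      show "g \<in> ?G"
        unfolding x(2) \<phi>_def
      proof (intro restrict_PiE_iff[THEN iffD2] ballI)
        fix i :: 'a assume "i \<in> Basis"
        then have "\<bar>x \<bullet> i\<bar> \<le> R" using Basis_le_norm[of i x] R(2)[OF x(1)] by simp
        then have "- R \<le> x \<bullet> i" "x \<bullet> i \<le> R" by auto
        then have "- R * k \<le> (x \<bullet> i) * k" "(x \<bullet> i) * k \<le> R * k"
          using mult_right_mono[OF _ less_imp_le[OF k]] by blast+
        then show "\<lfloor>(x \<bullet> i) * k\<rfloor> \<in> {\<lfloor>- R * k\<rfloor>..\<lfloor>R * k\<rfloor>}" by (auto intro!: floor_mono)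
      qed
    qed
    then have fin: "finite (\<phi> ` D)" using finG finite_subset by blast
    let ?Z = "inv_into D \<phi> ` (\<phi> ` D)"
    have same_cell: "dist x y < h" if "\<phi> x = \<phi> y" for x y
    proof -
      have "\<bar>(x - y) \<bullet> i\<bar> < 1 / k" if "i \<in> Basis" for i
      proof -
        have "\<lfloor>(x \<bullet> i) * k\<rfloor> = \<lfloor>(y \<bullet> i) * k\<rfloor>"
          using fun_cong[OF \<open>\<phi> x = \<phi> y\<close>, of i] that by (simp add: \<phi>_def)
        then have "\<bar>(x \<bullet> i) * k - (y \<bullet> i) * k\<bar> < 1" by linarith
        also have "(x \<bullet> i) * k - (y \<bullet> i) * k = ((x - y) \<bullet> i) * k" by (simp add: algebra_simps)
        finally show ?thesis using k by (simp add: abs_mult field_simps)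
      qed
      then have "(\<Sum>i\<in>Basis. \<bar>(x - y) \<bullet> i\<bar>) < (\<Sum>i\<in>(Basis :: 'a set). 1 / k)"
        by (intro sum_strict_mono) auto
      also have "\<dots> = h" using h by (simp add: k_def)
      finally show ?thesis using norm_le_l1[of "x - y"] by (simp add: dist_norm)
    qed
    show "\<exists>Z. finite Z \<and> Z \<subseteq> D \<and> (\<forall>x\<in>D. \<exists>z\<in>Z. dist x z < h) \<and>
        real (card Z) \<le> (2 * R * real ?d + 2) ^ ?d * (1 / h) ^ ?d"
    proof (intro exI[of _ ?Z] conjI ballI)
      show "finite ?Z" using fin by simp
      show "?Z \<subseteq> D" by (auto intro: inv_into_into)
      show "\<exists>z\<in>?Z. dist x z < h" if "x \<in> D" for x
        using that same_cell[of x "inv_into D \<phi> (\<phi> x)"] f_inv_into_f[of "\<phi> x" \<phi> D] by auto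
      have "card ?Z \<le> card (\<phi> ` D)" using fin by (rule card_image_le)
      also have "\<dots> \<le> card ?G" by (rule card_mono[OF finG sub])
      also have "\<dots> = nat (\<lfloor>R * k\<rfloor> - \<lfloor>- R * k\<rfloor> + 1) ^ ?d" by (simp add: card_PiE)
      finally have "real (card ?Z) \<le> real (nat (\<lfloor>R * k\<rfloor> - \<lfloor>- R * k\<rfloor> + 1)) ^ ?d"
        by (metis of_nat_le_iff of_nat_power)
      also have "\<dots> \<le> ((2 * R * real ?d + 2) * (1 / h)) ^ ?d"
      proof (intro power_mono)
        have "0 < R * k" using R k by simp
        then have "real (nat (\<lfloor>R * k\<rfloor> - \<lfloor>- R * k\<rfloor> + 1)) \<le> 2 * (R * k) + 2" by linarith
        also have "\<dots> \<le> (2 * R * real ?d + 2) * (1 / h)"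
          using h by (simp add: k_def field_simps)
        finally show "real (nat (\<lfloor>R * k\<rfloor> - \<lfloor>- R * k\<rfloor> + 1)) \<le> (2 * R * real ?d + 2) * (1 / h)" .
      qed simp
      finally show "real (card ?Z) \<le> (2 * R * real ?d + 2) ^ ?d * (1 / h) ^ ?d"
        by (simp only: power_mult_distrib)
    qed
  qed
qed

lemma powr_inverse_power: "0 < y \<Longrightarrow> 0 < d \<Longrightarrow> (y powr (1 / real d)) ^ d = y"
  by (simp add: powr_realpow[symmetric] powr_powr)

lemma (in prob_space) ae_eventually_not_if_summable:
  assumes meas: "\<And>n. A n \<in> events" and bound: "\<forall>\<^sub>F n in sequentially. prob (A n) \<le> K * inverse (real n ^ 2)"
  shows "AE \<omega> in M. \<forall>\<^sub>F n in sequentially. \<omega> \<notin> A n"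
proof -
  have "summable (\<lambda>n. prob (A n))"
  proof (rule summable_comparison_test_ev)
    show "\<forall>\<^sub>F n in sequentially. norm (prob (A n)) \<le> K * inverse (real n ^ 2)" using bound by simp
    show "summable (\<lambda>n. K * inverse (real n ^ 2))"
      using inverse_power_summable[of 2] by (intro summable_mult) simp
  qed
  then have "AE \<omega> in M. \<forall>\<^sub>F n in sequentially. \<omega> \<in> space M - A n"
    by (intro borel_cantelli_AE1 meas) (auto simp: emeasure_eq_measure)
  then show ?thesis by eventually_elim (auto elim: eventually_mono)
qed

text \<open>The estimates for random points use only that balls of radius \<open>r\<close> have probability of the
  order of \<open>r\<close> to the power of the dimension.\<close>

locale random_sample = prob_space M for M :: "'w measure" +
  fixes D :: "'a::euclidean_space set" and X :: "nat \<Rightarrow> 'w \<Rightarrow> 'a" and p\<^sub>1 p\<^sub>2 :: real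
  assumes indep: "indep_vars (\<lambda>_. borel) X {1..}"
    and p_pos: "0 < p\<^sub>1" "0 < p\<^sub>2"
    and inner: "\<And>i x r. 1 \<le> i \<Longrightarrow> x \<in> D \<Longrightarrow> 0 < r \<Longrightarrow> r \<le> 1 \<Longrightarrow>
      p\<^sub>1 * r ^ DIM('a) \<le> prob (X i -` ball x r \<inter> space M)"
    and outer: "\<And>i x r. 1 \<le> i \<Longrightarrow> 0 \<le> r \<Longrightarrow> prob (X i -` ball x r \<inter> space M) \<le> p\<^sub>2 * r ^ DIM('a)"
    and D_bounded: "bounded D"
begin

lemma X_measurable [measurable]: "1 \<le> i \<Longrightarrow> X i \<in> borel_measurable M"
  using indep by (auto simp: indep_vars_def2)

lemma X_event: "1 \<le> i \<Longrightarrow> B \<in> sets borel \<Longrightarrow> X i -` B \<inter> space M \<in> events"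
  using X_measurable[of i] by (rule measurable_sets)

text \<open>If a ball of radius \<open>2 * h n\<close> around a point of \<open>D\<close> contains no sample point, neither does the
  ball of radius \<open>h n\<close> around some point of a net. Each of these polynomially many balls is missed
  by all sample points with probability at most \<open>exp (- n * p\<^sub>1 * h n ^ d)\<close>.\<close>

theorem sample_covers:
  obtains A where "0 < A" "AE \<omega> in M. \<forall>\<^sub>F n in sequentially. \<forall>x\<in>D. \<exists>i\<in>{1..n}.
    dist x (X i \<omega>) < A * (ln (real n) / real n) powr (1 / real DIM('a))"
proof -
  let ?d = "DIM('a)"
  obtain C where C: "0 < C" "\<forall>h. 0 < h \<and> h \<le> 1 \<longrightarrow>
    (\<exists>Z. finite Z \<and> Z \<subseteq> D \<and> (\<forall>x\<in>D. \<exists>z\<in>Z. dist x z < h) \<and> real (card Z) \<le> C * (1 / h) ^ ?d)"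
    using bounded_polynomial_nets[OF D_bounded] by (elim exE conjE)
  \<comment> \<open>The factor \<open>3\<close> turns the probability of missing a ball into \<open>n powr - 3\<close>; the number of
    balls is at most of order \<open>n\<close>, which leaves the summable \<open>n powr - 2\<close>.\<close>
  define h where "h n = (3 / p\<^sub>1 * (ln (real n) / real n)) powr (1 / real ?d)" for n :: nat
  have h_pow: "h n ^ ?d = 3 / p\<^sub>1 * (ln (real n) / real n)" if "3 \<le> n" for n
  proof -
    have "0 < 3 / p\<^sub>1 * (ln (real n) / real n)" using that p_pos by simp
    then show ?thesis unfolding h_def by (rule powr_inverse_power) simp
  qed
  have h_pos: "0 < h n" if "3 \<le> n" for n using that p_pos by (simp add: h_def)
  have "(\<lambda>n. ln (real n) / real n) \<longlonglongrightarrow> 0" by (rule lim_ln_over_n)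
  then have "(\<lambda>n. 3 / p\<^sub>1 * (ln (real n) / real n)) \<longlonglongrightarrow> 3 / p\<^sub>1 * 0"
    by (rule tendsto_mult_left)
  then have "\<forall>\<^sub>F n in sequentially. 3 / p\<^sub>1 * (ln (real n) / real n) < 1"
    by (rule order_tendstoD(2)) simp
  then have h_le: "\<forall>\<^sub>F n in sequentially. h n \<le> 1"
    using eventually_ge_at_top[of 3]
  proof eventually_elim
    case (elim n)
    have "0 \<le> 3 / p\<^sub>1 * (ln (real n) / real n)" using elim p_pos by simp
    then show ?case unfolding h_def using elim by (intro powr_le1) auto
  qed
  have "\<forall>n. \<exists>Z. (3 \<le> n \<and> h n \<le> 1 \<longrightarrow> finite Z \<and> Z \<subseteq> D \<and> (\<forall>x\<in>D. \<exists>z\<in>Z. dist x z < h n) \<and>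
      real (card Z) \<le> C * (1 / h n) ^ ?d) \<and> (\<not> (3 \<le> n \<and> h n \<le> 1) \<longrightarrow> Z = {})"
    using C(2) h_pos by metis
  then obtain Z where Z: "\<And>n. 3 \<le> n \<Longrightarrow> h n \<le> 1 \<Longrightarrow> finite (Z n) \<and> Z n \<subseteq> D \<and>
      (\<forall>x\<in>D. \<exists>z\<in>Z n. dist x z < h n) \<and> real (card (Z n)) \<le> C * (1 / h n) ^ ?d"
    and Z0: "\<And>n. \<not> (3 \<le> n \<and> h n \<le> 1) \<Longrightarrow> Z n = {}" by metis
  have Zfin: "finite (Z n)" for n using Z[of n] Z0[of n] by (cases "3 \<le> n \<and> h n \<le> 1") auto
  define miss where "miss n z = (\<Inter>i\<in>{1..n}. X i -` (- ball z (h n)) \<inter> space M)" for n z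
  define bad where "bad n = (\<Union>z\<in>Z n. miss n z)" for n
  have miss_meas: "miss n z \<in> events" if "3 \<le> n" for n z
    unfolding miss_def using that by (intro sets.finite_INT X_event) auto
  have bad_meas: "bad n \<in> events" for n
  proof (cases "3 \<le> n")
    case True
    then show ?thesis unfolding bad_def by (intro sets.finite_UN Zfin miss_meas)
  next
    case False
    then show ?thesis using Z0[of n] by (simp add: bad_def)
  qed
  have prob_miss: "prob (miss n z) \<le> inverse (real n ^ 3)" if n: "3 \<le> n" and hn: "h n \<le> 1" and z: "z \<in> D" for n z
  proof -
    have "prob (miss n z) = (\<Prod>i\<in>{1..n}. prob (X i -` (- ball z (h n)) \<inter> space M))"
      unfolding miss_def using n by (intro indep_varsD[OF indep]) auto
    also have "\<dots> \<le> (\<Prod>i\<in>{1..n}. exp (- (p\<^sub>1 * h n ^ ?d)))"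
    proof (intro prod_mono conjI)
      fix i assume "i \<in> {1..n}"
      then have i: "1 \<le> i" by simp
      have "X i -` (- ball z (h n)) \<inter> space M = space M - (X i -` ball z (h n) \<inter> space M)" by auto
      then have "prob (X i -` (- ball z (h n)) \<inter> space M) = 1 - prob (X i -` ball z (h n) \<inter> space M)"
        using X_event[OF i, of "ball z (h n)"] by (simp add: prob_compl)
      also have "\<dots> \<le> 1 + (- (p\<^sub>1 * h n ^ ?d))" using inner[OF i z h_pos[OF n] hn] by simp
      also have "\<dots> \<le> exp (- (p\<^sub>1 * h n ^ ?d))" by (rule exp_ge_add_one_self)
      finally show "prob (X i -` (- ball z (h n)) \<inter> space M) \<le> exp (- (p\<^sub>1 * h n ^ ?d))" .
    qed simp
    also have "\<dots> = exp (- (real n * (p\<^sub>1 * h n ^ ?d)))" by (simp add: exp_of_nat_mult[symmetric])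
    also have "real n * (p\<^sub>1 * h n ^ ?d) = 3 * ln (real n)"
      unfolding h_pow[OF n] using n p_pos by simp
    also have "exp (- (3 * ln (real n))) = inverse (real n ^ 3)"
      using n exp_of_nat_mult[of 3 "ln (real n)"] by (simp add: exp_minus)
    finally show ?thesis .
  qed
  have "\<forall>\<^sub>F n in sequentially. prob (bad n) \<le> (C * p\<^sub>1 / 3) * inverse (real n ^ 2)"
    using h_le eventually_ge_at_top[of 3]
  proof eventually_elim
    case (elim n)
    note Zn = Z[OF elim(2,1)]
    have "1 \<le> ln (real n)"
      using elim(2) exp_le by (subst ln_ge_iff) auto
    have "prob (bad n) \<le> (\<Sum>z\<in>Z n. prob (miss n z))"
      unfolding bad_def using Zfin miss_meas[OF elim(2)] by (intro finite_measure_subadditive_finite) auto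
    also have "\<dots> \<le> (\<Sum>z\<in>Z n. inverse (real n ^ 3))"
      using Zn by (intro sum_mono prob_miss elim) auto
    also have "\<dots> = real (card (Z n)) * inverse (real n ^ 3)" by simp
    also have "\<dots> \<le> (C * (1 / h n) ^ ?d) * inverse (real n ^ 3)" using Zn by (intro mult_right_mono) auto
    also have "(1 / h n) ^ ?d = p\<^sub>1 / 3 * (real n / ln (real n))"
      unfolding power_one_over h_pow[OF elim(2)] by simp
    also have "C * (p\<^sub>1 / 3 * (real n / ln (real n))) * inverse (real n ^ 3)
        \<le> C * (p\<^sub>1 / 3 * (real n / 1)) * inverse (real n ^ 3)"
      using \<open>1 \<le> ln (real n)\<close> C(1) p_pos elim(2)
      by (intro mult_right_mono mult_left_mono divide_left_mono) auto
    also have "\<dots> = (C * p\<^sub>1 / 3) * inverse (real n ^ 2)"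
      using elim(2) by (simp add: power2_eq_square power3_eq_cube field_simps)
    finally show ?case .
  qed
  then have ae: "AE \<omega> in M. \<forall>\<^sub>F n in sequentially. \<omega> \<notin> bad n"
    by (rule ae_eventually_not_if_summable[OF bad_meas])
  show ?thesis
  proof (rule that[of "2 * (3 / p\<^sub>1) powr (1 / real ?d)"])
    show "0 < 2 * (3 / p\<^sub>1) powr (1 / real ?d)" using p_pos by simp
    show "AE \<omega> in M. \<forall>\<^sub>F n in sequentially. \<forall>x\<in>D. \<exists>i\<in>{1..n}.
      dist x (X i \<omega>) < 2 * (3 / p\<^sub>1) powr (1 / real ?d) * (ln (real n) / real n) powr (1 / real ?d)"
      using ae AE_space
    proof eventually_elim
      case (elim \<omega>)
      show ?case using elim(1) h_le eventually_ge_at_top[of 3]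
      proof eventually_elim
        case (elim n)
        show ?case
        proof
          fix x assume "x \<in> D"
          then obtain z where z: "z \<in> Z n" "dist x z < h n" using Z[OF elim(3,2)] by blast
          then have "\<omega> \<notin> miss n z" using elim(1) by (auto simp: bad_def)
          then have "\<exists>i\<in>{1..n}. X i \<omega> \<in> ball z (h n)"
            using \<open>\<omega> \<in> space M\<close> unfolding miss_def by blast
          then obtain i where i: "i \<in> {1..n}" "dist z (X i \<omega>) < h n" by auto
          have "dist x (X i \<omega>) < 2 * h n" using dist_triangle[of x "X i \<omega>" z] z(2) i(2) by simp
          also have "h n = (3 / p\<^sub>1) powr (1 / real ?d) * (ln (real n) / real n) powr (1 / real ?d)"
            unfolding h_def by (rule powr_mult)
          finally show "\<exists>i\<in>{1..n}. dist x (X i \<omega>) < 2 * (3 / p\<^sub>1) powr (1 / real ?d) * (ln (real n) / real n) powr (1 / real ?d)"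
            using i(1) by (auto simp: mult.assoc)
        qed
      qed
    qed
  qed
qed

text \<open>A set of probability \<open>O(n powr (- 1 - \<beta>))\<close> catches \<open>k\<close> sample points with probability
  \<open>O(n powr (- \<beta> k))\<close>, which beats any polynomial number of sets once \<open>k\<close> is large.\<close>

theorem few_sample_points:
  fixes \<T> :: "nat \<Rightarrow> 'a set set"
  assumes fin: "\<And>n. finite (\<T> n)" and borel: "\<And>n T. T \<in> \<T> n \<Longrightarrow> T \<in> sets borel"
    and C: "0 \<le> C" "0 \<le> C'" and "0 < \<beta>"
    and prob_T: "\<forall>\<^sub>F n in sequentially. \<forall>T\<in>\<T> n. \<forall>i\<ge>1. prob (X i -` T \<inter> space M) \<le> C * real n powr (- 1 - \<beta>)"
    and card_T: "\<forall>\<^sub>F n in sequentially. real (card (\<T> n)) \<le> C' * real n powr q"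
  obtains K where "AE \<omega> in M. \<forall>\<^sub>F n in sequentially. \<forall>T\<in>\<T> n. card {i\<in>{1..n}. X i \<omega> \<in> T} \<le> K"
proof -
  define k where "k = Suc (nat \<lceil>(q + 2) / \<beta>\<rceil>)"
  have k: "1 \<le> k" "q + 2 \<le> \<beta> * real k"
  proof -
    have "(q + 2) / \<beta> \<le> real k" unfolding k_def by linarith
    then show "q + 2 \<le> \<beta> * real k" using \<open>0 < \<beta>\<close> by (simp add: field_simps)
  qed (simp add: k_def)
  define hit :: "'a set \<Rightarrow> nat set \<Rightarrow> 'w set" where "hit T I = (\<Inter>i\<in>I. X i -` T \<inter> space M)" for T I
  define J where "J n = {I. I \<subseteq> {1..n} \<and> card I = k}" for n :: nat
  define bad where "bad n = (\<Union>T\<in>\<T> n. \<Union>I\<in>J n. hit T I)" for n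
  have J: "finite (J n)" for n unfolding J_def by (rule finite_subset[of _ "Pow {1..n}"]) auto
  have JI: "I \<noteq> {}" "finite I" "I \<subseteq> {1..}" if "I \<in> J n" for n I
    using that k(1) finite_subset[of I "{1..n}"] by (auto simp: J_def)
  have hit_meas: "hit T I \<in> events" if "T \<in> \<T> n" "I \<in> J n" for n T I
    unfolding hit_def using JI[OF that(2)] by (intro sets.finite_INT X_event borel[OF that(1)]) auto
  have bad_meas: "bad n \<in> events" for n
    unfolding bad_def by (intro sets.finite_UN fin J hit_meas)
  have "\<forall>\<^sub>F n in sequentially. prob (bad n) \<le> (C' * C ^ k) * inverse (real n ^ 2)"
    using prob_T card_T eventually_ge_at_top[of 1]
  proof eventually_elim
    case (elim n)
    have n: "1 \<le> real n" using elim(3) by simp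
    let ?p = "C * real n powr (- 1 - \<beta>)"
    have p: "0 \<le> ?p" using C by simp
    have prob_hit: "prob (hit T I) \<le> ?p ^ k" if "T \<in> \<T> n" "I \<in> J n" for T I
    proof -
      have "prob (hit T I) = (\<Prod>i\<in>I. prob (X i -` T \<inter> space M))"
        unfolding hit_def using JI[OF that(2)] borel[OF that(1)] by (intro indep_varsD[OF indep]) auto
      also have "\<dots> \<le> (\<Prod>i\<in>I. ?p)" using elim(1) that JI[OF that(2)] by (intro prod_mono) auto
      also have "\<dots> = ?p ^ k" using that(2) by (simp add: J_def)
      finally show ?thesis .
    qed
    have "prob (bad n) \<le> (\<Sum>T\<in>\<T> n. prob (\<Union>I\<in>J n. hit T I))"
      unfolding bad_def using fin J hit_meas
      by (intro finite_measure_subadditive_finite) (auto intro!: sets.finite_UN)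
    also have "\<dots> \<le> (\<Sum>T\<in>\<T> n. \<Sum>I\<in>J n. prob (hit T I))"
      using J hit_meas by (intro sum_mono finite_measure_subadditive_finite) auto
    also have "\<dots> \<le> (\<Sum>T\<in>\<T> n. \<Sum>I\<in>J n. ?p ^ k)" by (intro sum_mono prob_hit)
    also have "\<dots> = real (card (\<T> n)) * (real (card (J n)) * ?p ^ k)" by simp
    also have "\<dots> \<le> (C' * real n powr q) * (real n ^ k * ?p ^ k)"
    proof (intro mult_mono elim)
      have "card (J n) = n choose k" unfolding J_def using n_subsets[of "{1..n}" k] by simp
      also have "\<dots> \<le> n ^ k" using binomial_fact_pow[of n k] fact_ge_1[of k]
        by (metis (no_types, lifting) le_trans mult.right_neutral mult_le_mono2)
      finally show "real (card (J n)) \<le> real n ^ k" by (metis of_nat_le_iff of_nat_power)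
    qed (use C p in auto)
    also have "real n ^ k * ?p ^ k = C ^ k * (real n * real n powr (- 1 - \<beta>)) ^ k"
      by (simp add: power_mult_distrib)
    also have "real n * real n powr (- 1 - \<beta>) = real n powr (- \<beta>)"
      using n by (simp add: powr_mult_base)
    also have "(real n powr (- \<beta>)) ^ k = real n powr (- (\<beta> * real k))"
      using n by (simp add: powr_powr powr_realpow[symmetric])
    also have "C' * real n powr q * (C ^ k * real n powr (- (\<beta> * real k))) = (C' * C ^ k) * real n powr (q - \<beta> * real k)"
      by (simp add: powr_diff powr_minus field_simps)
    also have "\<dots> \<le> (C' * C ^ k) * real n powr (- 2)"
      using C k(2) n by (intro mult_left_mono powr_mono) auto
    also have "real n powr (- 2) = inverse (real n ^ 2)"
      using n powr_realpow[of "real n" 2] by (simp add: powr_minus)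
    finally show ?case .
  qed
  then have ae: "AE \<omega> in M. \<forall>\<^sub>F n in sequentially. \<omega> \<notin> bad n"
    by (rule ae_eventually_not_if_summable[OF bad_meas])
  show ?thesis
  proof (rule that[of k])
    show "AE \<omega> in M. \<forall>\<^sub>F n in sequentially. \<forall>T\<in>\<T> n. card {i\<in>{1..n}. X i \<omega> \<in> T} \<le> k"
      using ae AE_space
    proof eventually_elim
      case (elim \<omega>)
      show ?case using elim(1)
      proof eventually_elim
        case (elim n)
        show ?case
        proof (intro ballI, rule ccontr)
          fix T assume T: "T \<in> \<T> n" and "\<not> card {i\<in>{1..n}. X i \<omega> \<in> T} \<le> k"
          then have "k \<le> card {i\<in>{1..n}. X i \<omega> \<in> T}" by simp
          then obtain I where I: "I \<subseteq> {i\<in>{1..n}. X i \<omega> \<in> T}" "card I = k"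
            by (rule obtain_subset_with_card_n)
          then have "I \<in> J n" "\<omega> \<in> hit T I" using \<open>\<omega> \<in> space M\<close> by (auto simp: J_def hit_def)
          then show False using elim T by (auto simp: bad_def)
        qed
      qed
    qed
  qed
qed

end

text \<open>Tubes around segments between arbitrary points are replaced by unions of about \<open>\<epsilon> / r\<close>
  balls with equidistant centres on a segment between points \<open>z\<close> and \<open>z'\<close> of a net. This gives a
  deterministic family of polynomially many sets, with a volume bound that needs no integration
  over tubes.\<close>

definition tube_cover :: "real \<Rightarrow> real \<Rightarrow> 'a::euclidean_space \<Rightarrow> 'a \<Rightarrow> 'a set" where
  "tube_cover \<epsilon> r z z' = (\<Union>j\<le>nat \<lceil>3 * \<epsilon> / r\<rceil>. ball (z + (real j / real (nat \<lceil>3 * \<epsilon> / r\<rceil>)) *\<^sub>R (z' - z)) (4 * r))"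

text \<open>The distance from \<open>x\<close> to a centre is less than \<open>4 * r\<close>, as it is made up of three parts of size
  at most \<open>r\<close>: to the segment from \<open>p\<close> to \<open>q\<close>, from there to the segment between the net points,
  and along the latter to the nearest smaller centre.\<close>

lemma tube_subset_tube_cover:
  fixes p q z z' x :: "'a::euclidean_space"
  assumes "0 < \<epsilon>" "0 < r" and z: "dist p z < r" "dist q z' < r" "dist z z' \<le> 3 * \<epsilon>"
    and x: "infdist x (closed_segment p q) < r"
  shows "x \<in> tube_cover \<epsilon> r z z'"
proof -
  define J where "J = nat \<lceil>3 * \<epsilon> / r\<rceil>"
  have "0 < 3 * \<epsilon> / r" using assms by simp
  then have J: "3 * \<epsilon> / r \<le> real J" "0 < real J" unfolding J_def by linarith+
  have "(INF y\<in>closed_segment p q. dist x y) < r" using x by (simp add: infdist_def)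
  then have "\<exists>y\<in>closed_segment p q. dist x y < r"
    by (subst (asm) cINF_less_iff) (auto intro: bdd_belowI[of _ 0])
  then obtain y where y: "y \<in> closed_segment p q" "dist x y < r" by blast
  then obtain s where s: "0 \<le> s" "s \<le> 1" "y = (1 - s) *\<^sub>R p + s *\<^sub>R q"
    by (auto simp: closed_segment_def)
  define y' where "y' = (1 - s) *\<^sub>R z + s *\<^sub>R z'"
  have "y - y' = (1 - s) *\<^sub>R (p - z) + s *\<^sub>R (q - z')" by (simp add: s(3) y'_def algebra_simps)
  then have "dist y y' \<le> (1 - s) * dist p z + s * dist q z'"
    using s(1,2) norm_triangle_ineq[of "(1 - s) *\<^sub>R (p - z)" "s *\<^sub>R (q - z')"] by (simp add: dist_norm)
  also have "\<dots> \<le> (1 - s) * r + s * r" using z s(1,2) by (intro add_mono mult_left_mono) auto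
  finally have yy': "dist y y' \<le> r" by (simp add: algebra_simps)
  define j where "j = nat \<lfloor>s * real J\<rfloor>"
  have "0 \<le> s * real J" using s(1) J(2) by simp
  then have j: "real j \<le> s * real J" "s * real J < real j + 1" unfolding j_def by linarith+
  have "s * real J \<le> 1 * real J" using s(2) J(2) by (intro mult_right_mono) auto
  then have "j \<le> J" using j(1) by simp
  have sj: "\<bar>s - real j / real J\<bar> \<le> 1 / real J"
  proof -
    have "s - real j / real J = (s * real J - real j) / real J" using J(2) by (simp add: diff_divide_distrib)
    then show ?thesis using j J(2) by (simp add: divide_right_mono)
  qed
  have "y' - (z + (real j / real J) *\<^sub>R (z' - z)) = (s - real j / real J) *\<^sub>R (z' - z)"
    by (simp add: y'_def algebra_simps)
  then have "dist y' (z + (real j / real J) *\<^sub>R (z' - z)) = \<bar>s - real j / real J\<bar> * dist z z'"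
    by (simp add: dist_norm norm_minus_commute)
  also have "\<dots> \<le> 1 / real J * (3 * \<epsilon>)" using sj z(3) J(2) by (intro mult_mono) auto
  also have "\<dots> \<le> r" using J \<open>0 < r\<close> by (simp add: field_simps)
  finally have "dist x (z + (real j / real J) *\<^sub>R (z' - z)) < 4 * r"
    using y(2) yy' \<open>0 < r\<close> dist_triangle[of x "z + (real j / real J) *\<^sub>R (z' - z)" y]
      dist_triangle[of y "z + (real j / real J) *\<^sub>R (z' - z)" y'] by linarith
  then show ?thesis using \<open>j \<le> J\<close> unfolding tube_cover_def J_def[symmetric] by (auto simp: dist_commute)
qed

context random_sample
begin

text \<open>There are at most \<open>3 * \<epsilon> / r + 2 \<le> 5 * \<epsilon> / r\<close> balls.\<close>

lemma prob_tube_cover: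
  assumes "1 \<le> i" "0 < r" "r \<le> \<epsilon>"
  shows "prob (X i -` tube_cover \<epsilon> r z z' \<inter> space M) \<le> 5 * p\<^sub>2 * 4 ^ DIM('a) * (\<epsilon> * r ^ (DIM('a) - 1))"
proof -
  let ?d = "DIM('a)"
  define J where "J = nat \<lceil>3 * \<epsilon> / r\<rceil>"
  let ?B = "\<lambda>j. X i -` ball (z + (real j / real J) *\<^sub>R (z' - z)) (4 * r) \<inter> space M"
  have eq: "X i -` tube_cover \<epsilon> r z z' \<inter> space M = (\<Union>j\<le>J. ?B j)"
    unfolding tube_cover_def J_def[symmetric] by auto
  have "prob (X i -` tube_cover \<epsilon> r z z' \<inter> space M) \<le> (\<Sum>j\<le>J. prob (?B j))"
    unfolding eq using X_event[OF assms(1)] by (intro finite_measure_subadditive_finite) auto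
  also have "\<dots> \<le> (\<Sum>j\<le>J. p\<^sub>2 * (4 * r) ^ ?d)" using assms by (intro sum_mono outer) auto
  also have "\<dots> = (real J + 1) * (p\<^sub>2 * (4 * r) ^ ?d)" by simp
  also have "\<dots> \<le> (5 * (\<epsilon> / r)) * (p\<^sub>2 * (4 * r) ^ ?d)"
  proof (intro mult_right_mono)
    have "1 \<le> \<epsilon> / r" using assms by simp
    moreover have "real J \<le> 3 * (\<epsilon> / r) + 1" using \<open>1 \<le> \<epsilon> / r\<close> unfolding J_def by linarith
    ultimately show "real J + 1 \<le> 5 * (\<epsilon> / r)" by linarith
  qed (use p_pos assms in auto)
  also have "\<dots> = 5 * p\<^sub>2 * 4 ^ ?d * (\<epsilon> * r ^ (?d - 1))"
  proof -
    have "r ^ ?d = r * r ^ (?d - 1)" by (metis DIM_positive power_eq_if less_numeral_extra(3))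
    then show ?thesis using assms(2) by (simp add: power_mult_distrib)
  qed
  finally show ?thesis .
qed

text \<open>With \<open>r = \<epsilon> powr \<alpha>\<close> the probability of the covers is at most of order \<open>\<epsilon> * r ^ (d - 1) = n powr (- 1 - \<beta>)\<close>,
  where \<open>\<beta> = \<delta> * (\<alpha> * (d - 1) + 1) - 1\<close> is positive.\<close>

theorem tubes_contain_few_points:
  assumes \<alpha>: "1 \<le> \<alpha>" and "0 < \<delta>" and \<delta>: "1 < \<delta> * (\<alpha> * (real DIM('a) - 1) + 1)"
  obtains K where "AE \<omega> in M. \<forall>\<^sub>F n in sequentially. \<forall>p\<in>D. \<forall>q\<in>D. dist p q < real n powr (- \<delta>) \<longrightarrow>
    card {i\<in>{1..n}. infdist (X i \<omega>) (closed_segment p q) < (real n powr (- \<delta>)) powr \<alpha>} \<le> K"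
proof -
  let ?d = "DIM('a)"
  define \<epsilon> where "\<epsilon> n = real n powr (- \<delta>)" for n
  define r where "r n = \<epsilon> n powr \<alpha>" for n
  have eps: "0 < \<epsilon> n" "\<epsilon> n \<le> 1" "0 < r n" "r n \<le> \<epsilon> n" "r n \<le> 1" if "1 \<le> n" for n
  proof -
    show 1: "0 < \<epsilon> n" using that by (simp add: \<epsilon>_def)
    show 2: "\<epsilon> n \<le> 1" using that \<open>0 < \<delta>\<close> powr_mono[of "- \<delta>" 0 "real n"] by (simp add: \<epsilon>_def)
    show "0 < r n" using 1 by (simp add: r_def)
    show 3: "r n \<le> \<epsilon> n" using powr_mono'[of 1 \<alpha> "\<epsilon> n"] 1 2 \<alpha> by (simp add: r_def)
    show "r n \<le> 1" using 2 3 by simp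
  qed
  obtain C where C: "0 < C" "\<forall>h. 0 < h \<and> h \<le> 1 \<longrightarrow>
    (\<exists>Z. finite Z \<and> Z \<subseteq> D \<and> (\<forall>x\<in>D. \<exists>z\<in>Z. dist x z < h) \<and> real (card Z) \<le> C * (1 / h) ^ ?d)"
    using bounded_polynomial_nets[OF D_bounded] by (elim exE conjE)
  have "\<forall>n. \<exists>Z. finite Z \<and> (1 \<le> n \<longrightarrow> (\<forall>x\<in>D. \<exists>z\<in>Z. dist x z < r n) \<and> real (card Z) \<le> C * (1 / r n) ^ ?d)"
  proof
    fix n :: nat
    show "\<exists>Z. finite Z \<and> (1 \<le> n \<longrightarrow> (\<forall>x\<in>D. \<exists>z\<in>Z. dist x z < r n) \<and> real (card Z) \<le> C * (1 / r n) ^ ?d)"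
    proof (cases "1 \<le> n")
      case True
      with C(2) eps(3,5)[of n] show ?thesis by blast
    next
      case False
      then show ?thesis by (intro exI[of _ "{}"]) auto
    qed
  qed
  from choice[OF this] obtain Z where Z: "\<forall>n. finite (Z n) \<and>
      (1 \<le> n \<longrightarrow> (\<forall>x\<in>D. \<exists>z\<in>Z n. dist x z < r n) \<and> real (card (Z n)) \<le> C * (1 / r n) ^ ?d)"
    by (elim exE)
  define \<T> where "\<T> n = (\<lambda>(z, z'). tube_cover (\<epsilon> n) (r n) z z') ` (Z n \<times> Z n)" for n
  define \<beta> where "\<beta> = \<delta> * (\<alpha> * (real ?d - 1) + 1) - 1"
  define q where "q = 2 * (\<alpha> * \<delta> * real ?d)"
  have "0 < \<beta>" using \<delta> by (simp add: \<beta>_def)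
  have fin: "finite (\<T> n)" for n unfolding \<T>_def using Z by auto
  have borel: "T \<in> sets borel" if "T \<in> \<T> n" for T n
    using that unfolding \<T>_def tube_cover_def by (auto intro!: borel_open)
  have prob_T: "\<forall>\<^sub>F n in sequentially. \<forall>T\<in>\<T> n. \<forall>i\<ge>1. prob (X i -` T \<inter> space M)
      \<le> (5 * p\<^sub>2 * 4 ^ ?d) * real n powr (- 1 - \<beta>)"
    using eventually_ge_at_top[of 1]
  proof eventually_elim
    case (elim n)
    have "\<epsilon> n * r n ^ (?d - 1) = real n powr (- 1 - \<beta>)"
    proof -
      have "r n ^ (?d - 1) = r n powr real (?d - 1)" by (rule powr_realpow[symmetric, OF eps(3)[OF elim]])
      also have "real (?d - 1) = real ?d - 1" by (simp add: of_nat_diff DIM_positive Suc_leI)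
      also have "r n powr (real ?d - 1) = real n powr (- \<delta> * \<alpha> * (real ?d - 1))"
        by (simp add: r_def \<epsilon>_def powr_powr)
      finally have "\<epsilon> n * r n ^ (?d - 1) = real n powr (- \<delta> + - \<delta> * \<alpha> * (real ?d - 1))"
        by (simp only: \<epsilon>_def powr_add)
      also have "- \<delta> + - \<delta> * \<alpha> * (real ?d - 1) = - 1 - \<beta>" by (simp add: \<beta>_def algebra_simps)
      finally show ?thesis .
    qed
    then show ?case using prob_tube_cover[OF _ eps(3,4)[OF elim]] by (auto simp: \<T>_def)
  qed
  have card_T: "\<forall>\<^sub>F n in sequentially. real (card (\<T> n)) \<le> C\<^sup>2 * real n powr q"
    using eventually_ge_at_top[of 1]
  proof eventually_elim
    case (elim n)
    have "card (\<T> n) \<le> card (Z n \<times> Z n)" unfolding \<T>_def using Z by (intro card_image_le) auto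
    also have "\<dots> = card (Z n) * card (Z n)" by (rule card_cartesian_product)
    finally have "real (card (\<T> n)) \<le> real (card (Z n)) * real (card (Z n))"
      by (metis of_nat_le_iff of_nat_mult)
    also have "\<dots> \<le> (C * (1 / r n) ^ ?d) * (C * (1 / r n) ^ ?d)"
      using Z elim C(1) eps(3)[OF elim] by (intro mult_mono) auto
    also have "(1 / r n) ^ ?d = real n powr (\<alpha> * \<delta> * real ?d)"
    proof -
      have "r n = real n powr (- (\<alpha> * \<delta>))"
        unfolding r_def \<epsilon>_def powr_powr by (simp add: mult.commute)
      then have "1 / r n = real n powr (\<alpha> * \<delta>)" by (simp add: powr_minus_divide)
      then show ?thesis using elim by (simp add: powr_realpow[symmetric] powr_powr)
    qed
    also have "(C * real n powr (\<alpha> * \<delta> * real ?d)) * (C * real n powr (\<alpha> * \<delta> * real ?d)) = C\<^sup>2 * real n powr q"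
      by (simp add: q_def power2_eq_square powr_add[symmetric] mult.assoc mult.left_commute)
    finally show ?case .
  qed
  obtain K where K: "AE \<omega> in M. \<forall>\<^sub>F n in sequentially. \<forall>T\<in>\<T> n. card {i\<in>{1..n}. X i \<omega> \<in> T} \<le> K"
    by (rule few_sample_points[OF fin borel _ _ \<open>0 < \<beta>\<close> prob_T card_T]) (use p_pos in auto)
  show ?thesis
  proof (rule that[of K])
    show "AE \<omega> in M. \<forall>\<^sub>F n in sequentially. \<forall>p\<in>D. \<forall>q\<in>D. dist p q < real n powr (- \<delta>) \<longrightarrow>
      card {i\<in>{1..n}. infdist (X i \<omega>) (closed_segment p q) < (real n powr (- \<delta>)) powr \<alpha>} \<le> K"
      using K
    proof eventually_elim
      case (elim \<omega>)
      show ?case using elim eventually_ge_at_top[of 1]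
      proof eventually_elim
        case (elim n)
        show ?case
          unfolding \<epsilon>_def[symmetric] r_def[symmetric]
        proof (intro ballI impI)
          fix p q assume pq: "p \<in> D" "q \<in> D" "dist p q < \<epsilon> n"
          obtain z where z: "z \<in> Z n" "dist p z < r n" using Z elim(2) pq(1) by blast
          obtain z' where z': "z' \<in> Z n" "dist q z' < r n" using Z elim(2) pq(2) by blast
          note e = eps[OF elim(2)]
          have "dist z z' \<le> 3 * \<epsilon> n"
            using dist_triangle[of z z' p] dist_triangle[of p z' q] z(2) z'(2) pq(3) e(4)
            by (simp add: dist_commute)
          then have "{i\<in>{1..n}. infdist (X i \<omega>) (closed_segment p q) < r n}
              \<subseteq> {i\<in>{1..n}. X i \<omega> \<in> tube_cover (\<epsilon> n) (r n) z z'}"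
            using tube_subset_tube_cover[OF e(1,3) z(2) z'(2)] by auto
          then have "card {i\<in>{1..n}. infdist (X i \<omega>) (closed_segment p q) < r n}
              \<le> card {i\<in>{1..n}. X i \<omega> \<in> tube_cover (\<epsilon> n) (r n) z z'}"
            by (intro card_mono) auto
          also have "\<dots> \<le> K" using elim(1) z(1) z'(1) unfolding \<T>_def by blast
          finally show "card {i\<in>{1..n}. infdist (X i \<omega>) (closed_segment p q) < r n} \<le> K" .
        qed
      qed
    qed
  qed
qed

end

text \<open>The lower bound on the probability of a ball \<open>ball x r\<close> comes from the density on a smaller ball
  inside \<open>D\<close>, since much of \<open>ball x r\<close> may lie outside \<open>D\<close>.\<close>

lemma random_points_sample:
  fixes D :: "'a::euclidean_space set"
  assumes "convex_body D" and "random_points M D \<rho> X"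
  shows "\<exists>p\<^sub>1 p\<^sub>2. random_sample M D X p\<^sub>1 p\<^sub>2" and "AE \<omega> in M. \<forall>i\<ge>1. X i \<omega> \<in> D"
proof -
  let ?d = "DIM('a)" and ?V = "unit_ball_vol (real DIM('a))"
  have ps: "prob_space M" and ind: "prob_space.indep_vars M (\<lambda>_. borel) X {1..}"
    and dist: "\<And>i. 1 \<le> i \<Longrightarrow> distributed M lborel (X i) (\<lambda>x. ennreal (\<rho> x) * indicator D x)"
    using assms(2) by (auto simp: random_points_def)
  obtain c\<^sub>0 where c0: "0 < c\<^sub>0" "\<And>x. x \<in> D \<Longrightarrow> c\<^sub>0 \<le> \<rho> x" "\<And>x. x \<in> D \<Longrightarrow> \<rho> x \<le> inverse c\<^sub>0"
    using assms(2) unfolding random_points_def by blast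
  interpret prob_space M by (rule ps)
  have compact: "compact D" using convex_body_compact_convex[OF assms(1)] by simp
  obtain \<beta> where \<beta>: "0 < \<beta>" "\<And>x r. x \<in> D \<Longrightarrow> 0 < r \<Longrightarrow> r \<le> 1 \<Longrightarrow> \<exists>y. ball y (\<beta> * r) \<subseteq> D \<inter> ball x r"
    using convex_body_inner_balls[OF assms(1)] by metis
  have em: "emeasure M (X i -` B \<inter> space M) = (\<integral>\<^sup>+x. ennreal (\<rho> x) * indicator D x * indicator B x \<partial>lborel)"
    if "1 \<le> i" "B \<in> sets borel" for i B
    using distributed_emeasure[OF dist[OF that(1)], of B] that(2) by simp
  have meas: "X i -` B \<inter> space M \<in> events" if "1 \<le> i" "B \<in> sets borel" for i B
    using distributed_measurable[OF dist[OF that(1)]] that(2) by (auto intro: measurable_sets)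
  have upper: "prob (X i -` ball x r \<inter> space M) \<le> inverse c\<^sub>0 * ?V * r ^ ?d" if "1 \<le> i" "0 \<le> r" for i x r
  proof -
    have "emeasure M (X i -` ball x r \<inter> space M) = (\<integral>\<^sup>+y. ennreal (\<rho> y) * indicator D y * indicator (ball x r) y \<partial>lborel)"
      by (rule em) (use that in auto)
    also have "\<dots> \<le> (\<integral>\<^sup>+y. ennreal (inverse c\<^sub>0) * indicator (ball x r) y \<partial>lborel)"
      using c0(3) by (intro nn_integral_mono) (auto simp: indicator_def ennreal_leI)
    also have "\<dots> = ennreal (inverse c\<^sub>0) * emeasure lborel (ball x r)"
      by (rule nn_integral_cmult_indicator) auto
    also have "\<dots> = ennreal (inverse c\<^sub>0 * (?V * r ^ ?d))"
      using c0(1) that(2) by (simp add: emeasure_ball ennreal_mult[symmetric])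
    finally show ?thesis
      using c0(1) that(2) by (simp add: emeasure_eq_measure mult.assoc)
  qed
  have lower: "c\<^sub>0 * ?V * \<beta> ^ ?d * r ^ ?d \<le> prob (X i -` ball x r \<inter> space M)"
    if i: "1 \<le> i" and xr: "x \<in> D" "0 < r" "r \<le> 1" for i x r
  proof -
    obtain y where y: "ball y (\<beta> * r) \<subseteq> D \<inter> ball x r" using \<beta>(2)[OF xr] by blast
    have "ennreal (c\<^sub>0 * (?V * (\<beta> * r) ^ ?d)) = ennreal c\<^sub>0 * emeasure lborel (ball y (\<beta> * r))"
      using c0(1) \<beta>(1) xr(2) by (simp add: emeasure_ball ennreal_mult[symmetric])
    also have "\<dots> = (\<integral>\<^sup>+z. ennreal c\<^sub>0 * indicator (ball y (\<beta> * r)) z \<partial>lborel)"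
      by (rule nn_integral_cmult_indicator[symmetric]) auto
    also have "\<dots> \<le> (\<integral>\<^sup>+z. ennreal (\<rho> z) * indicator D z * indicator (ball y (\<beta> * r)) z \<partial>lborel)"
      using c0(2) y by (intro nn_integral_mono) (auto simp: indicator_def ennreal_leI)
    also have "\<dots> = emeasure M (X i -` ball y (\<beta> * r) \<inter> space M)"
      by (rule em[symmetric]) (use i in auto)
    also have "\<dots> \<le> emeasure M (X i -` ball x r \<inter> space M)"
      using y i by (intro emeasure_mono meas) auto
    finally have "c\<^sub>0 * (?V * (\<beta> * r) ^ ?d) \<le> prob (X i -` ball x r \<inter> space M)"
      by (simp add: emeasure_eq_measure)
    then show ?thesis by (simp add: power_mult_distrib mult.assoc)
  qed
  have "random_sample M D X (c\<^sub>0 * ?V * \<beta> ^ ?d) (inverse c\<^sub>0 * ?V)"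
    by unfold_locales
      (use ind lower upper c0(1) \<beta>(1) compact_imp_bounded[OF compact] in auto)
  then show "\<exists>p\<^sub>1 p\<^sub>2. random_sample M D X p\<^sub>1 p\<^sub>2" by blast
  have "AE \<omega> in M. X i \<omega> \<in> D" if "1 \<le> i" for i
  proof (rule AE_I')
    have Db: "- D \<in> sets borel" using compact_imp_closed[OF compact] by auto
    have "emeasure M (X i -` (- D) \<inter> space M) = (\<integral>\<^sup>+x. ennreal (\<rho> x) * indicator D x * indicator (- D) x \<partial>lborel)"
      by (rule em[OF that Db])
    also have "\<dots> = (\<integral>\<^sup>+x. 0 \<partial>(lborel :: 'a measure))" by (intro nn_integral_cong) (auto simp: indicator_def)
    finally show "X i -` (- D) \<inter> space M \<in> null_sets M" using meas[OF that Db] by (simp add: null_sets_def)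
  qed auto
  then show "AE \<omega> in M. \<forall>i\<ge>1. X i \<omega> \<in> D" by (simp add: AE_all_countable)
qed

section \<open>Discrete approximation of minimal paths by random points\<close>

text \<open>Subadditivity is convexity at the midpoint together with homogeneity, and the comparison of base
  points is the Lipschitz condition divided by \<open>m1 * norm v \<le> f y v\<close>.\<close>

lemma finsler_integrandI:
  fixes D :: "'a::euclidean_space set"
  assumes "convex_body D" "integrand 1 D f" "cond_Lip 1 D f"
  shows "\<exists>m1 m2 \<kappa>. finsler_integrand D f m1 m2 \<kappa>"
proof -
  have A0: "cond_A0 D f" and A1: "cond_A1 D f" and A2: "cond_A2 1 D f" and A3: "cond_A3 1 D f"
    using assms(2) by (auto simp: integrand_def)
  obtain m1 m2 where m: "0 < m1" "0 < m2"
    "\<And>x v. x \<in> D \<Longrightarrow> m1 * norm v \<le> f x v" "\<And>x v. x \<in> D \<Longrightarrow> f x v \<le> m2 * norm v"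
    using A3 by (auto simp: cond_A3_def)
  obtain c where c: "\<And>x y v. x \<in> D \<Longrightarrow> y \<in> D \<Longrightarrow> \<bar>f x v - f y v\<bar> \<le> c * norm (x - y) * norm v"
    using assms(3) by (auto simp: cond_Lip_def)
  have zero: "f x 0 = 0" if "x \<in> D" for x using m(3,4)[OF that, of 0] by simp
  have scale: "f x (l *\<^sub>R v) = l * f x v" if "x \<in> D" "0 \<le> l" for x l v
    using A2 that zero by (cases "l = 0") (auto simp: cond_A2_def)
  have "finsler_integrand D f m1 m2 (\<bar>c\<bar> / m1)"
  proof
    show "convex D" "compact D" using convex_body_compact_convex[OF assms(1)] by auto
    show "continuous_on (D \<times> UNIV) (\<lambda>(x, v). f x v)" using A0 by (simp add: cond_A0_def)
    show "f x (u + v) \<le> f x u + f x v" if "x \<in> D" for x u v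
    proof -
      have "convex_on UNIV (f x)" using A1 that by (simp add: cond_A1_def)
      then have "f x ((1 / 2) *\<^sub>R u + (1 / 2) *\<^sub>R v) \<le> 1 / 2 * f x u + 1 / 2 * f x v"
        using convex_onD[of UNIV "f x" "1 / 2" u v] by simp
      moreover have "f x (u + v) = 2 * f x ((1 / 2) *\<^sub>R u + (1 / 2) *\<^sub>R v)"
        using scale[OF that, of 2 "(1 / 2) *\<^sub>R u + (1 / 2) *\<^sub>R v"] by (simp add: scaleR_add_right)
      ultimately show ?thesis by simp
    qed
    show "f x v \<le> (1 + \<bar>c\<bar> / m1 * dist x y) * f y v" if "x \<in> D" "y \<in> D" for x y v
    proof -
      have "f x v \<le> f y v + c * norm (x - y) * norm v" using c[OF that, of v] by simp
      also have "c * norm (x - y) * norm v \<le> \<bar>c\<bar> * norm (x - y) * norm v"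
        by (intro mult_right_mono) auto
      also have "\<dots> \<le> \<bar>c\<bar> * norm (x - y) * (f y v / m1)"
        using m(1) m(3)[OF that(2), of v] by (intro mult_left_mono) (auto simp: field_simps)
      finally show ?thesis by (simp add: dist_norm algebra_simps)
    qed
  qed (use m scale in auto)
  then show ?thesis by blast
qed

lemma covering_scale_negligible:
  fixes \<epsilon> :: "nat \<Rightarrow> real"
  assumes "\<forall>n\<ge>1. \<epsilon> n > 0"
    and lim: "limsup (\<lambda>n. ereal (ln (real n) powr (1 / d) / real n powr (1 / d) * (1 / \<epsilon> n))) = 0"
    and "0 < A" "0 < c"
  shows "\<forall>\<^sub>F n in sequentially. A * (ln (real n) / real n) powr (1 / d) < c * \<epsilon> n"
proof -
  have "limsup (\<lambda>n. ereal (ln (real n) powr (1 / d) / real n powr (1 / d) * (1 / \<epsilon> n))) < ereal (c / A)"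
    unfolding lim using assms by simp
  from Limsup_lessD[OF this] show ?thesis
    using eventually_ge_at_top[of 1]
  proof eventually_elim
    case (elim n)
    have "0 < \<epsilon> n" using assms(1) elim(2) by simp
    have "(ln (real n) / real n) powr (1 / d) = ln (real n) powr (1 / d) / real n powr (1 / d)"
      by (rule powr_divide)
    moreover have "ln (real n) powr (1 / d) / real n powr (1 / d) * (1 / \<epsilon> n) < c / A"
      using elim(1) by simp
    ultimately have "(ln (real n) / real n) powr (1 / d) / \<epsilon> n < c / A" by simp
    then show ?case using \<open>0 < \<epsilon> n\<close> \<open>0 < A\<close> by (simp add: field_simps)
  qed
qed

text \<open>The covering scale of the sample is negligible compared with \<open>\<epsilon> n\<close>, so almost every realization
  gives graphs to which the deterministic convergence results apply.\<close>

theorem theorem2p7: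
  fixes D :: "'a::euclidean_space set"
    and f :: "'a \<Rightarrow> 'a \<Rightarrow> real"
    and a b :: 'a
    and M :: "'w measure"
    and X :: "nat \<Rightarrow> 'w \<Rightarrow> 'a"
    and \<rho> :: "'a \<Rightarrow> real"
    and \<epsilon> :: "nat \<Rightarrow> real"
  defines "\<Omega> \<equiv> lip_paths D a b"
    and "F \<equiv> path_cost f"
    and "H \<equiv> discrete_cost f"
    and "V \<equiv> (\<lambda>n \<omega>. graph_paths (vertices X a b n \<omega>) (\<epsilon> n) a b)"
  assumes "DIM('a) \<ge> 2"
    and "convex_body D" and "a \<in> D" and "b \<in> D"
    and "integrand 1 D f" and "cond_Lip 1 D f" and "cond_Hilb D f"
    and "random_points M D \<rho> X"
    and "\<forall>n\<ge>1. \<epsilon> n > 0" and "\<epsilon> \<longlonglongrightarrow> 0"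
    and "limsup (\<lambda>n. ereal (ln (real n) powr (1 / real DIM('a)) / real n powr (1 / real DIM('a)) * (1 / \<epsilon> n))) = 0"
  shows
    "argmin_set F \<Omega> \<noteq> {} \<and>
     (AE \<omega> in M.
        (\<forall>\<^sub>F n in sequentially. argmin_set H (V n \<omega>) \<noteq> {}) \<and>
        (\<lambda>n. INF v\<in>V n \<omega>. H v) \<longlonglongrightarrow> (INF \<gamma>\<in>\<Omega>. F \<gamma>)) \<and>
     (\<forall>(\<alpha>::real) (\<eta>::real) (\<delta>::real).
        cond_TrIneq D f \<longrightarrow> 1 < \<alpha> \<longrightarrow> \<alpha> < sqrt 2 \<longrightarrow> cond_Pythag \<alpha> D f \<longrightarrow>
        0 < \<eta> \<longrightarrow> \<eta> < 1 \<longrightarrow>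
        \<delta> > max (inverse ((2 - \<alpha>\<^sup>2) * \<eta> + real DIM('a))) (inverse (\<alpha> * (real DIM('a) - 1) + 1)) \<longrightarrow>
        (\<forall>n\<ge>1. \<epsilon> n = real n powr (- \<delta>)) \<longrightarrow>
        (AE \<omega> in M. \<forall>v :: nat \<Rightarrow> 'a list.
           (\<forall>\<^sub>F n in sequentially. v n \<in> argmin_set H (V n \<omega>)) \<longrightarrow>
           (\<forall>r :: nat \<Rightarrow> nat. strict_mono r \<longrightarrow>
              (\<exists>s :: nat \<Rightarrow> nat. strict_mono s \<and>
                (\<exists>\<gamma> \<in> argmin_set F \<Omega>.
                   uniform_limit {0..1} (\<lambda>k. interpolation (v (r (s k)))) \<gamma> sequentially \<and>
                   (\<lambda>k. d_haus (set (v (r (s k)))) (path_image \<gamma>)) \<longlonglongrightarrow> 0))) \<and>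
           (\<forall>\<gamma>. unique_minimizer D f a b \<gamma> \<longrightarrow>
              (\<lambda>n. d_haus (set (v n)) (path_image \<gamma>)) \<longlonglongrightarrow> 0)))"
proof -
  note defs = \<Omega>_def F_def H_def V_def
  let ?d = "real DIM('a)"
  obtain m1 m2 \<kappa> where "finsler_integrand D f m1 m2 \<kappa>"
    using finsler_integrandI[OF \<open>convex_body D\<close> \<open>integrand 1 D f\<close> \<open>cond_Lip 1 D f\<close>] by blast
  then interpret finsler_integrand D f m1 m2 \<kappa> .
  obtain p\<^sub>1 p\<^sub>2 where "random_sample M D X p\<^sub>1 p\<^sub>2"
    using random_points_sample(1)[OF \<open>convex_body D\<close> \<open>random_points M D \<rho> X\<close>] by blast
  then interpret S: random_sample M D X p\<^sub>1 p\<^sub>2 .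
  obtain U where "open U" "U \<noteq> {}" "D = closure U"
    using \<open>convex_body D\<close> by (auto simp: convex_body_def)
  then have "\<not> D \<subseteq> {a}"
    using closure_subset[of U] not_open_singleton[of a] by (metis order_trans subset_singletonD)
  then obtain q where q: "q \<in> D" "q \<noteq> a" by blast
  have \<epsilon>_pos: "\<forall>\<^sub>F n in sequentially. 0 < \<epsilon> n"
    unfolding eventually_sequentially using \<open>\<forall>n\<ge>1. \<epsilon> n > 0\<close> by blast
  let ?S = "\<lambda>n \<omega>. vertices X a b n \<omega>"
  have S_D: "?S n \<omega> \<subseteq> D" if "\<forall>i\<ge>1. X i \<omega> \<in> D" for n \<omega>
    using that \<open>a \<in> D\<close> \<open>b \<in> D\<close> by (auto simp: vertices_def)
  have S_ab: "a \<in> ?S n \<omega>" "b \<in> ?S n \<omega>" "finite (?S n \<omega>)" for n \<omega> by (auto simp: vertices_def)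
  obtain A where A: "0 < A" "AE \<omega> in M. \<forall>\<^sub>F n in sequentially. \<forall>x\<in>D. \<exists>i\<in>{1..n}.
      dist x (X i \<omega>) < A * (ln (real n) / real n) powr (1 / ?d)"
    by (rule S.sample_covers)
  have in_D: "AE \<omega> in M. \<forall>i\<ge>1. X i \<omega> \<in> D"
    by (rule random_points_sample(2)[OF \<open>convex_body D\<close> \<open>random_points M D \<rho> X\<close>])
  have cover: "\<forall>\<^sub>F n in sequentially. \<forall>x\<in>D. \<exists>y\<in>?S n \<omega>. dist x y < c * \<epsilon> n"
    if "\<forall>\<^sub>F n in sequentially. \<forall>x\<in>D. \<exists>i\<in>{1..n}. dist x (X i \<omega>) < A * (ln (real n) / real n) powr (1 / ?d)"
      and "0 < c" for c \<omega>
    using that(1) covering_scale_negligible[OF assms(13,15) A(1) that(2)]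
  proof eventually_elim
    case (elim n)
    show ?case
    proof
      fix x assume "x \<in> D"
      then obtain i where "i \<in> {1..n}" "dist x (X i \<omega>) < c * \<epsilon> n" using elim by force
      then show "\<exists>y\<in>?S n \<omega>. dist x y < c * \<epsilon> n" by (auto simp: vertices_def)
    qed
  qed
  have dense: "dense_graphs D f m1 m2 \<kappa> (\<lambda>n. ?S n \<omega>) \<epsilon> a b q"
    if "\<forall>\<^sub>F n in sequentially. \<forall>x\<in>D. \<exists>i\<in>{1..n}. dist x (X i \<omega>) < A * (ln (real n) / real n) powr (1 / ?d)"
      and "\<forall>i\<ge>1. X i \<omega> \<in> D" for \<omega>
    by unfold_locales (use S_D[OF that(2)] S_ab \<epsilon>_pos \<open>\<epsilon> \<longlonglongrightarrow> 0\<close> cover[OF that(1)] q in auto)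
  have part1: "AE \<omega> in M. (\<forall>\<^sub>F n in sequentially. argmin_set H (V n \<omega>) \<noteq> {}) \<and>
        (\<lambda>n. INF v\<in>V n \<omega>. H v) \<longlonglongrightarrow> (INF \<gamma>\<in>\<Omega>. F \<gamma>)"
    using A(2) in_D
  proof eventually_elim
    case (elim \<omega>)
    interpret G: dense_graphs D f m1 m2 \<kappa> "\<lambda>n. ?S n \<omega>" \<epsilon> a b q by (rule dense[OF elim])
    show ?case unfolding defs using G.discrete_minimum_tendsto by blast
  qed
  let ?conv = "\<lambda>(v :: nat \<Rightarrow> 'a list) (r :: nat \<Rightarrow> nat). \<exists>s :: nat \<Rightarrow> nat. strict_mono s \<and>
    (\<exists>\<gamma> \<in> argmin_set F \<Omega>.
       uniform_limit {0..1} (\<lambda>k. interpolation (v (r (s k)))) \<gamma> sequentially \<and>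
       (\<lambda>k. d_haus (set (v (r (s k)))) (path_image \<gamma>)) \<longlonglongrightarrow> 0)"
  have part2: "AE \<omega> in M. \<forall>v. (\<forall>\<^sub>F n in sequentially. v n \<in> argmin_set H (V n \<omega>)) \<longrightarrow>
      (\<forall>r. strict_mono r \<longrightarrow> ?conv v r) \<and>
      (\<forall>\<gamma>. unique_minimizer D f a b \<gamma> \<longrightarrow> (\<lambda>n. d_haus (set (v n)) (path_image \<gamma>)) \<longlonglongrightarrow> 0)"
    if \<alpha>: "1 < \<alpha>" "\<alpha> < sqrt 2" and pythag: "cond_Pythag \<alpha> D f"
      and \<delta>: "inverse (\<alpha> * (?d - 1) + 1) < \<delta>" and \<epsilon>_eq: "\<forall>n\<ge>1. \<epsilon> n = real n powr (- \<delta>)" for \<alpha> \<delta>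
  proof -
    have P: "0 < \<alpha> * (?d - 1) + 1" using \<alpha>(1) DIM_positive[where 'a='a] by (intro add_nonneg_pos mult_nonneg_nonneg) auto
    then have "0 < \<delta>" using \<delta> by (meson inverse_positive_iff_positive order_less_trans)
    have "1 < \<delta> * (\<alpha> * (?d - 1) + 1)" using \<delta> P by (simp add: inverse_eq_divide pos_divide_less_eq)
    then obtain K where K: "AE \<omega> in M. \<forall>\<^sub>F n in sequentially. \<forall>p\<in>D. \<forall>q\<in>D. dist p q < real n powr (- \<delta>) \<longrightarrow>
        card {i\<in>{1..n}. infdist (X i \<omega>) (closed_segment p q) < (real n powr (- \<delta>)) powr \<alpha>} \<le> K"
      by (rule S.tubes_contain_few_points[OF less_imp_le[OF \<alpha>(1)] \<open>0 < \<delta>\<close>])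
    show ?thesis
      using A(2) in_D K
    proof eventually_elim
      case (elim \<omega>)
      interpret G: dense_graphs D f m1 m2 \<kappa> "\<lambda>n. ?S n \<omega>" \<epsilon> a b q by (rule dense[OF elim(1,2)])
      have tube: "\<forall>\<^sub>F n in sequentially. \<forall>p\<in>D. \<forall>q\<in>D. dist p q < \<epsilon> n \<longrightarrow>
          card {x \<in> ?S n \<omega>. infdist x (closed_segment p q) < \<epsilon> n powr \<alpha>} \<le> K + 2"
        using elim(3) eventually_ge_at_top[of 1]
      proof eventually_elim
        case (elim n)
        have e: "\<epsilon> n = real n powr (- \<delta>)" using \<epsilon>_eq elim(2) by simp
        show ?case
        proof (intro ballI impI)
          fix p q assume pq: "p \<in> D" "q \<in> D" "dist p q < \<epsilon> n"
          let ?I = "{i\<in>{1..n}. infdist (X i \<omega>) (closed_segment p q) < \<epsilon> n powr \<alpha>}"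
          have "{x \<in> ?S n \<omega>. infdist x (closed_segment p q) < \<epsilon> n powr \<alpha>} \<subseteq> (\<lambda>i. X i \<omega>) ` ?I \<union> {a, b}"
            by (auto simp: vertices_def)
          then have "card {x \<in> ?S n \<omega>. infdist x (closed_segment p q) < \<epsilon> n powr \<alpha>}
              \<le> card ((\<lambda>i. X i \<omega>) ` ?I \<union> {a, b})" by (intro card_mono) auto
          also have "\<dots> \<le> card ((\<lambda>i. X i \<omega>) ` ?I) + card {a, b}" by (rule card_Un_le)
          also have "card ((\<lambda>i. X i \<omega>) ` ?I) \<le> card ?I" by (intro card_image_le) auto
          also have "card ?I \<le> K" using elim(1) pq unfolding e by blast
          also have "card {a, b} \<le> 2" by (simp add: card_insert_if)
          finally show "card {x \<in> ?S n \<omega>. infdist x (closed_segment p q) < \<epsilon> n powr \<alpha>} \<le> K + 2" by simp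
        qed
      qed
      show ?case
        unfolding defs
      proof (intro allI impI conjI)
        fix v :: "nat \<Rightarrow> 'a list"
        assume opt: "\<forall>\<^sub>F n in sequentially. v n \<in> argmin_set (discrete_cost f) (graph_paths (?S n \<omega>) (\<epsilon> n) a b)"
        have subseq: "?conv v r" if "strict_mono r" for r :: "nat \<Rightarrow> nat"
          unfolding defs by (rule G.optimal_paths_subsequence[OF \<alpha> pythag tube opt that])
        then show "\<exists>s. strict_mono s \<and> (\<exists>\<gamma>\<in>argmin_set (path_cost f) (lip_paths D a b).
            uniform_limit {0..1} (\<lambda>k. interpolation (v (r (s k)))) \<gamma> sequentially \<and>
            (\<lambda>k. d_haus (set (v (r (s k)))) (path_image \<gamma>)) \<longlonglongrightarrow> 0)"
          if "strict_mono r" for r :: "nat \<Rightarrow> nat" using that unfolding defs by blast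
        show "(\<lambda>n. d_haus (set (v n)) (path_image \<gamma>)) \<longlonglongrightarrow> 0" if "unique_minimizer D f a b \<gamma>" for \<gamma>
          by (rule d_haus_tendsto_unique_minimizer[OF subseq[unfolded defs] that])
      qed
    qed
  qed
  have "argmin_set F \<Omega> \<noteq> {}"
    unfolding defs using \<open>a \<in> D\<close> \<open>b \<in> D\<close> by (rule minimizer_exists)
  moreover note part1
  moreover have "inverse (\<alpha> * (?d - 1) + 1) < \<delta>"
    if "\<delta> > max (inverse ((2 - \<alpha>\<^sup>2) * \<eta> + ?d)) (inverse (\<alpha> * (?d - 1) + 1))" for \<alpha> \<eta> \<delta>
    using that by simp
  ultimately show ?thesis using part2 by (intro conjI allI impI) blast+
qed

end
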